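(* Let $f:\Omega\to\mathbb{R}$ be a scalar-valued (measurable) function, put $\mu=\int_\Omega f(x)\pi(x)\,dx$, and let $x^{(i)}_m$ ($i\ge 1$, $1\le m\le M$) be the samples of an MP-MCMC simulation as described in the context. Assume that the Markov chain $Z_i=(x^{(i)}_1,\dots,x^{(i)}_M)$, $i\ge1$, on $\Omega^M$ is positive Harris and well-behaved, as defined in the context. Then the central limit theorem holds: $$\sqrt{nM}\,\Big(\frac{1}{nM}\sum_{i=1}^n\sum_{m=1}^M f\big(x^{(i)}_m\big)-\mu\Big)\xrightarrow{\ \mathcal D\ }\mathcal N(0,\sigma^2)\quad (n\to\infty),$$ and the asymptotic variance of the sequence of values of $f$ along the samples is $$\sigma^2=\zeta^{(0)}+\frac{2}{M}\sum_{1\le \ell<m\le M}\zeta^{(0)}_{\ell,m}+\frac{2}{M}\sum_{k=1}^\infty\sum_{\ell,m=1}^M\zeta^{(k)}_{\ell,m},$$ where $\zeta^{(0)}=\operatorname{Var}_\pi(f(x))$, $\zeta^{(0)}_{\ell,m}=\operatorname{Cov}(f(x_\ell^{(i)}),f(x_m^{(i)}))$ and $\zeta^{(k)}_{\ell,m}=\operatorname{Cov}(f(x_\ell^{(i)}),f(x_m^{(i+k)}))$ for $i,k\in\mathbb{N}$, $\ell,m\in\{1,\dots,M\}$, the covariances being taken for the stationary chain (so that they do not depend on $i$).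
   Context: Let $d,N,M\in\mathbb{N}$, $\Omega\subset\mathbb{R}^d$, and let $\pi$ be a probability density (the target) on $\Omega$. For $y_{1:N+1}=(y_1,\dots,y_{N+1})\in\Omega^{N+1}$ write $y_{\setminus i}=(y_1,\dots,y_{i-1},y_{i+1},\dots,y_{N+1})$. A proposal kernel $\kappa$ assigns to each $y\in\Omega$ a probability density $\kappa(y,\cdot)$ on $\Omega^N$. For each $y_{1:N+1}$ let $A(i,j)=A(i,j\mid y_{1:N+1})$, $i,j=1,\dots,N+1$, be a stochastic matrix satisfying the balance condition $$\pi(y_i)\kappa(y_i,y_{\setminus i})=\sum_{j=1}^{N+1}\pi(y_j)\kappa(y_j,y_{\setminus j})A(j,i),\qquad i=1,\dots,N+1$$ (which holds in particular under detailed balance). MP-MCMC (multiple-proposal MCMC): start with $y_1\in\Omega$ and index $I=1$. In each iteration: (1) keep $y_I$ and draw $y_{\setminus I}\sim\kappa(y_I,\cdot)$; (2) put $I_0=I$ and, for $m=1,\dots,M$, draw $I_m$ from $A(I_{m-1},\cdot\mid y_{1:N+1})$ and output the accepted sample $x_m=y_{I_m}$; (3) set $I=I_M$ and continue. The standard choice is $A(i,j)=\pi(y_j)\kappa(y_j,y_{\setminus j})/\sum_{k=1}^{N+1}\pi(y_k)\kappa(y_k,y_{\setminus k})$ for all $i$, i.e. $I_1,\dots,I_M$ are drawn independently from the stationary distribution of the index given $y_{1:N+1}$. The $m$-th sample of iteration $i$ is $x_m^{(i)}$. The updates preserve the joint distribution $p(y_{1:N+1},I=i)=\frac1{N+1}\pi(y_i)\kappa(y_i,y_{\setminus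 i})$. The vectors $Z_i=(x^{(i)}_1,\dots,x^{(i)}_M)$ are regarded as a single Markov chain on $\Omega^M$; its stationary distribution is also denoted $p$, and under it each coordinate has law $\pi$. Positive Harris means Harris recurrent with an invariant probability distribution. Put $F(z)=\frac1M\sum_{m=1}^M f(x_m)$ for $z=(x_1,\dots,x_M)\in\Omega^M$, and let $\sigma_{F,n}^2$ be the variance of $\sqrt n\,\big(\frac1n\sum_{i=1}^nF(Z_i)-\mu\big)$. The chain is called well-behaved if the asymptotic variance $\sigma_F^2$ of the sequence $(F(Z_i))_{i\ge1}$ (the variance of the limiting normal law of $\sqrt n\,(\frac1n\sum_{i=1}^nF(Z_i)-\mu)$) can be expressed as the limit $\lim_{n\to\infty}\sigma_{F,n}^2$, and is well-defined and positive.
   Formalization: The covariance series can diverge for periodic chains, so its value is taken as a Cesàro sum; it is the ordinary sum whenever the series converges, and always for the standard choice of A. f is assumed square-integrable under π so that the variance and covariances exist. *)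

theory Defs
  imports "HOL-Probability.Probability"
begin

section \<open>Markov chains on a general state space\<close>

text \<open>The law, on the space of paths, of the chain with initial law \<open>\<mu>\<^sub>0\<close> and transition kernel
  \<open>K\<close> on the measurable space \<open>S\<close> (Ionescu-Tulcea construction).\<close>

definition path_law :: "'a measure \<Rightarrow> ('a \<Rightarrow> 'a measure) \<Rightarrow> 'a measure \<Rightarrow> (nat \<Rightarrow> 'a) measure" where
  "path_law S K \<mu>\<^sub>0 = projective_family.lim UNIV
     (Ionescu_Tulcea.CI (\<lambda>n \<omega>. case n of 0 \<Rightarrow> \<mu>\<^sub>0 | Suc k \<Rightarrow> K (\<omega> k)) (\<lambda>_. S)) (\<lambda>_. S)"

text \<open>\<open>P(X\<^sub>n\<^sub>+\<^sub>1 \<in> B | X\<^sub>0, \<dots>, X\<^sub>n) = K(X\<^sub>n, B)\<close>, with the conditional probability written out.\<close>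

definition markov_chain :: "'w measure \<Rightarrow> 'a measure \<Rightarrow> ('a \<Rightarrow> 'a measure) \<Rightarrow> (nat \<Rightarrow> 'w \<Rightarrow> 'a) \<Rightarrow> bool" where
  "markov_chain P S K X \<longleftrightarrow>
     K \<in> S \<rightarrow>\<^sub>M prob_algebra S \<and>
     (\<forall>n. X n \<in> P \<rightarrow>\<^sub>M S) \<and>
     (\<forall>n. \<forall>E \<in> sets (PiM {..n} (\<lambda>_. S)). \<forall>B \<in> sets S.
        emeasure P {\<omega> \<in> space P. (\<lambda>j\<in>{..n}. X j \<omega>) \<in> E \<and> X (Suc n) \<omega> \<in> B} =
        (\<integral>\<^sup>+\<omega>. indicator E (\<lambda>j\<in>{..n}. X j \<omega>) * emeasure (K (X n \<omega>)) B \<partial>P))"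

definition harris_recurrent :: "'a measure \<Rightarrow> ('a \<Rightarrow> 'a measure) \<Rightarrow> bool" where
  "harris_recurrent S K \<longleftrightarrow>
     K \<in> S \<rightarrow>\<^sub>M prob_algebra S \<and>
     (\<exists>\<phi>. sets \<phi> = sets S \<and> sigma_finite_measure \<phi> \<and> emeasure \<phi> (space S) \<noteq> 0 \<and>
        (\<forall>B \<in> sets S. emeasure \<phi> B > 0 \<longrightarrow>
           (\<forall>x \<in> space S. AE \<omega> in path_law S K (return S x). \<exists>\<^sub>\<infinity>n. \<omega> n \<in> B)))"

definition positive_harris :: "'a measure \<Rightarrow> ('a \<Rightarrow> 'a measure) \<Rightarrow> bool" where
  "positive_harris S K \<longleftrightarrow>
     harris_recurrent S K \<and> (\<exists>p \<in> space (prob_algebra S). p \<bind> K = p)"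

definition covariance :: "'w measure \<Rightarrow> ('w \<Rightarrow> real) \<Rightarrow> ('w \<Rightarrow> real) \<Rightarrow> real" where
  "covariance P X Y =
     (\<integral>\<omega>. (X \<omega> - (\<integral>\<omega>'. X \<omega>' \<partial>P)) * (Y \<omega> - (\<integral>\<omega>'. Y \<omega>' \<partial>P)) \<partial>P)"

text \<open>\<open>\<surd>n (1/n \<Sum>\<^sub>i X\<^sub>i - \<mu>)\<close> for the first \<open>n\<close> terms of the sequence \<open>X\<^sub>0, X\<^sub>1, \<dots>\<close>\<close>

definition normalized_mean :: "(nat \<Rightarrow> 'w \<Rightarrow> real) \<Rightarrow> real \<Rightarrow> nat \<Rightarrow> 'w \<Rightarrow> real" where
  "normalized_mean X \<mu> n \<omega> = sqrt (real n) * ((\<Sum>i<n. X i \<omega>) / real n - \<mu>)"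

abbreviation centered_normal :: "real \<Rightarrow> real measure" where
  "centered_normal \<sigma> \<equiv> density lborel (\<lambda>x. ennreal (normal_density 0 \<sigma> x))"

text \<open>The variance of the limiting normal law exists, is positive, and is the limit of the variances.
  This is used with \<open>P\<close> the law of the \<^emph>\<open>stationary\<close> chain.\<close>

definition well_behaved :: "'w measure \<Rightarrow> (nat \<Rightarrow> 'w \<Rightarrow> real) \<Rightarrow> real \<Rightarrow> bool" where
  "well_behaved P X \<mu> \<longleftrightarrow>
     (\<exists>\<sigma>>0. weak_conv_m (\<lambda>n. distr P borel (normalized_mean X \<mu> n)) (centered_normal \<sigma>) \<and>
            (\<lambda>n. prob_space.variance P (normalized_mean X \<mu> n)) \<longlonglongrightarrow> \<sigma>\<^sup>2)"

text \<open>Summation in the sense of Cesaro: the averages of the partial sums converge. A positive Harris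
  chain may be periodic; its series of autocovariances then need not converge in the ordinary sense
  although the variances of the normalized means do.\<close>

definition cesaro_sums :: "(nat \<Rightarrow> real) \<Rightarrow> real \<Rightarrow> bool" where
  "cesaro_sums a s \<longleftrightarrow> (\<lambda>n. (\<Sum>j<n. \<Sum>k<j. a k) / real n) \<longlonglongrightarrow> s"


section \<open>Multiple-proposal MCMC\<close>

text \<open>\<open>\<Omega>\<^sup>n\<close> as a measurable space; points are functions on \<open>{1..n}\<close>.\<close>

abbreviation Om :: "(real^'d) set \<Rightarrow> (real^'d) measure" where
  "Om \<Omega> \<equiv> restrict_space borel \<Omega>"

abbreviation Om_pow :: "(real^'d) set \<Rightarrow> nat \<Rightarrow> (nat \<Rightarrow> real^'d) measure" where
  "Om_pow \<Omega> n \<equiv> PiM {1..n} (\<lambda>_. Om \<Omega>)"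

abbreviation leb_pow :: "(real^'d) set \<Rightarrow> nat \<Rightarrow> (nat \<Rightarrow> real^'d) measure" where
  "leb_pow \<Omega> n \<equiv> PiM {1..n} (\<lambda>_. restrict_space lborel \<Omega>)"

definition target :: "(real^'d) set \<Rightarrow> (real^'d \<Rightarrow> real) \<Rightarrow> (real^'d) measure" where
  "target \<Omega> \<pi> = density (restrict_space lborel \<Omega>) (\<lambda>x. ennreal (\<pi> x))"

text \<open>\<open>del_at N i y\<close> is \<open>y\<^sub>\<setminus>\<^sub>i\<close>, re-indexed by \<open>{1..N}\<close>; \<open>ins_at N i x u\<close> is the \<open>y\<close> with
  \<open>y\<^sub>i = x\<close> and \<open>y\<^sub>\<setminus>\<^sub>i = u\<close>.\<close>

definition del_at :: "nat \<Rightarrow> nat \<Rightarrow> (nat \<Rightarrow> 'a) \<Rightarrow> nat \<Rightarrow> 'a" where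
  "del_at N i y = (\<lambda>j\<in>{1..N}. if j < i then y j else y (Suc j))"

definition ins_at :: "nat \<Rightarrow> nat \<Rightarrow> 'a \<Rightarrow> (nat \<Rightarrow> 'a) \<Rightarrow> nat \<Rightarrow> 'a" where
  "ins_at N i x u = (\<lambda>j\<in>{1..N+1}. if j < i then u j else if j = i then x else u (j - 1))"

text \<open>\<open>A y i j\<close> is \<open>A(i,j | y\<^sub>1\<^sub>:\<^sub>N\<^sub>+\<^sub>1)\<close>.\<close>

locale mp_mcmc =
  fixes \<Omega> :: "(real^'d) set"
    and \<pi> :: "real^'d \<Rightarrow> real"
    and N M :: nat
    and \<kappa> :: "real^'d \<Rightarrow> (nat \<Rightarrow> real^'d) \<Rightarrow> real"
    and A :: "(nat \<Rightarrow> real^'d) \<Rightarrow> nat \<Rightarrow> nat \<Rightarrow> real"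
  assumes N_pos: "N \<ge> 1" and M_pos: "M \<ge> 1"
    and Omega_borel: "\<Omega> \<in> sets borel"
    and target_measurable: "\<pi> \<in> borel_measurable (Om \<Omega>)"
    and target_nonneg: "\<And>x. x \<in> \<Omega> \<Longrightarrow> 0 \<le> \<pi> x"
    and target_density: "(\<integral>\<^sup>+x. ennreal (\<pi> x) \<partial>restrict_space lborel \<Omega>) = 1"
    and kernel_measurable: "(\<lambda>(x, u). \<kappa> x u) \<in> borel_measurable (Om \<Omega> \<Otimes>\<^sub>M Om_pow \<Omega> N)"
    and kernel_nonneg: "\<And>x u. x \<in> \<Omega> \<Longrightarrow> u \<in> space (Om_pow \<Omega> N) \<Longrightarrow> 0 \<le> \<kappa> x u"
    and kernel_density: "\<And>x. x \<in> \<Omega> \<Longrightarrow> (\<integral>\<^sup>+u. ennreal (\<kappa> x u) \<partial>leb_pow \<Omega> N) = 1"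
    and stoch_measurable:
      "\<And>i j. i \<in> {1..N+1} \<Longrightarrow> j \<in> {1..N+1} \<Longrightarrow> (\<lambda>y. A y i j) \<in> borel_measurable (Om_pow \<Omega> (N+1))"
    and stoch_nonneg:
      "\<And>y i j. y \<in> space (Om_pow \<Omega> (N+1)) \<Longrightarrow> i \<in> {1..N+1} \<Longrightarrow> j \<in> {1..N+1} \<Longrightarrow> 0 \<le> A y i j"
    and stoch_sum:
      "\<And>y i. y \<in> space (Om_pow \<Omega> (N+1)) \<Longrightarrow> i \<in> {1..N+1} \<Longrightarrow> (\<Sum>j=1..N+1. A y i j) = 1"
    and balance:
      "\<And>y i. y \<in> space (Om_pow \<Omega> (N+1)) \<Longrightarrow> i \<in> {1..N+1} \<Longrightarrow>
         \<pi> (y i) * \<kappa> (y i) (del_at N i y) =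
         (\<Sum>j=1..N+1. \<pi> (y j) * \<kappa> (y j) (del_at N j y) * A y j i)"

definition standard_choice ::
  "(real^'d) set \<Rightarrow> (real^'d \<Rightarrow> real) \<Rightarrow> nat \<Rightarrow> (real^'d \<Rightarrow> (nat \<Rightarrow> real^'d) \<Rightarrow> real) \<Rightarrow>
   ((nat \<Rightarrow> real^'d) \<Rightarrow> nat \<Rightarrow> nat \<Rightarrow> real) \<Rightarrow> bool" where
  "standard_choice \<Omega> \<pi> N \<kappa> A \<longleftrightarrow>
     (\<forall>y \<in> space (Om_pow \<Omega> (N+1)).
        (\<Sum>k=1..N+1. \<pi> (y k) * \<kappa> (y k) (del_at N k y)) > 0 \<longrightarrow>
        (\<forall>i \<in> {1..N+1}. \<forall>j \<in> {1..N+1}.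
           A y i j = \<pi> (y j) * \<kappa> (y j) (del_at N j y) /
                     (\<Sum>k=1..N+1. \<pi> (y k) * \<kappa> (y k) (del_at N k y))))"

text \<open>The state handed from one iteration to the next is \<open>(y\<^sub>I, I)\<close>. The record of one iteration is
  \<open>(y\<^sub>1\<^sub>:\<^sub>N\<^sub>+\<^sub>1, (I\<^sub>0, \<dots>, I\<^sub>M))\<close>.\<close>

abbreviation state_space :: "(real^'d) set \<Rightarrow> nat \<Rightarrow> ((real^'d) \<times> nat) measure" where
  "state_space \<Omega> N \<equiv> Om \<Omega> \<Otimes>\<^sub>M count_space {1..N+1}"

abbreviation index_paths :: "nat \<Rightarrow> nat \<Rightarrow> (nat \<Rightarrow> nat) set" where
  "index_paths N M \<equiv> {0..M} \<rightarrow>\<^sub>E {1..N+1}"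

abbreviation record_space ::
  "(real^'d) set \<Rightarrow> nat \<Rightarrow> nat \<Rightarrow> ((nat \<Rightarrow> real^'d) \<times> (nat \<Rightarrow> nat)) measure" where
  "record_space \<Omega> N M \<equiv> Om_pow \<Omega> (N+1) \<Otimes>\<^sub>M count_space (index_paths N M)"

definition proposal_law ::
  "(real^'d) set \<Rightarrow> nat \<Rightarrow> (real^'d \<Rightarrow> (nat \<Rightarrow> real^'d) \<Rightarrow> real) \<Rightarrow> (real^'d) \<times> nat \<Rightarrow>
   (nat \<Rightarrow> real^'d) measure" where
  "proposal_law \<Omega> N \<kappa> = (\<lambda>(x, i).
     distr (density (leb_pow \<Omega> N) (\<lambda>u. ennreal (\<kappa> x u))) (Om_pow \<Omega> (N+1)) (ins_at N i x))"

text \<open>\<open>(I\<^sub>0, \<dots>, I\<^sub>M)\<close> is a finite Markov chain with transition matrix \<open>A(\<cdot>,\<cdot> | y)\<close> started at \<open>I\<^sub>0 = i\<close>.\<close>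

definition index_law ::
  "nat \<Rightarrow> nat \<Rightarrow> (nat \<Rightarrow> nat \<Rightarrow> real) \<Rightarrow> nat \<Rightarrow> (nat \<Rightarrow> nat) measure" where
  "index_law N M a i = density (count_space (index_paths N M))
     (\<lambda>\<iota>. if \<iota> 0 = i then ennreal (\<Prod>m=1..M. a (\<iota> (m-1)) (\<iota> m)) else 0)"

definition mp_iteration ::
  "(real^'d) set \<Rightarrow> nat \<Rightarrow> nat \<Rightarrow> (real^'d \<Rightarrow> (nat \<Rightarrow> real^'d) \<Rightarrow> real) \<Rightarrow>
   ((nat \<Rightarrow> real^'d) \<Rightarrow> nat \<Rightarrow> nat \<Rightarrow> real) \<Rightarrow> (real^'d) \<times> nat \<Rightarrow>
   ((nat \<Rightarrow> real^'d) \<times> (nat \<Rightarrow> nat)) measure" where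
  "mp_iteration \<Omega> N M \<kappa> A s =
     proposal_law \<Omega> N \<kappa> s \<bind> (\<lambda>y.
     index_law N M (A y) (snd s) \<bind> (\<lambda>\<iota>.
     return (record_space \<Omega> N M) (y, \<iota>)))"

definition end_state :: "nat \<Rightarrow> (nat \<Rightarrow> 'a) \<times> (nat \<Rightarrow> nat) \<Rightarrow> 'a \<times> nat" where
  "end_state M = (\<lambda>(y, \<iota>). (y (\<iota> M), \<iota> M))"

text \<open>The samples \<open>(x\<^sub>1, \<dots>, x\<^sub>M) = (y\<^sub>I\<^sub>1, \<dots>, y\<^sub>I\<^sub>M)\<close> of one iteration.\<close>

definition batch :: "nat \<Rightarrow> (nat \<Rightarrow> 'a) \<times> (nat \<Rightarrow> nat) \<Rightarrow> nat \<Rightarrow> 'a" where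
  "batch M = (\<lambda>(y, \<iota>). \<lambda>m\<in>{1..M}. y (\<iota> m))"

text \<open>Law of the sequence of records when the initial \<open>(y\<^sub>I, I)\<close> has law \<open>\<nu>\<close>; the start in a fixed
  \<open>y\<^sub>1 \<in> \<Omega>\<close> with \<open>I = 1\<close> is the point mass \<open>\<nu> = return (state_space \<Omega> N) (y\<^sub>1, 1)\<close>.
  Iterations are numbered from 0.\<close>

definition mp_simulation ::
  "(real^'d) set \<Rightarrow> nat \<Rightarrow> nat \<Rightarrow> (real^'d \<Rightarrow> (nat \<Rightarrow> real^'d) \<Rightarrow> real) \<Rightarrow>
   ((nat \<Rightarrow> real^'d) \<Rightarrow> nat \<Rightarrow> nat \<Rightarrow> real) \<Rightarrow> ((real^'d) \<times> nat) measure \<Rightarrow>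
   (nat \<Rightarrow> (nat \<Rightarrow> real^'d) \<times> (nat \<Rightarrow> nat)) measure" where
  "mp_simulation \<Omega> N M \<kappa> A \<nu> = path_law (record_space \<Omega> N M)
     (\<lambda>w. mp_iteration \<Omega> N M \<kappa> A (end_state M w)) (\<nu> \<bind> mp_iteration \<Omega> N M \<kappa> A)"

text \<open>The stationary simulation: with \<open>I\<close> uniform, \<open>y\<^sub>I \<sim> \<pi>\<close> and \<open>y\<^sub>\<setminus>\<^sub>I \<sim> \<kappa>(y\<^sub>I, \<cdot>)\<close>, the pair
  \<open>(y\<^sub>1\<^sub>:\<^sub>N\<^sub>+\<^sub>1, I = i)\<close> has density \<open>1/(N+1) \<pi>(y\<^sub>i) \<kappa>(y\<^sub>i, y\<^sub>\<setminus>\<^sub>i)\<close>.\<close>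

definition stationary_simulation ::
  "(real^'d) set \<Rightarrow> (real^'d \<Rightarrow> real) \<Rightarrow> nat \<Rightarrow> nat \<Rightarrow> (real^'d \<Rightarrow> (nat \<Rightarrow> real^'d) \<Rightarrow> real) \<Rightarrow>
   ((nat \<Rightarrow> real^'d) \<Rightarrow> nat \<Rightarrow> nat \<Rightarrow> real) \<Rightarrow>
   (nat \<Rightarrow> (nat \<Rightarrow> real^'d) \<times> (nat \<Rightarrow> nat)) measure" where
  "stationary_simulation \<Omega> \<pi> N M \<kappa> A =
     mp_simulation \<Omega> N M \<kappa> A (target \<Omega> \<pi> \<Otimes>\<^sub>M uniform_count_measure {1..N+1})"

definition chain_Z ::
  "nat \<Rightarrow> nat \<Rightarrow> (nat \<Rightarrow> (nat \<Rightarrow> 'a) \<times> (nat \<Rightarrow> nat)) \<Rightarrow> nat \<Rightarrow> 'a" where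
  "chain_Z M i \<omega> = batch M (\<omega> i)"

abbreviation sample ::
  "nat \<Rightarrow> nat \<Rightarrow> nat \<Rightarrow> (nat \<Rightarrow> (nat \<Rightarrow> 'a) \<times> (nat \<Rightarrow> nat)) \<Rightarrow> 'a" where
  "sample M i m \<omega> \<equiv> chain_Z M i \<omega> m"

definition batch_mean :: "nat \<Rightarrow> ('a \<Rightarrow> real) \<Rightarrow> (nat \<Rightarrow> 'a) \<Rightarrow> real" where
  "batch_mean M f z = (\<Sum>m=1..M. f (z m)) / real M"

text \<open>The \<open>Z\<^sub>i\<close> form a Markov chain on \<open>\<Omega>\<^sup>M\<close> with one and the same transition kernel \<open>K\<close>, whatever
  the initial law of \<open>(y\<^sub>I, I)\<close>. (In general only the pairs \<open>(Z\<^sub>i, I)\<close> do.)\<close>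

definition Z_markov ::
  "(real^'d) set \<Rightarrow> nat \<Rightarrow> nat \<Rightarrow> (real^'d \<Rightarrow> (nat \<Rightarrow> real^'d) \<Rightarrow> real) \<Rightarrow>
   ((nat \<Rightarrow> real^'d) \<Rightarrow> nat \<Rightarrow> nat \<Rightarrow> real) \<Rightarrow>
   ((nat \<Rightarrow> real^'d) \<Rightarrow> (nat \<Rightarrow> real^'d) measure) \<Rightarrow> bool" where
  "Z_markov \<Omega> N M \<kappa> A K \<longleftrightarrow>
     (\<forall>\<nu> \<in> space (prob_algebra (state_space \<Omega> N)).
        markov_chain (mp_simulation \<Omega> N M \<kappa> A \<nu>) (Om_pow \<Omega> M) K (chain_Z M))"

text \<open>\<open>\<zeta>\<^sup>(\<^sup>k\<^sup>)\<^sub>\<ell>\<^sub>,\<^sub>m = Cov(f(x\<^sub>\<ell>\<^sup>(\<^sup>i\<^sup>)), f(x\<^sub>m\<^sup>(\<^sup>i\<^sup>+\<^sup>k\<^sup>)))\<close> under stationarity.\<close>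

definition zeta ::
  "(real^'d) set \<Rightarrow> (real^'d \<Rightarrow> real) \<Rightarrow> nat \<Rightarrow> nat \<Rightarrow> (real^'d \<Rightarrow> (nat \<Rightarrow> real^'d) \<Rightarrow> real) \<Rightarrow>
   ((nat \<Rightarrow> real^'d) \<Rightarrow> nat \<Rightarrow> nat \<Rightarrow> real) \<Rightarrow> (real^'d \<Rightarrow> real) \<Rightarrow>
   nat \<Rightarrow> nat \<Rightarrow> nat \<Rightarrow> nat \<Rightarrow> real" where
  "zeta \<Omega> \<pi> N M \<kappa> A f i k l m = covariance (stationary_simulation \<Omega> \<pi> N M \<kappa> A)
     (\<lambda>\<omega>. f (sample M i l \<omega>)) (\<lambda>\<omega>. f (sample M (i + k) m \<omega>))"

end

theory Submission
  imports Defs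
begin

text \<open>
  The samples of one iteration form a batch, and the normalized mean of all samples is \<open>\<surd>M\<close> times
  the normalized mean of the batch means \<open>F(Z\<^sub>i)\<close>. Well-behavedness is the central limit theorem for
  the stationary chain together with convergence of the variances, so two things remain.

  First, the limit law must not depend on the start. For a positive Harris chain, Garsia's maximal
  inequality and the absence of nontrivial invariant sets give a mean ergodic theorem; as the
  characteristic function of the normalized sum is asymptotically invariant under a time shift,
  it is asymptotically independent of the initial state (Eagleson's principle), which settles starts
  that are absolutely continuous with respect to the stationary law. From an arbitrary start the
  singular part of the law at time \<open>k\<close> lives on one null set \<open>D\<close> for all \<open>k\<close>; the chain leaves \<open>D\<close> by the
  Harris property and never returns, so the mass of the singular part tends to \<open>0\<close>.

  Second, expanding the variance of the stationary mean of \<open>n\<close> batches gives the lag-0 covariance plus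
  twice the \<open>n\<close>-th Cesaro mean of the partial sums of the autocovariances. Under the standard choice the
  chain alternates between resampling the index given the points and resampling the points given the
  index, two self-adjoint projections. The autocovariances are therefore nonnegative, and Cesaro
  summability of a nonnegative series is ordinary convergence.
\<close>

section \<open>Markov chains on a general state space\<close>

text \<open>Two chains are in play. The records are Markov by construction and carry the covariance
  computations; the vectors \<open>chain_Z\<close> are Markov by hypothesis and carry the Harris
  property, hence the ergodic argument. The stationary law of the second is the image of that of the
  first. A positive Harris chain may be periodic, so its n-step laws need not converge: forgetting
  of the start has to come from averages alone. Neither a rate of convergence nor a solution of the
  Poisson equation is at hand for a martingale approximation. All perturbations of the sum are
  therefore made inside the characteristic function, where a change d of the exponent costs at most
  \<open>min 2 |d|\<close>; such costs vanish under division by the square root of n by dominated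
  convergence, without any moment condition. The pointwise ergodic theorem is proved for averages of
  powers of the operator \<open>kop\<close> rather than for path averages, because Fatou's lemma
  makes their lower limit superharmonic, a property that Harris recurrence can exploit; L2
  convergence along paths then follows from the autocovariances.\<close>

lemma
  assumes "K \<in> S \<rightarrow>\<^sub>M prob_algebra S"
  shows prob_kernel_subprob: "K \<in> S \<rightarrow>\<^sub>M subprob_algebra S"
    and prob_kernel_prob_space: "\<And>x. x \<in> space S \<Longrightarrow> prob_space (K x)"
    and prob_kernel_sets: "\<And>x. x \<in> space S \<Longrightarrow> sets (K x) = sets S"
    and prob_kernel_space: "\<And>x. x \<in> space S \<Longrightarrow> space (K x) = space S"
proof -
  show K: "K \<in> S \<rightarrow>\<^sub>M subprob_algebra S"
    using assms by (rule measurable_prob_algebraD)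
  show "prob_space (K x)" if "x \<in> space S" for x
    using measurable_space[OF assms that] by (simp add: space_prob_algebra)
  show "sets (K x) = sets S" "space (K x) = space S" if "x \<in> space S" for x
    using subprob_measurableD[OF K that] by auto
qed

text \<open>The restriction to \<open>{..n}\<close> is the exact form in which
  \<open>markov_chain\<close> conditions on the history, so the two are exchanged by
  unfolding.\<close>

definition past :: "(nat \<Rightarrow> 'w \<Rightarrow> 'a) \<Rightarrow> nat \<Rightarrow> 'w \<Rightarrow> nat \<Rightarrow> 'a" where
  "past X n \<omega> = (\<lambda>j\<in>{..n}. X j \<omega>)"

lemma past_nth[simp]: "j \<le> n \<Longrightarrow> past X n \<omega> j = X j \<omega>"
  by (simp add: past_def)

lemma past_Suc: "(past X n \<omega>)(Suc n := X (Suc n) \<omega>) = past X (Suc n) \<omega>"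
  by (auto simp: fun_eq_iff le_Suc_eq past_def)

lemma past_measurable[measurable (raw)]:
  assumes "\<And>j. X j \<in> P \<rightarrow>\<^sub>M S"
  shows "past X n \<in> P \<rightarrow>\<^sub>M PiM {..n} (\<lambda>_. S)"
  unfolding past_def[abs_def] using assms by (intro measurable_restrict)

locale mchain =
  fixes P :: "'w measure" and S :: "'a measure" and K :: "'a \<Rightarrow> 'a measure" and X :: "nat \<Rightarrow> 'w \<Rightarrow> 'a"
  assumes mc: "markov_chain P S K X"
begin

lemma kernel: "K \<in> S \<rightarrow>\<^sub>M prob_algebra S"
  using mc by (simp add: markov_chain_def)

lemmas kernel_subprob[measurable] = prob_kernel_subprob[OF kernel]
  and kernel_prob = prob_kernel_prob_space[OF kernel]
  and kernel_sets = prob_kernel_sets[OF kernel]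
  and kernel_space = prob_kernel_space[OF kernel]

lemma X_measurable[measurable]: "X n \<in> P \<rightarrow>\<^sub>M S"
  using mc by (simp add: markov_chain_def)

lemma X_space: "\<omega> \<in> space P \<Longrightarrow> X n \<omega> \<in> space S"
  by (rule measurable_space[OF X_measurable])

lemma emeasure_kernel_measurable[measurable]:
  "B \<in> sets S \<Longrightarrow> (\<lambda>x. emeasure (K x) B) \<in> borel_measurable S"
  by (rule measurable_emeasure_kernel[OF kernel_subprob])

lemma nn_kernel_measurable[measurable]:
  "v \<in> borel_measurable S \<Longrightarrow> (\<lambda>x. \<integral>\<^sup>+y. v y \<partial>K x) \<in> borel_measurable S"
  by (rule measurable_compose[OF kernel_subprob nn_integral_measurable_subprob_algebra])

text \<open>The defining identity of \<open>markov_chain\<close> says that the images of two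
  weighted copies of \<open>P\<close> on the space of histories agree on every measurable
  \<open>E\<close>. They are therefore the same measure, and any nonnegative \<open>a\<close> has
  the same integral against both.\<close>

lemma step_indicator:
  assumes [measurable]: "a \<in> borel_measurable (PiM {..n} (\<lambda>_. S))" "B \<in> sets S"
  shows "(\<integral>\<^sup>+\<omega>. a (past X n \<omega>) * indicator B (X (Suc n) \<omega>) \<partial>P)
       = (\<integral>\<^sup>+\<omega>. a (past X n \<omega>) * emeasure (K (X n \<omega>)) B \<partial>P)"
proof -
  let ?S = "PiM {..n} (\<lambda>_. S)"
  let ?A = "distr (density P (\<lambda>\<omega>. indicator B (X (Suc n) \<omega>))) ?S (past X n)"
  let ?B = "distr (density P (\<lambda>\<omega>. emeasure (K (X n \<omega>)) B)) ?S (past X n)"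
  have eq: "?A = ?B"
  proof (rule measure_eqI)
    fix E assume "E \<in> sets ?A"
    then have E[measurable]: "E \<in> sets ?S" by simp
    have "emeasure ?A E = (\<integral>\<^sup>+\<omega>. indicator B (X (Suc n) \<omega>) * indicator (past X n -` E \<inter> space P) \<omega> \<partial>P)"
      by (simp add: emeasure_distr emeasure_density)
    also have "\<dots> = (\<integral>\<^sup>+\<omega>. indicator {\<omega> \<in> space P. past X n \<omega> \<in> E \<and> X (Suc n) \<omega> \<in> B} \<omega> \<partial>P)"
      by (intro nn_integral_cong) (auto split: split_indicator)
    also have "\<dots> = emeasure P {\<omega> \<in> space P. past X n \<omega> \<in> E \<and> X (Suc n) \<omega> \<in> B}"
      by (rule nn_integral_indicator) measurable
    also have "\<dots> = (\<integral>\<^sup>+\<omega>. indicator E (past X n \<omega>) * emeasure (K (X n \<omega>)) B \<partial>P)"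
      using mc E assms(2) unfolding markov_chain_def past_def by blast
    also have "\<dots> = (\<integral>\<^sup>+\<omega>. emeasure (K (X n \<omega>)) B * indicator (past X n -` E \<inter> space P) \<omega> \<partial>P)"
      by (intro nn_integral_cong) (auto split: split_indicator)
    also have "\<dots> = emeasure ?B E"
      by (simp add: emeasure_distr emeasure_density)
    finally show "emeasure ?A E = emeasure ?B E" .
  qed simp
  have "(\<integral>\<^sup>+\<omega>. a (past X n \<omega>) * indicator B (X (Suc n) \<omega>) \<partial>P) = (\<integral>\<^sup>+x. a x \<partial>?A)"
    by (simp add: nn_integral_distr nn_integral_density mult.commute)
  also have "\<dots> = (\<integral>\<^sup>+x. a x \<partial>?B)" by (simp only: eq)
  also have "\<dots> = (\<integral>\<^sup>+\<omega>. a (past X n \<omega>) * emeasure (K (X n \<omega>)) B \<partial>P)"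
    by (simp add: nn_integral_distr nn_integral_density mult.commute)
  finally show ?thesis .
qed

text \<open>Linearity and monotone convergence carry the Markov property from sets to nonnegative
  functions of the next state; both sides respect each constructor of
  \<open>borel_measurable_induct\<close>.\<close>

lemma step:
  assumes [measurable]: "a \<in> borel_measurable (PiM {..n} (\<lambda>_. S))" and v: "v \<in> borel_measurable S"
  shows "(\<integral>\<^sup>+\<omega>. a (past X n \<omega>) * v (X (Suc n) \<omega>) \<partial>P)
       = (\<integral>\<^sup>+\<omega>. a (past X n \<omega>) * (\<integral>\<^sup>+y. v y \<partial>K (X n \<omega>)) \<partial>P)"
  using v
proof (induction v rule: borel_measurable_induct)
  case (cong f g)
  have "(\<integral>\<^sup>+\<omega>. a (past X n \<omega>) * f (X (Suc n) \<omega>) \<partial>P) = (\<integral>\<^sup>+\<omega>. a (past X n \<omega>) * g (X (Suc n) \<omega>) \<partial>P)"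
    using cong(3) by (intro nn_integral_cong) (simp add: X_space)
  moreover have "(\<integral>\<^sup>+y. f y \<partial>K (X n \<omega>)) = (\<integral>\<^sup>+y. g y \<partial>K (X n \<omega>))" if "\<omega> \<in> space P" for \<omega>
    using cong(3) that by (intro nn_integral_cong) (simp add: X_space kernel_space)
  ultimately show ?case using cong(4) by (simp cong: nn_integral_cong)
next
  case (set B)
  then have [measurable]: "B \<in> sets S" by auto
  have "(\<integral>\<^sup>+y. indicator B y \<partial>K (X n \<omega>)) = emeasure (K (X n \<omega>)) B" if "\<omega> \<in> space P" for \<omega>
    using set that by (intro nn_integral_indicator) (simp add: X_space kernel_sets)
  then show ?case
    by (subst step_indicator) (auto intro!: nn_integral_cong simp: set)
next
  case (mult u c)
  note [measurable] = mult(2)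
  have "(\<integral>\<^sup>+y. c * u y \<partial>K (X n \<omega>)) = c * (\<integral>\<^sup>+y. u y \<partial>K (X n \<omega>))" if "\<omega> \<in> space P" for \<omega>
    using mult(2) that by (intro nn_integral_cmult) (simp add: X_space kernel_sets cong: measurable_cong_sets)
  then have "(\<integral>\<^sup>+\<omega>. a (past X n \<omega>) * (\<integral>\<^sup>+y. c * u y \<partial>K (X n \<omega>)) \<partial>P)
     = (\<integral>\<^sup>+\<omega>. c * (a (past X n \<omega>) * (\<integral>\<^sup>+y. u y \<partial>K (X n \<omega>))) \<partial>P)"
    by (intro nn_integral_cong) (simp add: mult_ac)
  also have "\<dots> = c * (\<integral>\<^sup>+\<omega>. a (past X n \<omega>) * u (X (Suc n) \<omega>) \<partial>P)"
    by (subst nn_integral_cmult) (simp_all add: mult.IH mult)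
  also have "\<dots> = (\<integral>\<^sup>+\<omega>. c * (a (past X n \<omega>) * u (X (Suc n) \<omega>)) \<partial>P)"
    by (subst nn_integral_cmult) simp_all
  finally show ?case by (simp add: mult_ac)
next
  case (add u v)
  note [measurable] = add(1) add(3)
  have "(\<integral>\<^sup>+y. v y + u y \<partial>K (X n \<omega>)) = (\<integral>\<^sup>+y. v y \<partial>K (X n \<omega>)) + (\<integral>\<^sup>+y. u y \<partial>K (X n \<omega>))" if "\<omega> \<in> space P" for \<omega>
    using add(1,3) that by (intro nn_integral_add) (simp_all add: X_space kernel_sets cong: measurable_cong_sets)
  then have "(\<integral>\<^sup>+\<omega>. a (past X n \<omega>) * (\<integral>\<^sup>+y. v y + u y \<partial>K (X n \<omega>)) \<partial>P)
     = (\<integral>\<^sup>+\<omega>. a (past X n \<omega>) * (\<integral>\<^sup>+y. v y \<partial>K (X n \<omega>)) + a (past X n \<omega>) * (\<integral>\<^sup>+y. u y \<partial>K (X n \<omega>)) \<partial>P)"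
    by (intro nn_integral_cong) (simp add: distrib_left)
  also have "\<dots> = (\<integral>\<^sup>+\<omega>. a (past X n \<omega>) * (v (X (Suc n) \<omega>) + u (X (Suc n) \<omega>)) \<partial>P)"
    by (simp add: nn_integral_add distrib_left add.IH)
  finally show ?case by simp
next
  case (seq U)
  note [measurable] = seq(1)
  have mono: "incseq (\<lambda>i. a (past X n \<omega>) * U i (X (Suc n) \<omega>))" for \<omega>
    using seq(3) by (auto simp: incseq_def le_fun_def intro!: mult_left_mono)
  have mono': "incseq (\<lambda>i. a (past X n \<omega>) * (\<integral>\<^sup>+y. U i y \<partial>K (X n \<omega>)))" for \<omega>
    using seq(3) by (auto simp: incseq_def le_fun_def intro!: mult_left_mono nn_integral_mono)
  have "(\<integral>\<^sup>+\<omega>. a (past X n \<omega>) * (SUP i. U i) (X (Suc n) \<omega>) \<partial>P)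
      = (\<integral>\<^sup>+\<omega>. (SUP i. a (past X n \<omega>) * U i (X (Suc n) \<omega>)) \<partial>P)"
    by (simp add: SUP_mult_left_ennreal image_comp)
  also have "\<dots> = (SUP i. \<integral>\<^sup>+\<omega>. a (past X n \<omega>) * U i (X (Suc n) \<omega>) \<partial>P)"
    using mono by (intro nn_integral_monotone_convergence_SUP) (auto simp: incseq_def le_fun_def)
  also have "\<dots> = (SUP i. \<integral>\<^sup>+\<omega>. a (past X n \<omega>) * (\<integral>\<^sup>+y. U i y \<partial>K (X n \<omega>)) \<partial>P)"
    by (simp add: seq.IH)
  also have "\<dots> = (\<integral>\<^sup>+\<omega>. (SUP i. a (past X n \<omega>) * (\<integral>\<^sup>+y. U i y \<partial>K (X n \<omega>))) \<partial>P)"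
    using mono' by (intro nn_integral_monotone_convergence_SUP[symmetric]) (auto simp: incseq_def le_fun_def)
  also have "\<dots> = (\<integral>\<^sup>+\<omega>. a (past X n \<omega>) * (\<integral>\<^sup>+y. (SUP i. U i) y \<partial>K (X n \<omega>)) \<partial>P)"
  proof (intro nn_integral_cong)
    fix \<omega> assume "\<omega> \<in> space P"
    then have "(\<integral>\<^sup>+y. (SUP i. U i y) \<partial>K (X n \<omega>)) = (SUP i. \<integral>\<^sup>+y. U i y \<partial>K (X n \<omega>))"
      using seq(1,3)
      by (intro nn_integral_monotone_convergence_SUP) (auto simp: X_space kernel_sets cong: measurable_cong_sets)
    then show "(SUP i. a (past X n \<omega>) * (\<integral>\<^sup>+y. U i y \<partial>K (X n \<omega>))) = a (past X n \<omega>) * (\<integral>\<^sup>+y. (SUP i. U i) y \<partial>K (X n \<omega>))"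
      by (simp add: SUP_mult_left_ennreal image_comp)
  qed
  finally show ?case .
qed

text \<open>On rectangles only the law of the history and the kernel are visible, which is what the
  uniqueness proof compares.\<close>

lemma emeasure_pair_law:
  assumes [measurable]: "E \<in> sets (PiM {..n} (\<lambda>_. S))" "B \<in> sets S"
  shows "emeasure (distr P (PiM {..n} (\<lambda>_. S) \<Otimes>\<^sub>M S) (\<lambda>\<omega>. (past X n \<omega>, X (Suc n) \<omega>))) (E \<times> B)
       = (\<integral>\<^sup>+x. indicator E x * emeasure (K (x n)) B \<partial>distr P (PiM {..n} (\<lambda>_. S)) (past X n))"
proof -
  have "emeasure (distr P (PiM {..n} (\<lambda>_. S) \<Otimes>\<^sub>M S) (\<lambda>\<omega>. (past X n \<omega>, X (Suc n) \<omega>))) (E \<times> B)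
      = emeasure P {\<omega> \<in> space P. past X n \<omega> \<in> E \<and> X (Suc n) \<omega> \<in> B}"
    by (subst emeasure_distr) (auto intro!: arg_cong2[where f = emeasure])
  also have "\<dots> = (\<integral>\<^sup>+\<omega>. indicator E (past X n \<omega>) * emeasure (K (X n \<omega>)) B \<partial>P)"
    using mc assms unfolding markov_chain_def past_def by blast
  also have "\<dots> = (\<integral>\<^sup>+x. indicator E x * emeasure (K (x n)) B \<partial>distr P (PiM {..n} (\<lambda>_. S)) (past X n))"
    by (subst nn_integral_distr) simp_all
  finally show ?thesis .
qed

lemma emeasure_law_Suc:
  assumes [measurable]: "B \<in> sets S"
  shows "emeasure (distr P S (X (Suc n))) B = (\<integral>\<^sup>+x. emeasure (K x) B \<partial>distr P S (X n))"
proof -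
  have "emeasure (distr P S (X (Suc n))) B = (\<integral>\<^sup>+\<omega>. indicator (X (Suc n) -` B \<inter> space P) \<omega> \<partial>P)"
    by (simp add: emeasure_distr)
  also have "\<dots> = (\<integral>\<^sup>+\<omega>. 1 * indicator B (X (Suc n) \<omega>) \<partial>P)"
    by (intro nn_integral_cong) (auto split: split_indicator)
  also have "\<dots> = (\<integral>\<^sup>+x. emeasure (K x) B \<partial>distr P S (X n))"
    by (subst step_indicator) (simp_all add: nn_integral_distr)
  finally show ?thesis .
qed

end

text \<open>The converse of \<open>step_indicator\<close>; the integral form is the one in which a
  modified chain (shifted, reweighted, or built from the path law) is checked.\<close>

lemma markov_chainI:
  assumes "K \<in> S \<rightarrow>\<^sub>M prob_algebra S" and [measurable]: "\<And>n. X n \<in> P \<rightarrow>\<^sub>M S"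
    and eq: "\<And>n a B. a \<in> borel_measurable (PiM {..n} (\<lambda>_. S)) \<Longrightarrow> B \<in> sets S \<Longrightarrow>
        (\<integral>\<^sup>+\<omega>. a (past X n \<omega>) * indicator B (X (Suc n) \<omega>) \<partial>P)
       = (\<integral>\<^sup>+\<omega>. a (past X n \<omega>) * emeasure (K (X n \<omega>)) B \<partial>P)"
  shows "markov_chain P S K X"
  unfolding markov_chain_def past_def[symmetric]
proof safe
  fix n :: nat and E B assume [measurable]: "E \<in> sets (PiM {..n} (\<lambda>_. S))" "B \<in> sets S"
  have "emeasure P {\<omega> \<in> space P. past X n \<omega> \<in> E \<and> X (Suc n) \<omega> \<in> B}
      = (\<integral>\<^sup>+\<omega>. indicator {\<omega> \<in> space P. past X n \<omega> \<in> E \<and> X (Suc n) \<omega> \<in> B} \<omega> \<partial>P)"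
    by (rule nn_integral_indicator[symmetric]) measurable
  also have "\<dots> = (\<integral>\<^sup>+\<omega>. indicator E (past X n \<omega>) * indicator B (X (Suc n) \<omega>) \<partial>P)"
    by (intro nn_integral_cong) (auto split: split_indicator)
  finally show "emeasure P {\<omega> \<in> space P. past X n \<omega> \<in> E \<and> X (Suc n) \<omega> \<in> B}
      = (\<integral>\<^sup>+\<omega>. indicator E (past X n \<omega>) * emeasure (K (X n \<omega>)) B \<partial>P)"
    by (subst (asm) eq) simp_all
qed (use assms in auto)

context mchain begin

text \<open>A function of the shifted history is a function of the longer original history, through
  the re-indexing \<open>?r\<close>.\<close>

lemma markov_chain_shift: "markov_chain P S K (\<lambda>n. X (n + k))"
proof (rule markov_chainI[OF kernel])
  fix n :: nat and a :: "(nat \<Rightarrow> 'a) \<Rightarrow> ennreal" and B :: "'a set" assume [measurable]: "a \<in> borel_measurable (PiM {..n} (\<lambda>_. S))" "B \<in> sets S"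
  let ?r = "\<lambda>x. \<lambda>j\<in>{..n}. x (j + k)"
  have "?r \<in> PiM {..n + k} (\<lambda>_. S) \<rightarrow>\<^sub>M PiM {..n} (\<lambda>_. S)"
    by (intro measurable_restrict measurable_component_singleton) auto
  then have [measurable]: "(\<lambda>x. a (?r x)) \<in> borel_measurable (PiM {..n + k} (\<lambda>_. S))" by simp
  have "?r (past X (n + k) \<omega>) = past (\<lambda>n. X (n + k)) n \<omega>" for \<omega>
    by (auto simp: fun_eq_iff past_def)
  then show "(\<integral>\<^sup>+\<omega>. a (past (\<lambda>n. X (n + k)) n \<omega>) * indicator B (X (Suc n + k) \<omega>) \<partial>P)
       = (\<integral>\<^sup>+\<omega>. a (past (\<lambda>n. X (n + k)) n \<omega>) * emeasure (K (X (n + k) \<omega>)) B \<partial>P)"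
    using step_indicator[of "\<lambda>x. a (?r x)" "n + k" B] by simp
qed simp

text \<open>A weight that depends on the initial state alone can be absorbed into the function
  \<open>a\<close> of the history, so reweighting changes the initial law and leaves the kernel
  intact.\<close>

lemma markov_chain_density:
  assumes [measurable]: "r \<in> borel_measurable S"
  shows "markov_chain (density P (\<lambda>\<omega>. r (X 0 \<omega>))) S K X"
proof (rule markov_chainI[OF kernel])
  fix n :: nat and a :: "(nat \<Rightarrow> 'a) \<Rightarrow> ennreal" and B :: "'a set" assume [measurable]: "a \<in> borel_measurable (PiM {..n} (\<lambda>_. S))" "B \<in> sets S"
  have [measurable]: "(\<lambda>x. a x * r (x 0)) \<in> borel_measurable (PiM {..n} (\<lambda>_. S))" by simp
  have "past X n \<in> density P (\<lambda>\<omega>. r (X 0 \<omega>)) \<rightarrow>\<^sub>M PiM {..n} (\<lambda>_. S)" by simp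
  then show "(\<integral>\<^sup>+\<omega>. a (past X n \<omega>) * indicator B (X (Suc n) \<omega>) \<partial>density P (\<lambda>\<omega>. r (X 0 \<omega>)))
       = (\<integral>\<^sup>+\<omega>. a (past X n \<omega>) * emeasure (K (X n \<omega>)) B \<partial>density P (\<lambda>\<omega>. r (X 0 \<omega>)))"
    using step_indicator[of "\<lambda>x. a x * r (x 0)" n B]
    by (simp add: nn_integral_density mult_ac)
qed simp

end

text \<open>Induction on the horizon: the law of the history and the kernel fix the joint law with
  the next state on rectangles, hence everywhere. The measures are only finite, because the lemma is
  applied to chains restricted to an event, whose mass may be below 1.\<close>

lemma markov_chain_law_unique:
  assumes "markov_chain P S K X" "markov_chain Q S K Y"
    and fin: "finite_measure P" and init: "distr P S (X 0) = distr Q S (Y 0)"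
  shows "distr P (PiM {..n} (\<lambda>_. S)) (past X n) = distr Q (PiM {..n} (\<lambda>_. S)) (past Y n)"
proof (induction n)
  interpret X: mchain P S K X by standard fact
  interpret Y: mchain Q S K Y by standard fact
  let ?S = "\<lambda>n. PiM {..n::nat} (\<lambda>_. S)"
  {
    case 0
    let ?e = "\<lambda>x. \<lambda>j\<in>{..0::nat}. x"
    have [measurable]: "?e \<in> S \<rightarrow>\<^sub>M ?S 0" by (rule measurable_restrict) simp
    have "distr P (?S 0) (past X 0) = distr (distr P S (X 0)) (?S 0) ?e"
      by (subst distr_distr) (auto simp: comp_def past_def fun_eq_iff intro!: distr_cong)
    moreover have "distr Q (?S 0) (past Y 0) = distr (distr Q S (Y 0)) (?S 0) ?e"
      by (subst distr_distr) (auto simp: comp_def past_def fun_eq_iff intro!: distr_cong)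
    ultimately show ?case by (simp add: init)
  next
    case (Suc n)
    let ?T = "?S n \<Otimes>\<^sub>M S"
    let ?p = "distr P ?T (\<lambda>\<omega>. (past X n \<omega>, X (Suc n) \<omega>))"
    let ?q = "distr Q ?T (\<lambda>\<omega>. (past Y n \<omega>, Y (Suc n) \<omega>))"
    let ?u = "\<lambda>(x, y). x(Suc n := y)"
    have u[measurable]: "?u \<in> ?T \<rightarrow>\<^sub>M ?S (Suc n)"
      unfolding split_beta
      by (rule measurable_fun_upd[where J = "{..n}"]) auto
    interpret P: finite_measure P by fact
    have "?p = ?q"
    proof (rule measure_eqI_generator_eq[where E = "{a \<times> b |a b. a \<in> sets (?S n) \<and> b \<in> sets S}"
          and \<Omega> = "space ?T" and A = "\<lambda>_. space ?T"])
      show "Int_stable {a \<times> b |a b. a \<in> sets (?S n) \<and> b \<in> sets S}"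
        by (rule Int_stable_pair_measure_generator)
      show "{a \<times> b |a b. a \<in> sets (?S n) \<and> b \<in> sets S} \<subseteq> Pow (space ?T)"
        using pair_measure_closed[of "?S n" S] by (simp add: space_pair_measure)
      fix C assume "C \<in> {a \<times> b |a b. a \<in> sets (?S n) \<and> b \<in> sets S}"
      then obtain E B where C: "C = E \<times> B" and [measurable]: "E \<in> sets (?S n)" "B \<in> sets S" by auto
      show "emeasure ?p C = emeasure ?q C"
        unfolding C by (simp add: X.emeasure_pair_law Y.emeasure_pair_law Suc)
    next
      show "sets ?p = sigma_sets (space ?T) {a \<times> b |a b. a \<in> sets (?S n) \<and> b \<in> sets S}"
        "sets ?q = sigma_sets (space ?T) {a \<times> b |a b. a \<in> sets (?S n) \<and> b \<in> sets S}"
        by (simp_all add: sets_pair_measure space_pair_measure)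
      show "range (\<lambda>_. space ?T) \<subseteq> {a \<times> b |a b. a \<in> sets (?S n) \<and> b \<in> sets S}"
        by (auto simp: space_pair_measure)
      show "emeasure ?p (space ?T) \<noteq> \<infinity>"
        by (subst emeasure_distr) (auto simp: P.emeasure_eq_measure)
    qed auto
    \<comment> \<open>Updating the history at \<open>Suc n\<close> turns the pair into the longer
      history, so the equality of pair laws is pushed forward by \<open>?u\<close>.\<close>
    then have "distr ?p (?S (Suc n)) ?u = distr ?q (?S (Suc n)) ?u" by simp
    then show ?case
      by (simp add: distr_distr comp_def past_Suc)
  }
qed

text \<open>Translates the Ionescu-Tulcea limit into the vocabulary of \<open>markov_chain\<close>:
  the marginals of the limit on initial segments are the finite constructions
  \<open>IT.C 0 n\<close>, and the last factor of each is \<open>K\<close> at the previous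
  coordinate.\<close>

lemma markov_chain_path_law:
  assumes K: "K \<in> S \<rightarrow>\<^sub>M prob_algebra S" and \<mu>: "\<mu>\<^sub>0 \<in> space (prob_algebra S)"
  shows "markov_chain (path_law S K \<mu>\<^sub>0) S K (\<lambda>n \<omega>. \<omega> n)"
    and "prob_space (path_law S K \<mu>\<^sub>0)"
    and "distr (path_law S K \<mu>\<^sub>0) S (\<lambda>\<omega>. \<omega> 0) = \<mu>\<^sub>0"
    and "sets (path_law S K \<mu>\<^sub>0) = sets (PiM UNIV (\<lambda>_. S))"
proof -
  let ?P = "\<lambda>n \<omega>. case n of 0 \<Rightarrow> \<mu>\<^sub>0 | Suc k \<Rightarrow> K (\<omega> k)"
  note [measurable] = prob_kernel_subprob[OF K]
  have \<mu>': "prob_space \<mu>\<^sub>0" "sets \<mu>\<^sub>0 = sets S" using \<mu> by (auto simp: space_prob_algebra)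
  interpret IT: Ionescu_Tulcea ?P "\<lambda>_. S"
  proof (rule Ionescu_Tulcea.intro)
    show "?P i \<in> PiM {0..<i} (\<lambda>_. S) \<rightarrow>\<^sub>M subprob_algebra S" for i
    proof (cases i)
      case 0
      have "\<mu>\<^sub>0 \<in> space (subprob_algebra S)"
        using \<mu>' by (auto simp: space_subprob_algebra prob_space_imp_subprob_space)
      then show ?thesis by (simp add: 0)
    next
      case (Suc k)
      show ?thesis unfolding Suc
        by (auto intro!: measurable_compose[OF _ prob_kernel_subprob[OF K]] measurable_component_singleton)
    qed
    show "prob_space (?P i x)" if "x \<in> space (PiM {0..<i} (\<lambda>_. S))" for i x
      using that \<mu>' by (cases i) (auto simp: space_PiM PiE_iff intro!: prob_kernel_prob_space[OF K])
  qed
  let ?L = "path_law S K \<mu>\<^sub>0"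
  let ?C = "\<lambda>n. IT.C 0 n (\<lambda>_. undefined)"
  let ?S = "\<lambda>n. PiM {0..<n::nat} (\<lambda>_. S)"
  have L: "?L = IT.PF.lim" unfolding path_law_def ..
  have u: "(\<lambda>_. undefined) \<in> space (?S 0)" by (simp add: space_PiM)
  \<comment> \<open>\<open>IT.CI\<close> projects a finite construction to an index set; on an
    initial segment the projection is trivial.\<close>
  have CI: "IT.CI {0..<n} = ?C n" for n
  proof (rule measure_eqI)
    fix E assume "E \<in> sets (IT.CI {0..<n})"
    then have "E \<in> sets (?S n)" by (simp add: IT.CI_def)
    then show "emeasure (IT.CI {0..<n}) E = emeasure (?C n) E"
      using sets.sets_into_space[of E "?S n"]
      by (subst IT.emeasure_CI[of _ n]) (simp_all add: space_PiM prod_emb_id)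
  qed (simp add: IT.CI_def IT.sets_C[OF u])
  have C: "distr ?L (?S n) (\<lambda>\<omega>. restrict \<omega> {0..<n}) = ?C n" for n
    unfolding L by (subst IT.distr_lim) (simp_all add: CI)
  show sets: "sets ?L = sets (PiM UNIV (\<lambda>_. S))" unfolding L by simp
  have restr[measurable]: "(\<lambda>\<omega>. restrict \<omega> {0..<n}) \<in> ?L \<rightarrow>\<^sub>M ?S n" for n
    using sets by (auto intro!: measurable_restrict simp: measurable_component_singleton cong: measurable_cong_sets)
  have comp[measurable]: "(\<lambda>\<omega>. \<omega> n) \<in> ?L \<rightarrow>\<^sub>M S" for n
    using sets by (simp add: measurable_component_singleton cong: measurable_cong_sets)
  show "prob_space ?L"
  proof (rule prob_space_distrD[OF restr])
    show "prob_space (distr ?L (?S 0) (\<lambda>\<omega>. restrict \<omega> {0..<0}))"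
      unfolding C by (rule IT.prob_space_C[OF u])
  qed
  have eP: "emeasure (distr (?C (Suc n)) S (\<lambda>\<omega>. \<omega> n)) B = (\<integral>\<^sup>+\<omega>. emeasure (?P n \<omega>) B \<partial>?C n)"
    if [measurable]: "B \<in> sets S" for n B
  proof -
    have "emeasure (distr (?C (Suc n)) S (\<lambda>\<omega>. \<omega> n)) B = (\<integral>\<^sup>+\<omega>. indicator B (\<omega> n) \<partial>?C (Suc n))"
      using IT.sets_C[OF u, of "Suc n"]
      by (subst nn_integral_indicator[symmetric], simp, subst nn_integral_distr)
         (auto cong: measurable_cong_sets)
    also have "\<dots> = (\<integral>\<^sup>+\<omega>. (\<integral>\<^sup>+x. indicator B (x n) \<partial>IT.eP n \<omega>) \<partial>?C n)"
      using IT.sets_C[OF u, of n] IT.measurable_eP[of n]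
      by (simp, subst nn_integral_bind[where B = "?S (Suc n)"]) (auto cong: measurable_cong_sets)
    also have "\<dots> = (\<integral>\<^sup>+\<omega>. emeasure (?P n \<omega>) B \<partial>?C n)"
    proof (intro nn_integral_cong)
      fix \<omega> assume "\<omega> \<in> space (?C n)"
      then have \<omega>: "\<omega> \<in> space (?S n)" by (simp add: IT.space_C[OF u])
      then show "(\<integral>\<^sup>+x. indicator B (x n) \<partial>IT.eP n \<omega>) = emeasure (?P n \<omega>) B"
        using IT.sets_P[OF \<omega>] by (subst IT.nn_integral_eP) (auto simp: that)
    qed
    finally show ?thesis .
  qed
  show "distr ?L S (\<lambda>\<omega>. \<omega> 0) = \<mu>\<^sub>0"
  proof (rule measure_eqI)
    fix B assume "B \<in> sets (distr ?L S (\<lambda>\<omega>. \<omega> 0))"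
    then have B[measurable]: "B \<in> sets S" by simp
    have "distr ?L S (\<lambda>\<omega>. \<omega> 0) = distr (?C (Suc 0)) S (\<lambda>\<omega>. \<omega> 0)"
      unfolding C[symmetric] by (subst distr_distr) (auto simp: comp_def)
    then show "emeasure (distr ?L S (\<lambda>\<omega>. \<omega> 0)) B = emeasure \<mu>\<^sub>0 B"
      using eP[OF B, of 0] by (simp add: nn_integral_return u)
  qed (simp add: \<mu>')
  show "markov_chain ?L S K (\<lambda>n \<omega>. \<omega> n)"
  proof (rule markov_chainI[OF K comp])
    fix n :: nat and a :: "(nat \<Rightarrow> 'a) \<Rightarrow> ennreal" and B :: "'a set"
    assume a: "a \<in> borel_measurable (PiM {..n} (\<lambda>_. S))" and B[measurable]: "B \<in> sets S"
    have [simp]: "{..n} = {0..<Suc n}" by auto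
    have [measurable]: "a \<in> borel_measurable (?S (Suc n))" using a by simp
    have p: "past (\<lambda>n \<omega>. \<omega> n) n \<omega> = restrict \<omega> {0..<Suc n}" for \<omega> :: "nat \<Rightarrow> 'a"
      by (simp add: past_def restrict_def fun_eq_iff)
    have "(\<integral>\<^sup>+\<omega>. a (restrict \<omega> {0..<Suc n}) * indicator B (\<omega> (Suc n)) \<partial>?L)
        = (\<integral>\<^sup>+\<omega>. a (restrict \<omega> {0..<Suc n}) * indicator B (\<omega> (Suc n)) \<partial>?C (Suc (Suc n)))"
      unfolding C[symmetric] by (subst nn_integral_distr) (auto simp: Int_absorb1 restrict_restrict)
    also have "\<dots> = (\<integral>\<^sup>+\<omega>. (\<integral>\<^sup>+x. a (restrict x {0..<Suc n}) * indicator B (x (Suc n)) \<partial>IT.eP (Suc n) \<omega>) \<partial>?C (Suc n))"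
      using IT.sets_C[OF u, of "Suc n"] IT.measurable_eP[of "Suc n"]
      by (subst IT.C.simps(2), subst nn_integral_bind[where B = "?S (Suc (Suc n))"]) 
        (auto cong: measurable_cong_sets intro!: borel_measurable_times_ennreal measurable_compose[OF measurable_restrict_subset])
    also have "\<dots> = (\<integral>\<^sup>+\<omega>. a \<omega> * emeasure (K (\<omega> n)) B \<partial>?C (Suc n))"
    proof (intro nn_integral_cong)
      fix \<omega> assume "\<omega> \<in> space (?C (Suc n))"
      then have \<omega>: "\<omega> \<in> space (?S (Suc n))" by (simp only: IT.space_C[OF u] add_0)
      have r: "restrict (fun_upd \<omega> (Suc n) x) {0..<Suc n} = \<omega>" for x
        using \<omega> by (auto simp: space_PiM PiE_iff extensional_def fun_eq_iff)
      have "(\<integral>\<^sup>+x. a (restrict x {0..<Suc n}) * indicator B (x (Suc n)) \<partial>IT.eP (Suc n) \<omega>)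
         = (\<integral>\<^sup>+x. a \<omega> * indicator B x \<partial>K (\<omega> n))"
        by (subst IT.nn_integral_eP[OF \<omega>])
          (auto simp: r intro!: borel_measurable_times_ennreal measurable_compose[OF measurable_restrict_subset] simp del: restrict_fupd)
      also have "\<dots> = a \<omega> * emeasure (K (\<omega> n)) B"
        using IT.sets_P[OF \<omega>] B by (intro nn_integral_cmult_indicator) simp
      finally show "(\<integral>\<^sup>+x. a (restrict x {0..<Suc n}) * indicator B (x (Suc n)) \<partial>IT.eP (Suc n) \<omega>)
         = a \<omega> * emeasure (K (\<omega> n)) B" .
    qed
    also have "\<dots> = (\<integral>\<^sup>+\<omega>. a (restrict \<omega> {0..<Suc n}) * emeasure (K (\<omega> n)) B \<partial>?L)"
      unfolding C[symmetric] by (subst nn_integral_distr) auto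
    finally show "(\<integral>\<^sup>+\<omega>. a (past (\<lambda>n \<omega>. \<omega> n) n \<omega>) * indicator B (\<omega> (Suc n)) \<partial>?L)
       = (\<integral>\<^sup>+\<omega>. a (past (\<lambda>n \<omega>. \<omega> n) n \<omega>) * emeasure (K (\<omega> n)) B \<partial>?L)"
      by (simp only: p)
  qed
qed

context mchain begin

text \<open>Invariance turns a \<open>p\<close>-null set \<open>B\<close> into a set that
  \<open>p\<close>-almost every state enters with probability 0. A law dominated by \<open>p\<close>
  inherits this, and one step later it gives no mass to \<open>B\<close>.\<close>

lemma absolutely_continuous_law:
  assumes p[measurable_cong]: "sets p = sets S"
    and inv: "\<And>B. B \<in> sets S \<Longrightarrow> emeasure p B = (\<integral>\<^sup>+x. emeasure (K x) B \<partial>p)"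
    and init: "absolutely_continuous p (distr P S (X 0))"
  shows "absolutely_continuous p (distr P S (X n))"
proof (induction n)
  case 0 show ?case by (rule init)
next
  case (Suc n)
  show ?case
    unfolding absolutely_continuous_def
  proof safe
    fix B assume "B \<in> null_sets p"
    then have B[measurable]: "B \<in> sets S" and "emeasure p B = 0" by (auto simp: null_sets_def p)
    then have "(\<integral>\<^sup>+x. emeasure (K x) B \<partial>p) = 0" using inv by simp
    then have "AE x in p. emeasure (K x) B = 0" by (subst (asm) nn_integral_0_iff_AE) auto
    then have "AE x in distr P S (X n). emeasure (K x) B = 0"
      using Suc p by (intro absolutely_continuous_AE[of "distr P S (X n)" p]) auto
    then have "emeasure (distr P S (X (Suc n))) B = 0"
      by (simp add: emeasure_law_Suc nn_integral_0_iff_AE)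
    then show "B \<in> null_sets (distr P S (X (Suc n)))" by (simp add: null_sets_def)
  qed
qed

end

text \<open>Powers of the kernel killed outside \<open>C\<close>: the value at x is the probability
  of lying in \<open>C\<close> at all times 0 to n after a start at x. It depends on the kernel
  only, which lets chains with different starts be compared.\<close>

definition confinement :: "('a \<Rightarrow> 'a measure) \<Rightarrow> 'a set \<Rightarrow> nat \<Rightarrow> 'a \<Rightarrow> ennreal" where
  "confinement K C n = ((\<lambda>v x. indicator C x * (\<integral>\<^sup>+y. v y \<partial>K x)) ^^ n) (indicator C)"

context mchain begin

lemma emeasure_stay:
  assumes C[measurable]: "C \<in> sets S"
  shows "confinement K C n \<in> borel_measurable S"
    and "emeasure P {\<omega> \<in> space P. \<forall>j\<le>n. X j \<omega> \<in> C} = (\<integral>\<^sup>+x. confinement K C n x \<partial>distr P S (X 0))"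
proof -
  let ?W = "\<lambda>v x. indicator C x * (\<integral>\<^sup>+y. v y \<partial>K x)"
  have W: "(?W ^^ n) v \<in> borel_measurable S" if v: "v \<in> borel_measurable S" for n v
    by (induction n) (auto simp: v)
  show "confinement K C n \<in> borel_measurable S"
    unfolding confinement_def by (rule W) simp
  \<comment> \<open>The terminal function \<open>v\<close> is left arbitrary, so that the last step
    can be integrated out and absorbed into a new terminal function.\<close>
  have *: "(\<integral>\<^sup>+\<omega>. (\<Prod>j<n. indicator C (X j \<omega>)) * v (X n \<omega>) \<partial>P) = (\<integral>\<^sup>+\<omega>. (?W ^^ n) v (X 0 \<omega>) \<partial>P)"
    if v[measurable]: "v \<in> borel_measurable S" for n v
    using v
  proof (induction n arbitrary: v)
    case (Suc n)
    note [measurable] = Suc(2)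
    have "(\<integral>\<^sup>+\<omega>. (\<Prod>j<Suc n. indicator C (X j \<omega>)) * v (X (Suc n) \<omega>) \<partial>P)
        = (\<integral>\<^sup>+\<omega>. (\<Prod>j<Suc n. indicator C (past X n \<omega> j)) * v (X (Suc n) \<omega>) \<partial>P)"
      by (intro nn_integral_cong arg_cong2[where f = "(*)"] prod.cong) auto
    also have "\<dots> = (\<integral>\<^sup>+\<omega>. (\<Prod>j<Suc n. indicator C (past X n \<omega> j)) * (\<integral>\<^sup>+y. v y \<partial>K (X n \<omega>)) \<partial>P)"
      by (rule step) (auto intro!: borel_measurable_prod_ennreal measurable_compose[OF measurable_component_singleton])
    also have "\<dots> = (\<integral>\<^sup>+\<omega>. (\<Prod>j<Suc n. indicator C (X j \<omega>)) * (\<integral>\<^sup>+y. v y \<partial>K (X n \<omega>)) \<partial>P)"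
      by (intro nn_integral_cong arg_cong2[where f = "(*)"] prod.cong) auto
    also have "\<dots> = (\<integral>\<^sup>+\<omega>. (\<Prod>j<n. indicator C (X j \<omega>)) * ?W v (X n \<omega>) \<partial>P)"
      by (simp add: mult_ac)
    also have "\<dots> = (\<integral>\<^sup>+\<omega>. (?W ^^ n) (?W v) (X 0 \<omega>) \<partial>P)"
      by (rule Suc.IH) simp
    finally show ?case by (simp only: funpow_Suc_right comp_def)
  qed simp
  have "emeasure P {\<omega> \<in> space P. \<forall>j\<le>n. X j \<omega> \<in> C}
      = (\<integral>\<^sup>+\<omega>. indicator {\<omega> \<in> space P. \<forall>j\<le>n. X j \<omega> \<in> C} \<omega> \<partial>P)"
    by (rule nn_integral_indicator[symmetric]) measurable
  also have "\<dots> = (\<integral>\<^sup>+\<omega>. (\<Prod>j<n. indicator C (X j \<omega>)) * indicator C (X n \<omega>) \<partial>P)"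
  proof (intro nn_integral_cong)
    fix \<omega> assume \<omega>: "\<omega> \<in> space P"
    have "(\<Prod>j<n. indicator C (X j \<omega>)) * indicator C (X n \<omega>) = (\<Prod>j\<le>n. indicator C (X j \<omega>) :: ennreal)"
      by (simp add: lessThan_Suc_atMost[symmetric])
    then show "indicator {\<omega> \<in> space P. \<forall>j\<le>n. X j \<omega> \<in> C} \<omega>
        = (\<Prod>j<n. indicator C (X j \<omega>)) * (indicator C (X n \<omega>) :: ennreal)"
      using \<omega> by (auto simp: indicator_def)
  qed
  also have "\<dots> = (\<integral>\<^sup>+x. confinement K C n x \<partial>distr P S (X 0))"
    using W[of "indicator C" n]
    by (subst *) (simp_all add: confinement_def nn_integral_distr)
  finally show "emeasure P {\<omega> \<in> space P. \<forall>j\<le>n. X j \<omega> \<in> C} = (\<integral>\<^sup>+x. confinement K C n x \<partial>distr P S (X 0))" .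
qed

text \<open>The Harris property is about deterministic starts; monotone limits of the confinement
  probabilities carry it over to an arbitrary chain with the same kernel.\<close>

lemma confined_tendsto_0:
  assumes fin: "finite_measure P" and C[measurable]: "C \<in> sets S"
    and hit: "\<And>x. x \<in> space S \<Longrightarrow> AE \<omega> in path_law S K (return S x). \<exists>n. \<omega> n \<notin> C"
  shows "(\<lambda>n. emeasure P {\<omega> \<in> space P. \<forall>j\<le>n. X j \<omega> \<in> C}) \<longlonglongrightarrow> 0"
    and "AE \<omega> in P. \<exists>n. X n \<omega> \<notin> C"
proof -
  interpret finite_measure P by fact
  \<comment> \<open>From a fixed start the staying events decrease to the event of never leaving
    \<open>C\<close>, which has probability 0 by \<open>hit\<close>; \<open>confinement\<close>
    gives their probabilities.\<close>
  have pt: "(\<lambda>n. confinement K C n x) \<longlonglongrightarrow> 0" "\<And>n. confinement K C n x \<le> 1" if x: "x \<in> space S" for x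
  proof -
    have "return S x \<in> space (prob_algebra S)"
      using x by (simp add: space_prob_algebra prob_space_return)
    note L = markov_chain_path_law[OF kernel this]
    let ?L = "path_law S K (return S x)"
    interpret L: mchain ?L S K "\<lambda>n \<omega>. \<omega> n" by standard (rule L)
    interpret LP: prob_space ?L by (rule L)
    have eq: "confinement K C n x = emeasure ?L {\<omega> \<in> space ?L. \<forall>j\<le>n. \<omega> j \<in> C}" for n
      using L.emeasure_stay[OF C, of n] by (simp add: L(3) nn_integral_return x)
    have "(\<lambda>n. emeasure ?L {\<omega> \<in> space ?L. \<forall>j\<le>n. \<omega> j \<in> C})
        \<longlonglongrightarrow> emeasure ?L (\<Inter>n. {\<omega> \<in> space ?L. \<forall>j\<le>n. \<omega> j \<in> C})"
      by (intro Lim_emeasure_decseq) (auto simp: decseq_def)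
    also have "emeasure ?L (\<Inter>n. {\<omega> \<in> space ?L. \<forall>j\<le>n. \<omega> j \<in> C}) = 0"
    proof -
      have "(\<Inter>n. {\<omega> \<in> space ?L. \<forall>j\<le>n. \<omega> j \<in> C}) = {\<omega> \<in> space ?L. \<not> (\<exists>n. \<omega> n \<notin> C)}" by auto
      moreover have "{\<omega> \<in> space ?L. \<not> (\<exists>n. \<omega> n \<notin> C)} \<in> null_sets ?L"
        using hit[OF x] by (subst AE_iff_null[symmetric]) auto
      ultimately show ?thesis by auto
    qed
    finally show "(\<lambda>n. confinement K C n x) \<longlonglongrightarrow> 0" by (simp add: eq)
    show "confinement K C n x \<le> 1" for n
      by (simp add: eq LP.emeasure_le_1)
  qed
  \<comment> \<open>Integration of the pointwise limits over the initial law, a finite measure, for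
    which the constant 1 is a dominating function.\<close>
  have "(\<lambda>n. \<integral>\<^sup>+x. confinement K C n x \<partial>distr P S (X 0)) \<longlonglongrightarrow> (\<integral>\<^sup>+x. 0 \<partial>distr P S (X 0))"
  proof (rule nn_integral_dominated_convergence[where w = "\<lambda>_. 1"])
    show "(\<integral>\<^sup>+x. 1 \<partial>distr P S (X 0)) < \<infinity>"
      by (subst nn_integral_distr) (simp_all add: less_top[symmetric])
    show "AE x in distr P S (X 0). confinement K C j x \<le> 1" for j
      by (rule AE_I2) (simp add: pt)
    show "AE x in distr P S (X 0). (\<lambda>n. confinement K C n x) \<longlonglongrightarrow> 0"
      by (rule AE_I2) (simp add: pt)
  qed (auto simp: emeasure_stay(1)[OF C])
  then show lim: "(\<lambda>n. emeasure P {\<omega> \<in> space P. \<forall>j\<le>n. X j \<omega> \<in> C}) \<longlonglongrightarrow> 0"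
    by (simp add: emeasure_stay(2)[OF C])
  have "(\<lambda>n. emeasure P {\<omega> \<in> space P. \<forall>j\<le>n. X j \<omega> \<in> C})
      \<longlonglongrightarrow> emeasure P (\<Inter>n. {\<omega> \<in> space P. \<forall>j\<le>n. X j \<omega> \<in> C})"
    by (intro Lim_emeasure_decseq) (auto simp: decseq_def)
  with lim have "emeasure P (\<Inter>n. {\<omega> \<in> space P. \<forall>j\<le>n. X j \<omega> \<in> C}) = 0"
    by (rule LIMSEQ_unique[rotated])
  moreover have "(\<Inter>n. {\<omega> \<in> space P. \<forall>j\<le>n. X j \<omega> \<in> C}) = {\<omega> \<in> space P. \<not> (\<exists>n. X n \<omega> \<notin> C)}" by auto
  ultimately have "{\<omega> \<in> space P. \<not> (\<exists>n. X n \<omega> \<notin> C)} \<in> null_sets P" by (auto simp: null_sets_def)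
  then show "AE \<omega> in P. \<exists>n. X n \<omega> \<notin> C" by (subst AE_iff_null) auto
qed

end

section \<open>Bounded functions and the Markov operator on them\<close>

definition bounded_on :: "'a measure \<Rightarrow> real \<Rightarrow> ('a \<Rightarrow> real) \<Rightarrow> bool" where
  "bounded_on S C v \<longleftrightarrow> v \<in> borel_measurable S \<and> (\<forall>x\<in>space S. \<bar>v x\<bar> \<le> C)"

lemma bounded_onD:
  assumes "bounded_on S C v"
  shows "v \<in> borel_measurable S" "\<And>x. x \<in> space S \<Longrightarrow> \<bar>v x\<bar> \<le> C"
  using assms by (auto simp: bounded_on_def)

lemma bounded_on_add: "bounded_on S C u \<Longrightarrow> bounded_on S D v \<Longrightarrow> bounded_on S (C + D) (\<lambda>x. u x + v x)"
  unfolding bounded_on_def by (auto intro!: abs_triangle_ineq[THEN order_trans] add_mono)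

lemma bounded_on_diff: "bounded_on S C u \<Longrightarrow> bounded_on S D v \<Longrightarrow> bounded_on S (C + D) (\<lambda>x. u x - v x)"
  unfolding bounded_on_def by (auto intro!: abs_triangle_ineq4[THEN order_trans] add_mono)

lemma bounded_on_const: "bounded_on S \<bar>c\<bar> (\<lambda>x. c)"
  unfolding bounded_on_def by auto

lemma bounded_on_sum:
  "(\<And>i. i \<in> I \<Longrightarrow> bounded_on S C (v i)) \<Longrightarrow> bounded_on S (real (card I) * C) (\<lambda>x. \<Sum>i\<in>I. v i x)"
  unfolding bounded_on_def by (auto intro!: borel_measurable_sum order_trans[OF sum_abs] sum_bounded_above)

lemma (in finite_measure) integrable_bounded_on:
  "bounded_on S C v \<Longrightarrow> sets M = sets S \<Longrightarrow> integrable M v"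
  unfolding bounded_on_def
  by (intro integrable_const_bound[where B = C]) (auto dest: sets_eq_imp_space_eq cong: measurable_cong_sets)

lemma (in finite_measure) integrable_bounded_on_compose:
  assumes "bounded_on S C v" and [measurable]: "X \<in> M \<rightarrow>\<^sub>M S"
  shows "integrable M (\<lambda>\<omega>. v (X \<omega>))"
proof -
  have [measurable]: "v \<in> borel_measurable S" using assms(1) by (rule bounded_onD)
  show ?thesis
    using assms by (intro integrable_const_bound[where B = C])
      (auto intro!: AE_I2 bounded_onD(2)[OF assms(1)] measurable_space[OF assms(2)])
qed

context mchain begin

definition kop :: "('a \<Rightarrow> real) \<Rightarrow> 'a \<Rightarrow> real" where
  "kop v x = (\<integral>y. v y \<partial>K x)"

lemma integrable_kernel: "bounded_on S C v \<Longrightarrow> x \<in> space S \<Longrightarrow> integrable (K x) v"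
  using kernel_prob kernel_sets
  by (intro finite_measure.integrable_bounded_on) (auto simp: prob_space_def)

lemma kop_bounded: 
  assumes "bounded_on S C v" shows "bounded_on S C (kop v)"
proof -
  have v: "v \<in> borel_measurable S" using assms by (rule bounded_onD)
  have "kop v \<in> borel_measurable S"
    unfolding kop_def
    by (rule measurable_compose[OF kernel_subprob integral_measurable_subprob_algebra[OF v]])
  moreover have "\<bar>kop v x\<bar> \<le> C" if x: "x \<in> space S" for x
  proof -
    interpret Kx: prob_space "K x" using kernel_prob[OF x] .
    have "\<bar>kop v x\<bar> \<le> (\<integral>y. \<bar>v y\<bar> \<partial>K x)"
      unfolding kop_def by (rule integral_abs_bound)
    also have "\<dots> \<le> (\<integral>y. C \<partial>K x)"
      using integrable_kernel[OF assms x] bounded_onD(2)[OF assms] kernel_space[OF x]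
      by (intro integral_mono) auto
    finally show ?thesis by (simp add: Kx.prob_space)
  qed
  ultimately show ?thesis by (simp add: bounded_on_def)
qed

lemma kop_power_bounded: "bounded_on S C v \<Longrightarrow> bounded_on S C ((kop ^^ k) v)"
  by (induction k) (auto intro: kop_bounded)

lemma kop_mono:
  assumes "bounded_on S C u" "bounded_on S D v" "x \<in> space S" "\<And>y. y \<in> space S \<Longrightarrow> u y \<le> v y"
  shows "kop u x \<le> kop v x"
  unfolding kop_def using assms integrable_kernel kernel_space by (intro integral_mono) auto

lemma kop_sum:
  assumes "\<And>i. i \<in> I \<Longrightarrow> bounded_on S C (v i)" "x \<in> space S"
  shows "kop (\<lambda>y. \<Sum>i\<in>I. v i y) x = (\<Sum>i\<in>I. kop (v i) x)"
  unfolding kop_def using assms integrable_kernel by (intro Bochner_Integration.integral_sum) auto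

lemma kop_cong: "x \<in> space S \<Longrightarrow> (\<And>y. y \<in> space S \<Longrightarrow> u y = v y) \<Longrightarrow> kop u x = kop v x"
  unfolding kop_def by (intro Bochner_Integration.integral_cong) (auto simp: kernel_space)

text \<open>\<open>K x\<close> has mass 1, so constants are fixed by the operator.\<close>

lemma kop_affine:
  assumes v: "bounded_on S C v" and x: "x \<in> space S"
  shows "kop (\<lambda>y. a * v y + b) x = a * kop v x + b"
proof -
  interpret Kx: prob_space "K x" by (rule kernel_prob[OF x])
  show ?thesis
    unfolding kop_def using integrable_kernel[OF v x] Kx.prob_space
    by (subst Bochner_Integration.integral_add) auto
qed

lemma kop_power_affine:
  assumes v: "bounded_on S C v" and "x \<in> space S"
  shows "(kop ^^ k) (\<lambda>y. a * v y + b) x = a * (kop ^^ k) v x + b"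
  using assms(2)
proof (induction k arbitrary: x)
  case (Suc k)
  have "(kop ^^ Suc k) (\<lambda>y. a * v y + b) x = kop (\<lambda>y. a * (kop ^^ k) v y + b) x"
    using Suc by (auto intro: kop_cong)
  also have "\<dots> = a * kop ((kop ^^ k) v) x + b"
    by (rule kop_affine[OF kop_power_bounded[OF v] Suc(2)])
  finally show ?case by simp
qed simp

lemma nn_kop:
  assumes "bounded_on S C v" "\<And>y. y \<in> space S \<Longrightarrow> 0 \<le> v y" "x \<in> space S"
  shows "(\<integral>\<^sup>+y. ennreal (v y) \<partial>K x) = ennreal (kop v x)"
  unfolding kop_def using assms integrable_kernel kernel_space
  by (intro nn_integral_eq_integral) auto

end

locale prob_chain = mchain P S K X + prob_space P for P S K and X :: "nat \<Rightarrow> 'w \<Rightarrow> 'a"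
begin

lemma step_real_nonneg:
  assumes a: "bounded_on (PiM {..n} (\<lambda>_. S)) C a" and v: "bounded_on S D v"
    and nn: "\<And>x. x \<in> space (PiM {..n} (\<lambda>_. S)) \<Longrightarrow> 0 \<le> a x" "\<And>y. y \<in> space S \<Longrightarrow> 0 \<le> v y"
  shows "(\<integral>\<omega>. a (past X n \<omega>) * v (X (Suc n) \<omega>) \<partial>P) = (\<integral>\<omega>. a (past X n \<omega>) * kop v (X n \<omega>) \<partial>P)"
proof -
  note [measurable] = bounded_onD(1)[OF a] bounded_onD(1)[OF v] bounded_onD(1)[OF kop_bounded[OF v]]
  have past[measurable]: "past X n \<in> P \<rightarrow>\<^sub>M PiM {..n} (\<lambda>_. S)" by measurable
  have kv: "0 \<le> kop v y" if "y \<in> space S" for y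
    unfolding kop_def using nn(2) kernel_space[OF that] by (intro integral_nonneg_AE AE_I2) auto
  have "(\<integral>\<omega>. a (past X n \<omega>) * v (X (Suc n) \<omega>) \<partial>P)
      = enn2real (\<integral>\<^sup>+\<omega>. ennreal (a (past X n \<omega>)) * ennreal (v (X (Suc n) \<omega>)) \<partial>P)"
    using nn X_space measurable_space[OF past]
    by (subst integral_eq_nn_integral) (auto intro!: AE_I2 arg_cong[where f = enn2real] nn_integral_cong simp: ennreal_mult)
  also have "\<dots> = enn2real (\<integral>\<^sup>+\<omega>. ennreal (a (past X n \<omega>)) * (\<integral>\<^sup>+y. ennreal (v y) \<partial>K (X n \<omega>)) \<partial>P)"
    by (subst step[where v = "\<lambda>x. ennreal (v x)" and a = "\<lambda>x. ennreal (a x)"]) auto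
  also have "\<dots> = (\<integral>\<omega>. a (past X n \<omega>) * kop v (X n \<omega>) \<partial>P)"
    using nn kv X_space measurable_space[OF past]
    by (subst integral_eq_nn_integral)
      (auto intro!: AE_I2 arg_cong[where f = enn2real] nn_integral_cong simp: ennreal_mult nn_kop[OF v nn(2)])
  finally show ?thesis .
qed

text \<open>Both factors are made nonnegative by adding their bounds; the surplus terms cancel by
  linearity.\<close>

lemma step_real:
  assumes a: "bounded_on (PiM {..n} (\<lambda>_. S)) C a" and v: "bounded_on S D v"
  shows "(\<integral>\<omega>. a (past X n \<omega>) * v (X (Suc n) \<omega>) \<partial>P) = (\<integral>\<omega>. a (past X n \<omega>) * kop v (X n \<omega>) \<partial>P)"
proof -
  let ?S = "PiM {..n} (\<lambda>_. S)"
  note [measurable] = bounded_onD(1)[OF a] bounded_onD(1)[OF v] bounded_onD(1)[OF kop_bounded[OF v]]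
  have past[measurable]: "past X n \<in> P \<rightarrow>\<^sub>M ?S" by measurable
  have a': "bounded_on ?S (C + \<bar>C\<bar>) (\<lambda>x. a x + C)" and v': "bounded_on S (D + \<bar>D\<bar>) (\<lambda>x. v x + D)"
    using a v by (auto intro!: bounded_on_add bounded_on_const)
  have nn: "0 \<le> a x + C" if "x \<in> space ?S" for x using bounded_onD(2)[OF a that] by linarith
  have nn': "0 \<le> v x + D" if "x \<in> space S" for x using bounded_onD(2)[OF v that] by linarith
  have kv: "kop (\<lambda>y. v y + D) (X n \<omega>) = kop v (X n \<omega>) + D" if "\<omega> \<in> space P" for \<omega>
    using kop_power_affine[OF v X_space[OF that], of 1 1 D] by simp
  have bd: "\<bar>a (past X n \<omega>)\<bar> \<le> C" "\<bar>v (X (Suc n) \<omega>)\<bar> \<le> D" "\<bar>kop v (X n \<omega>)\<bar> \<le> D" if "\<omega> \<in> space P" for \<omega>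
    using that bounded_onD(2)[OF a] bounded_onD(2)[OF v] bounded_onD(2)[OF kop_bounded[OF v]]
      measurable_space[OF past] X_space by auto
  have i: "integrable P (\<lambda>\<omega>. a (past X n \<omega>))" "integrable P (\<lambda>\<omega>. v (X (Suc n) \<omega>))" 
    "integrable P (\<lambda>\<omega>. kop v (X n \<omega>))"
    "integrable P (\<lambda>\<omega>. a (past X n \<omega>) * v (X (Suc n) \<omega>))" "integrable P (\<lambda>\<omega>. a (past X n \<omega>) * kop v (X n \<omega>))"
  proof -
    show "integrable P (\<lambda>\<omega>. a (past X n \<omega>))"
      by (rule integrable_const_bound[where B = C]) (auto simp: bd)
    show "integrable P (\<lambda>\<omega>. v (X (Suc n) \<omega>))"
      by (rule integrable_const_bound[where B = D]) (auto simp: bd)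
    show "integrable P (\<lambda>\<omega>. kop v (X n \<omega>))"
      by (rule integrable_const_bound[where B = D]) (auto simp: bd)
    have "\<bar>a (past X n \<omega>)\<bar> * \<bar>z\<bar> \<le> C * D" if "\<omega> \<in> space P" "\<bar>z\<bar> \<le> D" for \<omega> z
      using that bd(1)[OF that(1)] by (intro mult_mono) auto
    note m = this
    show "integrable P (\<lambda>\<omega>. a (past X n \<omega>) * v (X (Suc n) \<omega>))"
      by (rule integrable_const_bound[where B = "C * D"]) (auto simp: abs_mult bd m)
    show "integrable P (\<lambda>\<omega>. a (past X n \<omega>) * kop v (X n \<omega>))"
      by (rule integrable_const_bound[where B = "C * D"]) (auto simp: abs_mult bd m)
  qed
  have 1: "(\<integral>\<omega>. (a (past X n \<omega>) + C) * (v (X (Suc n) \<omega>) + D) \<partial>P)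
      = (\<integral>\<omega>. (a (past X n \<omega>) + C) * (kop v (X n \<omega>) + D) \<partial>P)"
    using step_real_nonneg[OF a' v' nn nn'] by (simp add: kv cong: Bochner_Integration.integral_cong)
  \<comment> \<open>The instance with weight 1 disposes of the term in which the bound of
    \<open>a\<close> multiplies \<open>v\<close>.\<close>
  have 2: "(\<integral>\<omega>. 1 * (v (X (Suc n) \<omega>) + D) \<partial>P) = (\<integral>\<omega>. 1 * (kop v (X n \<omega>) + D) \<partial>P)"
    using step_real_nonneg[where n = n, OF bounded_on_const[of _ 1] v' _ nn'] by (simp add: kv cong: Bochner_Integration.integral_cong)
  have "(\<integral>\<omega>. v (X (Suc n) \<omega>) \<partial>P) = (\<integral>\<omega>. kop v (X n \<omega>) \<partial>P)"
    using 2 i by simp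
  then show ?thesis
    using 1 i by (simp add: ring_distribs)
qed

lemma step_power:
  assumes u: "bounded_on S C u" and v: "bounded_on S D v"
  shows "(\<integral>\<omega>. u (X n \<omega>) * v (X (n + k) \<omega>) \<partial>P) = (\<integral>\<omega>. u (X n \<omega>) * (kop ^^ k) v (X n \<omega>) \<partial>P)"
  using v
proof (induction k arbitrary: v)
  case (Suc k)
  have a: "bounded_on (PiM {..n + k} (\<lambda>_. S)) C (\<lambda>x. u (x n))"
    using u unfolding bounded_on_def
    by (auto intro!: measurable_compose[OF measurable_component_singleton] simp: space_PiM PiE_iff)
  have "(\<integral>\<omega>. u (X n \<omega>) * v (X (n + Suc k) \<omega>) \<partial>P) = (\<integral>\<omega>. u (X n \<omega>) * kop v (X (n + k) \<omega>) \<partial>P)"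
    using step_real[OF a Suc(2)] by simp
  also have "\<dots> = (\<integral>\<omega>. u (X n \<omega>) * (kop ^^ k) (kop v) (X n \<omega>) \<partial>P)"
    by (rule Suc.IH) (rule kop_bounded[OF Suc(2)])
  finally show ?case by (simp only: funpow_Suc_right comp_def)
qed simp

end

section \<open>Cesaro means and sums over stationary arrays\<close>

lemma cesaro_mean_tendsto:
  fixes x :: "nat \<Rightarrow> real"
  assumes "x \<longlonglongrightarrow> L"
  shows "(\<lambda>n. (\<Sum>j<n. x j) / real n) \<longlonglongrightarrow> L"
proof -
  have *: "(\<lambda>n. (\<Sum>j<n. y j) / real n) \<longlonglongrightarrow> 0" if y: "y \<longlonglongrightarrow> 0" for y :: "nat \<Rightarrow> real"
  proof (rule LIMSEQ_I)
    fix e :: real assume e: "0 < e"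
    from LIMSEQ_D[OF y half_gt_zero[OF e]] obtain N where N: "\<And>n. N \<le> n \<Longrightarrow> \<bar>y n\<bar> < e / 2" by auto
    define B where "B = (\<Sum>j<N. \<bar>y j\<bar>)"
    have B: "0 \<le> B" by (simp add: B_def sum_nonneg)
    obtain m :: nat where m: "2 * B / e < real m" using reals_Archimedean2 by blast
    show "\<exists>no. \<forall>n\<ge>no. norm ((\<Sum>j<n. y j) / real n - 0) < e"
    proof (intro exI[of _ "max (N + 1) m"] allI impI)
      fix n assume n: "max (N + 1) m \<le> n"
      then have n0: "0 < real n" by simp
      have "\<bar>\<Sum>j<n. y j\<bar> \<le> (\<Sum>j<n. \<bar>y j\<bar>)" by (rule sum_abs)
      also have "\<dots> \<le> (\<Sum>j\<in>{..<N} \<union> {N..<n}. \<bar>y j\<bar>)"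
        by (intro sum_mono2) auto
      also have "\<dots> = B + (\<Sum>j\<in>{N..<n}. \<bar>y j\<bar>)"
        unfolding B_def by (intro sum.union_disjoint) auto
      also have "(\<Sum>j\<in>{N..<n}. \<bar>y j\<bar>) \<le> (\<Sum>j\<in>{N..<n}. e / 2)"
        by (intro sum_mono less_imp_le[OF N]) auto
      also have "\<dots> \<le> real n * (e / 2)" using e by (simp add: mult_right_mono)
      finally have "\<bar>\<Sum>j<n. y j\<bar> \<le> B + real n * (e / 2)" by simp
      moreover have "B < real n * (e / 2)"
      proof -
        have "2 * B / e < real n" using m n by linarith
        then show ?thesis using e by (simp add: field_simps)
      qed
      ultimately show "norm ((\<Sum>j<n. y j) / real n - 0) < e"
        using n0 by (simp add: field_simps)
    qed
  qed
  have "(\<lambda>n. (\<Sum>j<n. x j - L) / real n + L) \<longlonglongrightarrow> 0 + L"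
    using assms by (intro tendsto_add * tendsto_const) (simp add: LIM_zero)
  moreover have "eventually (\<lambda>n. (\<Sum>j<n. x j - L) / real n + L = (\<Sum>j<n. x j) / real n) sequentially"
    using eventually_gt_at_top[of 0] by eventually_elim (simp add: sum_subtractf field_simps)
  ultimately show ?thesis by (simp add: tendsto_cong)
qed

text \<open>Enlarging the square by one adds the diagonal entry \<open>c 0\<close> and twice a
  column with entries \<open>c 1\<close> to \<open>c n\<close>. The double sum on the right is the
  sum of partial sums that occurs in a Cesaro mean; the lemma serves both the L2 ergodic theorem and
  the variance formula.\<close>

lemma sum_square_stationary:
  fixes \<gamma> :: "nat \<Rightarrow> nat \<Rightarrow> real"
  assumes sym: "\<And>i j. \<gamma> i j = \<gamma> j i" and stat: "\<And>i k. \<gamma> i (i + k) = c k"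
  shows "(\<Sum>i<n. \<Sum>j<n. \<gamma> i j) = real n * c 0 + 2 * (\<Sum>j<n. \<Sum>k<j. c (Suc k))"
proof (induction n)
  case (Suc n)
  have "(\<Sum>i<n. \<gamma> i n) = (\<Sum>i<n. c (Suc (n - Suc i)))"
  proof (intro sum.cong refl)
    fix i assume "i \<in> {..<n}"
    then show "\<gamma> i n = c (Suc (n - Suc i))" using stat[of i "n - i"] by (simp add: Suc_diff_Suc)
  qed
  also have "\<dots> = (\<Sum>k<n. c (Suc k))" by (rule sum.nat_diff_reindex)
  finally have "(\<Sum>i<n. \<gamma> i n) = (\<Sum>k<n. c (Suc k))" .
  moreover have "(\<Sum>i<n. \<gamma> n i) = (\<Sum>i<n. \<gamma> i n)" by (intro sum.cong refl sym)
  ultimately show ?case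
    using Suc stat[of n 0] by (simp add: sum.distrib algebra_simps)
qed simp

section \<open>Ergodicity of stationary Harris chains\<close>

lemma abs_mult_bound: "\<bar>a\<bar> \<le> C \<Longrightarrow> \<bar>b\<bar> \<le> D \<Longrightarrow> \<bar>a * b\<bar> \<le> C * (D :: real)"
  unfolding abs_mult by (rule mult_mono) auto

locale stationary_chain = prob_chain P S K X for P S K and X :: "nat \<Rightarrow> 'w \<Rightarrow> 'a" +
  fixes p :: "'a measure"
  assumes law: "\<And>n. distr P S (X n) = p"
begin

lemma sets_p[measurable_cong, simp]: "sets p = sets S"
  unfolding law[of 0, symmetric] by simp

lemma space_p[simp]: "space p = space S"
  unfolding law[of 0, symmetric] by simp

sublocale p: prob_space p
  unfolding law[of 0, symmetric] by (rule prob_space_distr) simp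

lemma invariant: "B \<in> sets S \<Longrightarrow> emeasure p B = (\<integral>\<^sup>+x. emeasure (K x) B \<partial>p)"
  using emeasure_law_Suc[of B 0] by (simp add: law)

lemma integral_X:
  fixes v :: "'a \<Rightarrow> real"
  shows "v \<in> borel_measurable S \<Longrightarrow> (\<integral>\<omega>. v (X n \<omega>) \<partial>P) = (\<integral>x. v x \<partial>p)"
  unfolding law[of n, symmetric] by (rule integral_distr[symmetric]) auto

lemma AE_X: "Measurable.pred S Q \<Longrightarrow> (AE \<omega> in P. Q (X n \<omega>)) \<longleftrightarrow> (AE x in p. Q x)"
  unfolding law[of n, symmetric] by (subst AE_distr_iff) auto

text \<open>Stationarity at the times 0 and 1, joined by one Markov step.\<close>

lemma integral_kop:
  assumes v: "bounded_on S C v"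
  shows "(\<integral>x. kop v x \<partial>p) = (\<integral>x. v x \<partial>p)"
proof -
  have "(\<integral>\<omega>. 1 * v (X (0 + 1) \<omega>) \<partial>P) = (\<integral>\<omega>. 1 * (kop ^^ 1) v (X 0 \<omega>) \<partial>P)"
    by (rule step_power[OF bounded_on_const v])
  then show ?thesis
    using bounded_onD(1)[OF v] bounded_onD(1)[OF kop_bounded[OF v]] by (simp add: integral_X)
qed

text \<open>Garsia's recursion for the maximum of the partial sums of \<open>kop\<^sup>k g\<close>.\<close>

primrec garsia :: "('a \<Rightarrow> real) \<Rightarrow> nat \<Rightarrow> 'a \<Rightarrow> real" where
  "garsia g 0 = (\<lambda>x. 0)"
| "garsia g (Suc n) = (\<lambda>x. max 0 (g x + kop (garsia g n) x))"

text \<open>Birkhoff sums of the operator, not of a path: the expected sum of \<open>g\<close> over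
  the first n times for a start at x.\<close>

definition part_sum :: "('a \<Rightarrow> real) \<Rightarrow> nat \<Rightarrow> 'a \<Rightarrow> real" where
  "part_sum g n x = (\<Sum>k<n. (kop ^^ k) g x)"

lemma part_sum_bounded: "bounded_on S C g \<Longrightarrow> bounded_on S (real n * C) (part_sum g n)"
  unfolding part_sum_def[abs_def]
  using bounded_on_sum[of "{..<n}" S C "\<lambda>k. (kop ^^ k) g"] by (simp add: kop_power_bounded)

lemma kop_part_sum:
  assumes g: "bounded_on S C g" and x: "x \<in> space S"
  shows "kop (part_sum g n) x = part_sum g (Suc n) x - g x"
proof -
  have "kop (part_sum g n) x = (\<Sum>k<n. (kop ^^ Suc k) g x)"
    unfolding part_sum_def[abs_def] using kop_sum[OF kop_power_bounded[OF g] x] by simp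
  then show ?thesis unfolding part_sum_def by (subst sum.lessThan_Suc_shift) simp
qed

lemma garsia_bounded: "bounded_on S C g \<Longrightarrow> bounded_on S (real n * C) (garsia g n)"
proof (induction n)
  case 0 then show ?case by (simp add: bounded_on_def)
next
  case (Suc n)
  then have "bounded_on S (C + real n * C) (\<lambda>x. g x + kop (garsia g n) x)"
    by (intro bounded_on_add kop_bounded)
  then show ?case
    by (auto simp: bounded_on_def algebra_simps max_def)
qed

lemma garsia_nonneg: "0 \<le> garsia g n x"
  by (cases n) auto

lemma garsia_mono:
  assumes g: "bounded_on S C g" and x: "x \<in> space S"
  shows "garsia g n x \<le> garsia g (Suc n) x"
  using x
proof (induction n arbitrary: x)
  case (Suc n)
  have "kop (garsia g n) x \<le> kop (garsia g (Suc n)) x"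
    using Suc by (intro kop_mono[OF garsia_bounded[OF g, of n] garsia_bounded[OF g, of "Suc n"]]) auto
  then show ?case by (simp add: max_def)
qed simp

text \<open>The recursion of \<open>kop_part_sum\<close> is that of \<open>garsia\<close> without
  the maximum with 0, and \<open>kop\<close> is monotone.\<close>

lemma part_sum_le_garsia:
  assumes g: "bounded_on S C g" and x: "x \<in> space S"
  shows "part_sum g n x \<le> garsia g n x"
  using x
proof (induction n arbitrary: x)
  case 0 then show ?case by (simp add: part_sum_def)
next
  case (Suc n)
  have "kop (part_sum g n) x \<le> kop (garsia g n) x"
    using Suc by (intro kop_mono[OF part_sum_bounded[OF g] garsia_bounded[OF g]]) auto
  then show ?case using kop_part_sum[OF g Suc(2), of n] by simp
qed

text \<open>Write m for \<open>garsia g (Suc n)\<close>. Where m is positive, it equals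
  \<open>g\<close> plus \<open>kop (garsia g n)\<close> and is at most \<open>g\<close> plus
  \<open>kop\<close> of m; elsewhere m minus \<open>kop\<close> of m is at most 0. As this
  difference has integral 0, the integral of \<open>g\<close> over the set where m is positive is
  nonnegative, and by \<open>pos\<close> these sets exhaust the space up to a null set.\<close>

lemma maximal_ergodic:
  assumes g: "bounded_on S C g" and pos: "AE x in p. \<exists>n. part_sum g n x > 0"
  shows "0 \<le> (\<integral>x. g x \<partial>p)"
proof -
  note M = garsia_bounded[OF g]
  note [measurable] = bounded_onD(1)[OF g] bounded_onD(1)[OF M] bounded_onD(1)[OF kop_bounded[OF M]]
  have ig: "integrable p g" using g by (rule p.integrable_bounded_on) simp
  have iM: "integrable p (garsia g n)" "integrable p (kop (garsia g n))" for n
    using M kop_bounded[OF M] by (auto intro!: p.integrable_bounded_on)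
  have ge: "0 \<le> (\<integral>x. indicator {x. 0 < garsia g (Suc n) x} x * g x \<partial>p)" for n
  proof -
    have "0 = (\<integral>x. garsia g (Suc n) x - kop (garsia g (Suc n)) x \<partial>p)"
      using integral_kop[OF M, of "Suc n"] iM[of "Suc n"] by (simp del: garsia.simps)
    also have "\<dots> \<le> (\<integral>x. indicator {x. 0 < garsia g (Suc n) x} x * g x \<partial>p)"
    proof (rule integral_mono)
      show "integrable p (\<lambda>x. garsia g (Suc n) x - kop (garsia g (Suc n)) x)"
        using iM by (intro Bochner_Integration.integrable_diff)
      show "integrable p (\<lambda>x. indicator {x. 0 < garsia g (Suc n) x} x * g x)"
        by (rule Bochner_Integration.integrable_bound[OF ig]) (auto simp: indicator_def)
      fix x assume "x \<in> space p"
      then have x: "x \<in> space S" by simp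
      have "kop (garsia g n) x \<le> kop (garsia g (Suc n)) x"
        by (intro kop_mono[OF M M x] garsia_mono[OF g])
      moreover have "0 \<le> kop (garsia g (Suc n)) x"
        unfolding kop_def by (intro integral_nonneg_AE AE_I2 garsia_nonneg)
      ultimately show "garsia g (Suc n) x - kop (garsia g (Suc n)) x
          \<le> indicator {x. 0 < garsia g (Suc n) x} x * g x"
        by (auto simp: indicator_def max_def split: if_splits)
    qed
    finally show ?thesis .
  qed
  have "(\<lambda>n. \<integral>x. indicator {x. 0 < garsia g (Suc n) x} x * g x \<partial>p) \<longlonglongrightarrow> (\<integral>x. g x \<partial>p)"
  proof (rule integral_dominated_convergence[where w = "\<lambda>x. \<bar>g x\<bar>"])
    show "AE x in p. (\<lambda>n. indicator {x. 0 < garsia g (Suc n) x} x * g x) \<longlonglongrightarrow> g x"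
      using pos
    proof (rule AE_mp, intro AE_I2 impI)
      fix x assume "x \<in> space p" and "\<exists>n. part_sum g n x > 0"
      then obtain n where x: "x \<in> space S" and "part_sum g n x > 0" by auto
      then have n: "0 < garsia g n x" using part_sum_le_garsia[OF g x, of n] by linarith
      have mono: "garsia g n x \<le> garsia g m x" if "n \<le> m" for m
        using garsia_mono[OF g x] that by (rule lift_Suc_mono_le)
      have "eventually (\<lambda>m. indicator {x. 0 < garsia g (Suc m) x} x * g x = g x) sequentially"
        using eventually_ge_at_top[of n]
      proof eventually_elim
        case (elim m)
        then have "0 < garsia g (Suc m) x" using n mono[of "Suc m"] by linarith
        then show ?case by simp
      qed
      then show "(\<lambda>n. indicator {x. 0 < garsia g (Suc n) x} x * g x) \<longlonglongrightarrow> g x"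
        by (rule tendsto_eventually)
    qed
  qed (use ig in \<open>auto simp: indicator_def\<close>)
  then show ?thesis using ge by (intro LIMSEQ_le_const) auto
qed

end

locale harris_chain = stationary_chain P S K X p for P S K and X :: "nat \<Rightarrow> 'w \<Rightarrow> 'a" and p +
  assumes harris: "harris_recurrent S K"
begin

text \<open>The irreducibility measure is dominated by the stationary law.\<close>

lemma
  shows conull_hit: "\<And>D x. D \<in> null_sets p \<Longrightarrow> x \<in> space S \<Longrightarrow>
      AE \<omega> in path_law S K (return S x). \<exists>n. \<omega> n \<notin> D"
    and harris_dichotomy: "\<And>B. B \<in> sets S \<Longrightarrow> (\<And>n. AE \<omega> in P. X n \<omega> \<in> B \<longleftrightarrow> X 0 \<omega> \<in> B) \<Longrightarrow>
      (AE x in p. x \<in> B) \<or> (AE x in p. x \<notin> B)"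
proof -
  obtain \<phi> where \<phi>: "sets \<phi> = sets S" "emeasure \<phi> (space S) \<noteq> 0"
    and hit: "\<And>B x. B \<in> sets S \<Longrightarrow> emeasure \<phi> B > 0 \<Longrightarrow> x \<in> space S \<Longrightarrow>
      AE \<omega> in path_law S K (return S x). \<exists>\<^sub>\<infinity>n. \<omega> n \<in> B"
    using harris unfolding harris_recurrent_def by blast
  \<comment> \<open>The set that is hit is the complement of \<open>C\<close>, charged by the
    irreducibility measure.\<close>
  have hit': "AE \<omega> in path_law S K (return S x). \<exists>n. \<omega> n \<notin> C"
    if C: "C \<in> sets S" "emeasure \<phi> (space S - C) > 0" and x: "x \<in> space S" for C x
    using hit[OF _ C(2) x] C(1) by (auto dest!: frequently_ex elim!: eventually_mono)
  have hitP: "AE \<omega> in P. \<exists>n. X n \<omega> \<notin> C" if "C \<in> sets S" "emeasure \<phi> (space S - C) > 0" for C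
    using that by (intro confined_tendsto_0(2) hit') unfold_locales
  have split: "emeasure \<phi> (space S) = emeasure \<phi> C + emeasure \<phi> (space S - C)" if "C \<in> sets S" for C
  proof -
    have "emeasure \<phi> (C \<union> (space S - C)) = emeasure \<phi> C + emeasure \<phi> (space S - C)"
      using that \<phi> by (intro plus_emeasure[symmetric]) auto
    moreover have "C \<union> (space S - C) = space S" using sets.sets_into_space[OF that] by auto
    ultimately show ?thesis by simp
  qed
  show "AE \<omega> in path_law S K (return S x). \<exists>n. \<omega> n \<notin> D" if D: "D \<in> null_sets p" and x: "x \<in> space S" for D x
  proof -
    have D': "D \<in> sets S" "AE x in p. x \<notin> D" using D by (auto intro: AE_not_in)
    \<comment> \<open>Otherwise the stationary chain would enter \<open>D\<close> almost surely,
      although each \<open>X n\<close> avoids the null set \<open>D\<close> almost surely.\<close>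
    have "emeasure \<phi> D = 0"
    proof (rule ccontr)
      assume *: "emeasure \<phi> D \<noteq> 0"
      have "space S - (space S - D) = D" using sets.sets_into_space[OF D'(1)] by auto
      then have 1: "AE \<omega> in P. \<exists>n. X n \<omega> \<notin> space S - D"
        using * D' by (intro hitP) (auto simp: zero_less_iff_neq_zero)
      have "AE \<omega> in P. \<forall>n. X n \<omega> \<notin> D"
        unfolding AE_all_countable using D' by (subst AE_X) auto
      then have "AE \<omega> in P. False"
        using 1 AE_space by eventually_elim (auto simp: X_space)
      then show False by simp
    qed
    then have "emeasure \<phi> (space S - D) > 0"
      using \<phi>(2) split[OF D'(1)] by (simp add: zero_less_iff_neq_zero)
    then show ?thesis using D' x by (intro hit')
  qed
  fix B assume B[measurable]: "B \<in> sets S" and inv: "\<And>n. AE \<omega> in P. X n \<omega> \<in> B \<longleftrightarrow> X 0 \<omega> \<in> B"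
  have inv': "AE \<omega> in P. \<forall>n. X n \<omega> \<in> B \<longleftrightarrow> X 0 \<omega> \<in> B"
    unfolding AE_all_countable using inv by blast
  show "(AE x in p. x \<in> B) \<or> (AE x in p. x \<notin> B)"
  \<comment> \<open>\<open>\<phi>\<close> charges \<open>B\<close> or its complement, and the set it
    charges is visited almost surely. As membership in \<open>B\<close> does not change along the
    path, the start lies in that set as well.\<close>
  proof (cases "emeasure \<phi> (space S - B) > 0")
    case True
    have "AE \<omega> in P. X 0 \<omega> \<notin> B"
      using hitP[OF B True] inv' by eventually_elim auto
    then show ?thesis by (subst (asm) AE_X) auto
  next
    case False
    then have "emeasure \<phi> B > 0" using \<phi>(2) split[OF B] by (auto simp: zero_less_iff_neq_zero)
    moreover have "space S - (space S - B) = B" using sets.sets_into_space[OF B] by auto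
    ultimately have "AE \<omega> in P. \<exists>n. X n \<omega> \<notin> space S - B" by (intro hitP) auto
    then have "AE \<omega> in P. X 0 \<omega> \<in> B"
      using inv' AE_space by eventually_elim (auto simp: X_space)
    then show ?thesis by (subst (asm) AE_X) auto
  qed
qed

text \<open>Equality of the integrals of \<open>h\<close> and \<open>kop h\<close> forces
  harmonicity almost everywhere. Then \<open>h (X n)\<close> is a martingale with constant second
  moment, so its increments vanish, and the level set of \<open>h\<close> below \<open>c\<close> is
  invariant along the paths; \<open>harris_dichotomy\<close> applies to it.\<close>

lemma superharmonic_dichotomy:
  assumes h: "bounded_on S C h" and sup: "\<And>x. x \<in> space S \<Longrightarrow> kop h x \<le> h x"
  shows "(AE x in p. c \<le> h x) \<or> (AE x in p. h x < c)"
proof -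
  note [measurable] = bounded_onD(1)[OF h] bounded_onD(1)[OF kop_bounded[OF h]]
  have ih: "integrable p h" "integrable p (kop h)"
    using h kop_bounded[OF h] by (auto intro!: p.integrable_bounded_on)
  have "AE x in p. h x - kop h x = 0"
    using sup ih by (subst integral_nonneg_eq_0_iff_AE[symmetric]) (auto simp: integral_kop[OF h])
  then have harm: "AE x in p. kop h x = h x" by eventually_elim simp
  have step: "AE \<omega> in P. h (X (Suc n) \<omega>) = h (X n \<omega>)" for n
  proof -
    have hh: "\<bar>h x * h x\<bar> \<le> C * C" if "x \<in> space S" for x
      using abs_mult_bound[OF bounded_onD(2)[OF h that] bounded_onD(2)[OF h that]] .
    have "(\<lambda>x. h x * h x) \<in> borel_measurable S" by measurable
    then have b2: "bounded_on S (C * C) (\<lambda>x. h x * h x)"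
      unfolding bounded_on_def using hh by blast
    have i: "integrable P (\<lambda>\<omega>. h (X k \<omega>) * h (X k \<omega>))" for k
      by (rule integrable_bounded_on_compose[OF b2]) simp
    have bd: "\<bar>h (X k \<omega>)\<bar> \<le> C" if "\<omega> \<in> space P" for k \<omega>
      using bounded_onD(2)[OF h] X_space that by auto
    have i2: "integrable P (\<lambda>\<omega>. h (X n \<omega>) * h (X (Suc n) \<omega>))"
      by (rule integrable_const_bound[where B = "C * C"])
        (auto intro!: abs_mult_bound bd)
    have "(\<integral>\<omega>. h (X n \<omega>) * h (X (n + 1) \<omega>) \<partial>P) = (\<integral>\<omega>. h (X n \<omega>) * (kop ^^ 1) h (X n \<omega>) \<partial>P)"
      by (rule step_power[OF h h])
    also have "\<dots> = (\<integral>x. h x * kop h x \<partial>p)" by (subst integral_X[symmetric]) auto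
    also have "\<dots> = (\<integral>x. h x * h x \<partial>p)" using harm by (intro integral_cong_AE) auto
    finally have cross: "(\<integral>\<omega>. h (X n \<omega>) * h (X (Suc n) \<omega>) \<partial>P) = (\<integral>x. h x * h x \<partial>p)" by simp
    have sq: "(\<integral>\<omega>. h (X k \<omega>) * h (X k \<omega>) \<partial>P) = (\<integral>x. h x * h x \<partial>p)" for k
      by (subst integral_X[symmetric, where n = k]) auto
    have ex: "(h (X (Suc n) \<omega>) - h (X n \<omega>))\<^sup>2 = h (X (Suc n) \<omega>) * h (X (Suc n) \<omega>)
        + h (X n \<omega>) * h (X n \<omega>) - 2 * (h (X n \<omega>) * h (X (Suc n) \<omega>))" for \<omega>
      by (simp add: power2_eq_square algebra_simps)
    have 0: "(\<integral>\<omega>. (h (X (Suc n) \<omega>) - h (X n \<omega>))\<^sup>2 \<partial>P) = 0"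
      unfolding ex using i i2 by (simp add: cross sq)
    have "integrable P (\<lambda>\<omega>. (h (X (Suc n) \<omega>) - h (X n \<omega>))\<^sup>2)"
      unfolding ex using i i2 by simp
    with 0 have "AE \<omega> in P. (h (X (Suc n) \<omega>) - h (X n \<omega>))\<^sup>2 = 0"
      by (subst (asm) integral_nonneg_eq_0_iff_AE) auto
    then show ?thesis by eventually_elim simp
  qed
  have all: "AE \<omega> in P. h (X n \<omega>) = h (X 0 \<omega>)" for n
  proof (induction n)
    case (Suc n) then show ?case using step[of n] by eventually_elim simp
  qed simp
  have "(AE x in p. x \<in> {x \<in> space S. h x < c}) \<or> (AE x in p. x \<notin> {x \<in> space S. h x < c})"
  proof (rule harris_dichotomy)
    show "AE \<omega> in P. X n \<omega> \<in> {x \<in> space S. h x < c} \<longleftrightarrow> X 0 \<omega> \<in> {x \<in> space S. h x < c}" for n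
      using all[of n] AE_space by eventually_elim (simp add: X_space)
  qed measurable
  then show ?thesis
  proof
    assume "AE x in p. x \<in> {x \<in> space S. h x < c}"
    then have "AE x in p. h x < c" by eventually_elim simp
    then show ?thesis ..
  next
    assume "AE x in p. x \<notin> {x \<in> space S. h x < c}"
    then have "AE x in p. c \<le> h x" using AE_space by eventually_elim auto
    then show ?thesis ..
  qed
qed

text \<open>The lower limit \<open>h\<close> of the averages is superharmonic, so it is at least
  \<open>c\<close> almost everywhere, as wanted, or below \<open>c\<close> almost everywhere. In the
  second case almost every x has a positive partial sum of \<open>c - g\<close>, and the maximal
  inequality bounds the mean of \<open>g\<close> by \<open>c\<close>, a contradiction.\<close>

lemma liminf_averages:
  assumes g: "bounded_on S C g" and nn: "\<And>x. x \<in> space S \<Longrightarrow> 0 \<le> g x" and c: "0 \<le> c" "c < (\<integral>x. g x \<partial>p)"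
  shows "AE x in p. \<forall>e>0. eventually (\<lambda>m. c - e < part_sum g m x / real m) sequentially"
proof -
  let ?A = "\<lambda>m x. part_sum g m x / real m"
  obtain x0 where "x0 \<in> space S" using p.not_empty by auto
  then have C: "0 \<le> C" using bounded_onD(2)[OF g] abs_ge_zero[of "g x0"] by (meson order_trans)
  have powb: "bounded_on S C ((kop ^^ k) g)" for k by (rule kop_power_bounded[OF g])
  have pnn: "0 \<le> (kop ^^ k) g x" if "x \<in> space S" for k x
    using that
  proof (induction k arbitrary: x)
    case (Suc k)
    then show ?case using kernel_space[OF Suc(2)]
      by (auto simp: kop_def[of "(kop ^^ k) g"] intro!: integral_nonneg_AE AE_I2)
  qed (simp add: nn)
  have psnn: "0 \<le> part_sum g m x" if "x \<in> space S" for m x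
    unfolding part_sum_def using pnn that by (intro sum_nonneg) auto
  have Ab: "bounded_on S C (?A m)" for m
    using part_sum_bounded[OF g, of m] C unfolding bounded_on_def
    by (cases "m = 0") (auto simp: field_simps)
  note [measurable] = bounded_onD(1)[OF g] bounded_onD(1)[OF Ab]
  \<comment> \<open>The lower limit is formed in \<open>ennreal\<close>, where it always exists and
    Fatou's lemma applies; boundedness brings it back to the reals as \<open>h\<close>.\<close>
  define H where "H x = liminf (\<lambda>m. ennreal (?A m x))" for x
  have HC: "H x \<le> ennreal C" if "x \<in> space S" for x
  proof -
    have "?A m x \<le> C" for m using bounded_onD(2)[OF Ab that, of m] by (rule abs_le_D1)
    then have "H x \<le> liminf (\<lambda>m. ennreal C)"
      unfolding H_def by (intro Liminf_mono always_eventually allI ennreal_leI)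
    then show ?thesis by (simp add: Liminf_const)
  qed
  have [measurable]: "H \<in> borel_measurable S" unfolding H_def[abs_def] by measurable
  define h where "h x = enn2real (H x)" for x
  have hH: "ennreal (h x) = H x" if "x \<in> space S" for x
    using le_less_trans[OF HC[OF that] ennreal_less_top] by (simp add: h_def)
  have hb: "bounded_on S C h"
    unfolding bounded_on_def h_def
    using HC C by (auto intro!: enn2real_leI)
  have KH: "(\<integral>\<^sup>+y. H y \<partial>K x) \<le> H x" if x: "x \<in> space S" for x
    unfolding H_def[of x] le_Liminf_iff
  proof safe
    fix z assume z: "z < (\<integral>\<^sup>+y. H y \<partial>K x)"
    then obtain w where w: "z < w" "w < (\<integral>\<^sup>+y. H y \<partial>K x)" using dense by blast
    have "(\<integral>\<^sup>+y. H y \<partial>K x) \<le> liminf (\<lambda>m. \<integral>\<^sup>+y. ennreal (?A m y) \<partial>K x)"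
      unfolding H_def using kernel_sets[OF x] 
      by (intro nn_integral_liminf) (auto cong: measurable_cong_sets)
    also have "\<dots> = liminf (\<lambda>m. ennreal (kop (?A m) x))"
      by (intro arg_cong[where f = liminf] ext nn_kop[OF Ab _ x]) (auto simp: psnn)
    finally have ev: "eventually (\<lambda>m. w < ennreal (kop (?A m) x)) sequentially"
      using w(2) unfolding le_Liminf_iff by blast
    have "w < top" by (rule order.strict_trans2[OF w(2) top_greatest])
    then obtain w' where w': "w = ennreal w'" "0 \<le> w'" by (cases w) auto
    have "z < top" by (rule order.strict_trans2[OF w(1) top_greatest])
    then obtain z' where z': "z = ennreal z'" "0 \<le> z'" by (cases z) auto
    have zw: "z' < w'" using w(1) w' z' by (simp add: ennreal_less_iff)
    \<comment> \<open>Applying \<open>kop\<close> to a sum of m terms trades the first term for a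
      new last one; as \<open>g\<close> is nonnegative, the average grows by at most C / m.\<close>
    have lim0: "(\<lambda>m. C / real m) \<longlonglongrightarrow> 0" by (rule lim_const_over_n)
    have "eventually (\<lambda>m. C / real m < w' - z') sequentially"
      using order_tendstoD(2)[OF lim0] zw by simp
    with ev show "eventually (\<lambda>m. z < ennreal (?A m x)) sequentially"
    proof eventually_elim
      case (elim m)
      have "kop (?A m) x = kop (part_sum g m) x / real m"
        unfolding kop_def by simp
      also have "kop (part_sum g m) x = part_sum g m x + (kop ^^ m) g x - g x"
        using kop_part_sum[OF g x, of m] by (simp add: part_sum_def)
      also have "\<dots> / real m \<le> (part_sum g m x + C) / real m"
        using bounded_onD(2)[OF powb x, of m] nn[OF x] by (intro divide_right_mono) auto
      finally have "kop (?A m) x \<le> ?A m x + C / real m" by (simp add: add_divide_distrib)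
      moreover have "w' < kop (?A m) x" using elim(1) w' by (simp add: ennreal_less_iff)
      ultimately have "z' < ?A m x" using elim(2) by linarith
      then show ?case using z' by (simp add: ennreal_less_iff)
    qed
  qed
  have sup: "kop h x \<le> h x" if x: "x \<in> space S" for x
  proof -
    have "ennreal (kop h x) = (\<integral>\<^sup>+y. ennreal (h y) \<partial>K x)"
      by (rule nn_kop[OF hb _ x, symmetric]) (simp add: h_def)
    also have "\<dots> = (\<integral>\<^sup>+y. H y \<partial>K x)" by (intro nn_integral_cong) (simp add: hH kernel_space[OF x])
    also have "\<dots> \<le> ennreal (h x)" using KH[OF x] by (simp add: hH x)
    finally show ?thesis by (simp add: h_def)
  qed
  have "AE x in p. c \<le> h x"
  proof (rule ccontr)
    assume "\<not> ?thesis"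
    then have lt: "AE x in p. h x < c" using superharmonic_dichotomy[OF hb sup, of c] by blast
    have cg: "bounded_on S (\<bar>c\<bar> + C) (\<lambda>x. c - g x)" by (intro bounded_on_diff bounded_on_const g)
    have "0 \<le> (\<integral>x. c - g x \<partial>p)"
    proof (rule maximal_ergodic[OF cg])
      show "AE x in p. \<exists>n. 0 < part_sum (\<lambda>x. c - g x) n x"
        using lt AE_space
      proof eventually_elim
        case (elim x)
        then have x: "x \<in> space S" by simp
        have "0 \<le> h x" by (simp add: h_def)
        then have "H x < ennreal c" using elim(1) hH[OF x] ennreal_lessI[of c "h x"] by simp
        have "\<exists>\<^sub>F m in sequentially. ennreal (?A m x) < ennreal c"
        proof (rule ccontr)
          assume "\<not> (\<exists>\<^sub>F m in sequentially. ennreal (?A m x) < ennreal c)"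
          then have "\<forall>\<^sub>F m in sequentially. ennreal c \<le> ennreal (?A m x)"
            by (simp only: not_frequently not_less)
          then have "ennreal c \<le> H x" unfolding H_def by (rule Liminf_bounded)
          then show False using \<open>H x < ennreal c\<close> by simp
        qed
        then have "\<exists>\<^sub>F m in sequentially. 0 < m \<and> ennreal (?A m x) < ennreal c"
          by (rule frequently_eventually_conj[OF _ eventually_gt_at_top])
        then obtain m where m: "0 < m" "ennreal (?A m x) < ennreal c" by (auto dest: frequently_ex)
        then have "?A m x < c" using psnn[OF x, of m] by (simp add: ennreal_less_iff)
        then have "part_sum g m x < real m * c" using m(1) by (simp add: field_simps)
        moreover have "part_sum (\<lambda>x. c - g x) m x = real m * c - part_sum g m x"
          unfolding part_sum_def using kop_power_affine[OF g x, of _ "-1" c]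
          by (simp add: sum_subtractf)
        ultimately show ?case by (intro exI[of _ m]) simp
      qed
    qed
    moreover have "integrable p g" using g by (rule p.integrable_bounded_on) simp
    moreover have "measure p (space S) = 1" using p.prob_space by simp
    ultimately show False using c by simp
  qed
  then show ?thesis
    using AE_space
  proof eventually_elim
    case (elim x)
    then have x: "x \<in> space S" by simp
    have cH: "ennreal c \<le> H x" using elim(1) hH[OF x] using ennreal_leI[OF elim(1)] by (simp only: hH[OF x])
    show ?case
    proof safe
      fix e :: real assume "0 < e"
      show "eventually (\<lambda>m. c - e < ?A m x) sequentially"
      proof (cases "c - e < 0")
        case True
        have "c - e < ?A m x" for m
        proof -
          have "0 \<le> ?A m x" using psnn[OF x] by simp
          with True show ?thesis by linarith
        qed
        then show ?thesis by simp
      next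
        case False
        then have "ennreal (c - e) < ennreal c" using \<open>0 < e\<close> by (simp add: ennreal_less_iff)
        then have "eventually (\<lambda>m. ennreal (c - e) < ennreal (?A m x)) sequentially"
          using cH unfolding H_def le_Liminf_iff by blast
        then show ?thesis
        proof eventually_elim
          case (elim m)
          then show ?case using False by (simp add: ennreal_less_iff)
        qed
      qed
    qed
  qed
qed

text \<open>\<open>liminf_averages\<close> wants a nonnegative function and a threshold between 0
  and the mean. The shift by \<open>?D\<close> makes the function at least 1, and countably many
  thresholds \<open>c j\<close> approach its mean.\<close>

lemma averages_lower:
  assumes g: "bounded_on S C g"
  shows "AE x in p. \<forall>e>0. eventually (\<lambda>m. (\<integral>x. g x \<partial>p) - e < part_sum g m x / real m) sequentially"
proof -
  let ?D = "\<bar>C\<bar> + 1"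
  let ?g = "\<lambda>x. 1 * g x + ?D"
  have [simp]: "integrable p g" using g by (rule p.integrable_bounded_on) simp
  have "measure p (space S) = 1" using p.prob_space by simp
  then have int: "(\<integral>x. ?g x \<partial>p) = (\<integral>x. g x \<partial>p) + ?D" by simp
  have bg: "bounded_on S (C + \<bar>?D\<bar>) ?g"
    using bounded_on_add[OF g bounded_on_const[of S ?D]] by simp
  have ge: "1 \<le> ?g x" if "x \<in> space S" for x using bounded_onD(2)[OF g that] by auto
  have pos: "1 \<le> (\<integral>x. ?g x \<partial>p)"
  proof (rule p.integral_ge_const)
    show "AE x in p. 1 \<le> ?g x" by (rule AE_I2) (rule ge, simp)
  qed simp
  \<comment> \<open>The maximum with 0 keeps the threshold admissible; it stays strictly below the
    mean, which is at least 1 by \<open>pos\<close>.\<close>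
  define c where "c j = max 0 ((\<integral>x. ?g x \<partial>p) - 1 / real (Suc j))" for j
  have "AE x in p. \<forall>j. \<forall>e>0. eventually (\<lambda>m. c j - e < part_sum ?g m x / real m) sequentially"
    unfolding AE_all_countable
  proof
    fix j
    show "AE x in p. \<forall>e>0. eventually (\<lambda>m. c j - e < part_sum ?g m x / real m) sequentially"
    proof (rule liminf_averages[OF bg])
      show "0 \<le> ?g x" if "x \<in> space S" for x using ge[OF that] by linarith
      show "0 \<le> c j" by (simp add: c_def)
      show "c j < (\<integral>x. ?g x \<partial>p)" unfolding c_def using pos by auto
    qed
  qed
  then show ?thesis
    using AE_space
  proof eventually_elim
    case (elim x)
    then have x: "x \<in> space S" by simp
    show ?case
    proof safe
      fix e :: real assume e: "0 < e"
      obtain j where j: "1 / real (Suc j) < e / 2" using nat_approx_posE[OF half_gt_zero[OF e]] .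
      have "eventually (\<lambda>m. c j - e / 2 < part_sum ?g m x / real m) sequentially"
        using elim(1) e by simp
      then show "eventually (\<lambda>m. (\<integral>x. g x \<partial>p) - e < part_sum g m x / real m) sequentially"
        using eventually_gt_at_top[of 0]
      proof eventually_elim
        case (elim m)
        have "part_sum ?g m x = part_sum g m x + real m * ?D"
          unfolding part_sum_def kop_power_affine[OF g x] by (simp add: sum.distrib)
        then have "part_sum ?g m x / real m = part_sum g m x / real m + ?D"
          using elim(2) by (simp add: field_simps)
        moreover have "(\<integral>x. ?g x \<partial>p) - 1 / real (Suc j) \<le> c j" by (simp add: c_def)
        ultimately show ?case using elim(1) j int by linarith
      qed
    qed
  qed
qed

text \<open>The lower estimate, applied to \<open>g\<close> and to its negative.\<close>

lemma averages_tendsto: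
  assumes g: "bounded_on S C g"
  shows "AE x in p. (\<lambda>m. part_sum g m x / real m) \<longlonglongrightarrow> (\<integral>x. g x \<partial>p)"
proof -
  \<comment> \<open>The negative is written in affine form, to match
    \<open>kop_power_affine\<close>.\<close>
  have mg: "bounded_on S C (\<lambda>x. -1 * g x + 0)" using g by (simp add: bounded_on_def)
  from averages_lower[OF g] averages_lower[OF mg] AE_space show ?thesis
  proof eventually_elim
    case (elim x)
    then have x: "x \<in> space S" by simp
    show ?case
    proof (rule LIMSEQ_I)
      fix e :: real assume e: "0 < e"
      from elim(1)[rule_format, OF e] elim(2)[rule_format, OF e]
      have "eventually (\<lambda>m. norm (part_sum g m x / real m - (\<integral>x. g x \<partial>p)) < e) sequentially"
      proof eventually_elim
        case (elim m)
        have "part_sum (\<lambda>x. -1 * g x + 0) m x = - part_sum g m x"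
          unfolding part_sum_def kop_power_affine[OF g x] by (simp add: sum_negf)
        then show ?case using elim by simp
      qed
      then show "\<exists>no. \<forall>n\<ge>no. norm (part_sum g n x / real n - (\<integral>x. g x \<partial>p)) < e"
        by (simp add: eventually_sequentially)
    qed
  qed
qed

text \<open>The second moment of the path average is an expression in the autocovariances
  \<open>c k\<close>. Their averages \<open>b j\<close> tend to 0, because they pair
  \<open>g\<close> with averages of the operator, which are bounded and converge almost everywhere
  to the mean 0.\<close>

lemma path_averages_L2:
  assumes g: "bounded_on S C g" and zero: "(\<integral>x. g x \<partial>p) = 0"
  shows "(\<lambda>m. \<integral>\<omega>. ((\<Sum>k<m. g (X k \<omega>)) / real m)\<^sup>2 \<partial>P) \<longlonglongrightarrow> 0"
proof -
  define c where "c k = (\<integral>x. g x * (kop ^^ k) g x \<partial>p)" for k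
  define b where "b j = (\<Sum>k<j. c (Suc k)) / real j" for j
  have kg: "bounded_on S C (kop g)" by (rule kop_bounded[OF g])
  have powb: "bounded_on S C ((kop ^^ k) g)" for k by (rule kop_power_bounded[OF g])
  obtain x0 where "x0 \<in> space S" using p.not_empty by auto
  then have C: "0 \<le> C" using bounded_onD(2)[OF g] abs_ge_zero[of "g x0"] by (meson order_trans)
  note [measurable] = bounded_onD(1)[OF g] bounded_onD(1)[OF powb] bounded_onD(1)[OF part_sum_bounded[OF kg]]
  have int: "integrable p (\<lambda>x. g x * (kop ^^ k) g x)" for k
    by (rule p.integrable_const_bound[where B = "C * C"])
      (auto intro!: AE_I2 abs_mult_bound bounded_onD(2)[OF g] bounded_onD(2)[OF powb])
  have b: "b \<longlonglongrightarrow> 0"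
  proof -
    have "b = (\<lambda>j. \<integral>x. g x * (part_sum (kop g) j x / real j) \<partial>p)"
    proof
      fix j
      have "(\<integral>x. g x * (part_sum (kop g) j x / real j) \<partial>p)
          = (\<integral>x. (\<Sum>k<j. g x * (kop ^^ Suc k) g x) / real j \<partial>p)"
        unfolding part_sum_def by (simp add: sum_distrib_left funpow_Suc_right del: funpow.simps)
      also have "\<dots> = b j"
        unfolding b_def c_def using int[of "Suc _"]
        by (subst integral_divide_zero, subst Bochner_Integration.integral_sum) auto
      finally show "b j = (\<integral>x. g x * (part_sum (kop g) j x / real j) \<partial>p)" by simp
    qed
    moreover have "(\<lambda>j. \<integral>x. g x * (part_sum (kop g) j x / real j) \<partial>p) \<longlonglongrightarrow> (\<integral>x. g x * 0 \<partial>p)"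
    proof (rule integral_dominated_convergence[where w = "\<lambda>_. C * C"])
      show "AE x in p. (\<lambda>j. g x * (part_sum (kop g) j x / real j)) \<longlonglongrightarrow> g x * 0"
        using averages_tendsto[OF kg] unfolding integral_kop[OF g] zero
        by eventually_elim (intro tendsto_mult_left)
      show "AE x in p. norm (g x * (part_sum (kop g) j x / real j)) \<le> C * C" for j
      proof (rule AE_I2)
        fix x assume "x \<in> space p"
        then have x: "x \<in> space S" by simp
        have "\<bar>part_sum (kop g) j x / real j\<bar> \<le> C"
          using bounded_onD(2)[OF part_sum_bounded[OF kg] x, of j] C by (cases "j = 0") (auto simp: field_simps)
        then show "norm (g x * (part_sum (kop g) j x / real j)) \<le> C * C"
          unfolding real_norm_def by (intro abs_mult_bound bounded_onD(2)[OF g x])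
      qed
    qed auto
    ultimately show ?thesis by (simp only: mult_zero_right integral_zero)
  qed
  define \<gamma> where "\<gamma> i j = (\<integral>\<omega>. g (X i \<omega>) * g (X j \<omega>) \<partial>P)" for i j
  have \<gamma>: "\<gamma> i (i + k) = c k" for i k
    unfolding \<gamma>_def c_def step_power[OF g g] by (rule integral_X) simp
  have iX: "integrable P (\<lambda>\<omega>. g (X i \<omega>) * g (X j \<omega>))" for i j
    by (rule integrable_const_bound[where B = "C * C"])
      (auto intro!: AE_I2 abs_mult_bound bounded_onD(2)[OF g] X_space)
  \<comment> \<open>\<open>sum_square_stationary\<close> in terms of \<open>b\<close>: the inner
    partial sums are \<open>real j * b j\<close>. Since j is at most m, the remaining term is
    dominated by a Cesaro mean of the absolute values of \<open>b\<close>.\<close>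
  have eq: "(\<integral>\<omega>. ((\<Sum>k<m. g (X k \<omega>)) / real m)\<^sup>2 \<partial>P)
      = c 0 / real m + 2 * ((\<Sum>j<m. real j * b j) / (real m)\<^sup>2)" for m
  proof -
    have "(\<integral>\<omega>. ((\<Sum>k<m. g (X k \<omega>)) / real m)\<^sup>2 \<partial>P)
       = (\<integral>\<omega>. (\<Sum>i<m. \<Sum>j<m. g (X i \<omega>) * g (X j \<omega>)) / (real m)\<^sup>2 \<partial>P)"
      by (simp add: power_divide power2_eq_square[of "sum _ _"] sum_product)
    also have "\<dots> = (\<Sum>i<m. \<Sum>j<m. \<gamma> i j) / (real m)\<^sup>2"
      unfolding \<gamma>_def using iX
      by (simp add: Bochner_Integration.integral_sum Bochner_Integration.integrable_sum)
    also have "(\<Sum>i<m. \<Sum>j<m. \<gamma> i j) = real m * c 0 + 2 * (\<Sum>j<m. \<Sum>k<j. c (Suc k))"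
      by (rule sum_square_stationary) (simp_all add: \<gamma>, simp add: \<gamma>_def mult.commute)
    also have "(\<Sum>j<m. \<Sum>k<j. c (Suc k)) = (\<Sum>j<m. real j * b j)"
      by (intro sum.cong) (auto simp: b_def)
    finally show ?thesis by (simp add: add_divide_distrib power2_eq_square)
  qed
  have "(\<lambda>m. (\<Sum>j<m. real j * b j) / (real m)\<^sup>2) \<longlonglongrightarrow> 0"
  proof (rule Lim_null_comparison)
    show "(\<lambda>m. (\<Sum>j<m. \<bar>b j\<bar>) / real m) \<longlonglongrightarrow> 0"
      using cesaro_mean_tendsto[OF tendsto_rabs_zero[OF b]] .
    show "eventually (\<lambda>m. norm ((\<Sum>j<m. real j * b j) / (real m)\<^sup>2) \<le> (\<Sum>j<m. \<bar>b j\<bar>) / real m) sequentially"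
      using eventually_gt_at_top[of 0]
    proof eventually_elim
      case (elim m)
      have "\<bar>\<Sum>j<m. real j * b j\<bar> \<le> (\<Sum>j<m. real m * \<bar>b j\<bar>)"
        by (rule order_trans[OF sum_abs]) (intro sum_mono, auto simp: abs_mult intro!: mult_right_mono)
      then have "\<bar>\<Sum>j<m. real j * b j\<bar> / (real m)\<^sup>2 \<le> (real m * (\<Sum>j<m. \<bar>b j\<bar>)) / (real m)\<^sup>2"
        by (intro divide_right_mono) (simp_all add: sum_distrib_left)
      then show ?case using elim by (simp add: power2_eq_square)
    qed
  qed
  then have "(\<lambda>m. c 0 / real m + 2 * ((\<Sum>j<m. real j * b j) / (real m)\<^sup>2)) \<longlonglongrightarrow> 0 + 2 * 0"
    by (intro tendsto_add tendsto_mult_left lim_const_over_n)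
  then show ?thesis by (simp add: eq)
qed

text \<open>Centring, then the comparison of first and second moments that is contained in
  nonnegativity of the variance.\<close>

lemma path_averages_L1:
  assumes g: "bounded_on S C g"
  shows "(\<lambda>m. \<integral>\<omega>. \<bar>(\<Sum>k<m. g (X k \<omega>) - (\<integral>x. g x \<partial>p)) / real m\<bar> \<partial>P) \<longlonglongrightarrow> 0"
proof -
  let ?c = "\<integral>x. g x \<partial>p"
  let ?g = "\<lambda>x. g x - ?c"
  have bg: "bounded_on S (C + \<bar>?c\<bar>) ?g" by (intro bounded_on_diff g bounded_on_const)
  have [simp]: "integrable p g" using g by (rule p.integrable_bounded_on) simp
  have "measure p (space S) = 1" using p.prob_space by simp
  then have z: "(\<integral>x. ?g x \<partial>p) = 0" by simp
  let ?Y = "\<lambda>m \<omega>. \<bar>(\<Sum>k<m. ?g (X k \<omega>)) / real m\<bar>"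
  have lim: "(\<lambda>m. sqrt (\<integral>\<omega>. (?Y m \<omega>)\<^sup>2 \<partial>P)) \<longlonglongrightarrow> 0"
    using tendsto_real_sqrt[OF path_averages_L2[OF bg z]] unfolding power2_abs real_sqrt_zero .
  show ?thesis
  proof (rule tendsto_sandwich[OF _ _ tendsto_const lim])
    have bs: "bounded_on S (C + \<bar>?c\<bar>) (\<lambda>x. ?g x)" by (rule bg)
    note [measurable] = bounded_onD(1)[OF bg]
    have "expectation (?Y m) \<le> sqrt (\<integral>\<omega>. (?Y m \<omega>)\<^sup>2 \<partial>P)" for m
    proof -
      let ?B = "(\<Sum>k<m. C + \<bar>?c\<bar>) / real m"
      have "?Y m \<omega> \<le> ?B" if "\<omega> \<in> space P" for \<omega>
      proof -
        have "\<bar>\<Sum>k<m. ?g (X k \<omega>)\<bar> \<le> (\<Sum>k<m. C + \<bar>?c\<bar>)"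
          by (rule order_trans[OF sum_abs]) (intro sum_mono bounded_onD(2)[OF bg] X_space that)
        then show ?thesis unfolding abs_divide abs_of_nat by (rule divide_right_mono) simp
      qed
      note Y = this
      have i: "integrable P (?Y m)" "integrable P (\<lambda>\<omega>. (?Y m \<omega>)\<^sup>2)"
      proof -
        show "integrable P (?Y m)"
          by (rule integrable_const_bound[where B = ?B], rule AE_I2, unfold real_norm_def abs_idempotent, erule Y) simp
        have "norm ((?Y m \<omega>)\<^sup>2) \<le> ?B\<^sup>2" if "\<omega> \<in> space P" for \<omega>
          unfolding real_norm_def abs_power2 by (rule power_mono[OF Y[OF that]]) simp
        then show "integrable P (\<lambda>\<omega>. (?Y m \<omega>)\<^sup>2)"
          by (intro integrable_const_bound[where B = "?B\<^sup>2"] AE_I2) auto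
      qed
      have "0 \<le> variance (?Y m)" by (rule variance_positive)
      then have "(expectation (?Y m))\<^sup>2 \<le> (\<integral>\<omega>. (?Y m \<omega>)\<^sup>2 \<partial>P)"
        unfolding variance_eq[OF i] by simp
      then show ?thesis by (rule real_le_rsqrt)
    qed
    then show "eventually (\<lambda>m. expectation (?Y m) \<le> sqrt (\<integral>\<omega>. (?Y m \<omega>)\<^sup>2 \<partial>P)) sequentially" by simp
  qed (auto intro!: always_eventually integral_nonneg_AE)
qed

end

section \<open>Transfer of limit laws to arbitrary starts\<close>

text \<open>The truncation at 2 makes the later error terms integrable for every measurable
  \<open>f\<close>, whatever its moments.\<close>

lemma norm_iexp_diff_le: "cmod (iexp a - iexp b) \<le> min 2 \<bar>a - b\<bar>"
proof -
  have "cmod (iexp a - iexp b) \<le> cmod (iexp a) + cmod (iexp b)" by (rule norm_triangle_ineq4)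
  then have 1: "cmod (iexp a - iexp b) \<le> 2" by simp
  have "iexp a - iexp b = iexp b * (iexp (a - b) - 1)"
    by (simp add: exp_diff of_real_diff right_diff_distrib[of \<i>] right_diff_distrib[of "iexp b"])
  then have "cmod (iexp a - iexp b) = cmod (iexp (a - b) - 1)"
    by (simp add: norm_mult)
  also have "\<dots> \<le> \<bar>a - b\<bar>" using iexp_approx1[of "a - b" 0] by simp
  finally show ?thesis using 1 by simp
qed

text \<open>Subadditivity of the truncated modulus: changing several summands of the exponent costs
  at most the sum of the single costs.\<close>

lemma min_abs_sum_le: "finite J \<Longrightarrow> min 2 \<bar>\<Sum>j\<in>J. a j\<bar> \<le> (\<Sum>j\<in>J. min 2 \<bar>a j :: real\<bar>)"
proof (induction J rule: finite_induct)
  case (insert x J)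
  have "min 2 \<bar>\<Sum>j\<in>insert x J. a j\<bar> \<le> min 2 \<bar>a x\<bar> + min 2 \<bar>\<Sum>j\<in>J. a j\<bar>"
  proof -
    have "min 2 \<bar>u + v\<bar> \<le> min 2 \<bar>u\<bar> + min 2 \<bar>v\<bar>" for u v :: real
      by (auto simp: min_def)
    then show ?thesis using insert(1,2) by simp
  qed
  then show ?case using insert by simp
qed simp

lemma sum_shift_split: "(\<Sum>i<n + k. a i) = (\<Sum>i<k. a i) + (\<Sum>i<n. a (i + k) :: 'b :: comm_monoid_add)"
  for n k :: nat
  by (induction n) (auto simp: ac_simps)

text \<open>Maximise the mass under \<open>M\<close> over the null sets of \<open>p\<close>. The
  union of a maximising sequence is again null and attains the supremum, so no further null set can
  add mass outside it. Such a set carries the singular part in the Lebesgue decomposition.\<close>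

lemma (in finite_measure) exhaust_null_sets:
  assumes sets: "sets p = sets M"
  shows "\<exists>D\<in>null_sets p. \<forall>E\<in>null_sets p. emeasure M (E - D) = 0"
proof -
  have "null_sets p \<noteq> {}" by auto
  from ennreal_SUP_countable_SUP[OF this, of "emeasure M"]
  obtain u :: "nat \<Rightarrow> ennreal" where u: "range u \<subseteq> emeasure M ` null_sets p"
    "(SUP D\<in>null_sets p. emeasure M D) = (SUP i. u i)" by auto
  from u(1) have "\<forall>i. \<exists>D. D \<in> null_sets p \<and> u i = emeasure M D" by auto
  then obtain D where D: "\<And>i. D i \<in> null_sets p" "\<And>i. u i = emeasure M (D i)" by metis
  let ?D = "\<Union>i. D i"
  have null: "?D \<in> null_sets p" using D(1) by (intro null_sets_UN)
  have meas: "E \<in> null_sets p \<Longrightarrow> E \<in> sets M" for E using sets by auto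
  have le: "(SUP D\<in>null_sets p. emeasure M D) \<le> emeasure M ?D"
    unfolding u(2) D(2) using meas[OF null] by (intro SUP_least emeasure_mono) auto
  have "emeasure M (E - ?D) = 0" if E: "E \<in> null_sets p" for E
  proof -
    have "emeasure M ?D + emeasure M (E - ?D) = emeasure M (?D \<union> E)"
      using meas[OF null] meas[OF E] by (subst plus_emeasure) (auto intro!: arg_cong[where f = "emeasure M"])
    also have "\<dots> \<le> (SUP D\<in>null_sets p. emeasure M D)"
      using null E by (intro SUP_upper) auto
    also have "\<dots> \<le> emeasure M ?D + 0" using le by simp
    finally have "emeasure M (E - ?D) \<le> 0"
      using emeasure_finite[of ?D] by (subst (asm) ennreal_add_left_cancel_le) (auto simp: top_unique)
    then show ?thesis by simp
  qed
  with null show ?thesis by blast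
qed

context mchain begin

text \<open>Restricting to the event that \<open>X k\<close> lies outside \<open>D\<close> reweights
  by a function of the initial state of the chain shifted by \<open>k\<close>, so the shifted chain
  keeps its kernel. The restriction is not normalised.\<close>

lemma avoiding_chain:
  fixes k :: nat
  assumes fin: "finite_measure P" and [measurable]: "D \<in> sets S"
  defines "Q \<equiv> density P (\<lambda>\<omega>. indicator (space S - D) (X k \<omega>))"
  shows "markov_chain Q S K (\<lambda>n. X (n + k))" "finite_measure Q"
    and "\<And>B n. B \<in> sets S \<Longrightarrow> emeasure (distr Q S (X n)) B = emeasure P {\<omega> \<in> space P. X k \<omega> \<notin> D \<and> X n \<omega> \<in> B}"
proof -
  interpret finite_measure P by fact
  interpret sh: mchain P S K "\<lambda>n. X (n + k)" by standard (rule markov_chain_shift)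
  show "markov_chain Q S K (\<lambda>n. X (n + k))"
    unfolding Q_def using sh.markov_chain_density[of "indicator (space S - D)"] by simp
  have em: "emeasure Q A = emeasure P {\<omega> \<in> space P. X k \<omega> \<notin> D \<and> \<omega> \<in> A}" if A[measurable]: "A \<in> sets P" for A
  proof -
    have "emeasure Q A = (\<integral>\<^sup>+\<omega>. indicator (space S - D) (X k \<omega>) * indicator A \<omega> \<partial>P)"
      unfolding Q_def by (rule emeasure_density) measurable
    also have "\<dots> = (\<integral>\<^sup>+\<omega>. indicator {\<omega> \<in> space P. X k \<omega> \<notin> D \<and> \<omega> \<in> A} \<omega> \<partial>P)"
      by (intro nn_integral_cong) (auto simp: X_space split: split_indicator)
    also have "\<dots> = emeasure P {\<omega> \<in> space P. X k \<omega> \<notin> D \<and> \<omega> \<in> A}"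
      by (rule nn_integral_indicator) measurable
    finally show ?thesis .
  qed
  show "finite_measure Q"
    by (rule finite_measureI) (simp add: em Q_def[symmetric], simp add: Q_def em[unfolded Q_def])
  show "emeasure (distr Q S (X n)) B = emeasure P {\<omega> \<in> space P. X k \<omega> \<notin> D \<and> X n \<omega> \<in> B}" if [measurable]: "B \<in> sets S" for B n
  proof -
    have "X n \<in> Q \<rightarrow>\<^sub>M S" unfolding Q_def by simp
    then have "emeasure (distr Q S (X n)) B = emeasure Q (X n -` B \<inter> space P)"
      by (simp add: emeasure_distr Q_def)
    also have "\<dots> = emeasure P {\<omega> \<in> space P. X k \<omega> \<notin> D \<and> X n \<omega> \<in> B}"
      by (subst em) (auto intro!: arg_cong[where f = "emeasure P"])
    finally show ?thesis .
  qed
qed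

text \<open>A null set \<open>D\<close> that carries the singular parts of all the marginal laws at once: once outside
  \<open>D\<close>, the chain has an absolutely continuous law for ever, hence never returns to \<open>D\<close>.\<close>

lemma singular_part_vanishes:
  assumes fin: "finite_measure P" and p[measurable_cong]: "sets p = sets S"
    and inv: "\<And>B. B \<in> sets S \<Longrightarrow> emeasure p B = (\<integral>\<^sup>+x. emeasure (K x) B \<partial>p)"
    and hit: "\<And>D x. D \<in> null_sets p \<Longrightarrow> x \<in> space S \<Longrightarrow> AE \<omega> in path_law S K (return S x). \<exists>n. \<omega> n \<notin> D"
  obtains D where "D \<in> null_sets p"
    "\<And>k. absolutely_continuous p (distr (density P (\<lambda>\<omega>. indicator (space S - D) (X k \<omega>))) S (X k))"
    "(\<lambda>n. emeasure P {\<omega> \<in> space P. X n \<omega> \<in> D}) \<longlonglongrightarrow> 0"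
proof -
  interpret finite_measure P by fact
  have "\<exists>D\<in>null_sets p. \<forall>E\<in>null_sets p. emeasure (distr P S (X k)) (E - D) = 0" for k
    by (rule finite_measure.exhaust_null_sets[OF finite_measure_distr]) (simp_all add: p)
  \<comment> \<open>One carrier for each time; their countable union \<open>D\<close> serves for all
    times at once.\<close>
  then obtain D' where D': "\<And>k. D' k \<in> null_sets p"
    "\<And>k E. E \<in> null_sets p \<Longrightarrow> emeasure (distr P S (X k)) (E - D' k) = 0"
    by metis
  define D where "D = (\<Union>k. D' k)"
  have D: "D \<in> null_sets p" unfolding D_def using D'(1) by (intro null_sets_UN)
  have D'D: "x \<in> D' k \<Longrightarrow> x \<in> D" for x k by (auto simp: D_def)
  have DS[measurable]: "D \<in> sets S" using D p by auto
  have ac: "absolutely_continuous p (distr (density P (\<lambda>\<omega>. indicator (space S - D) (X k \<omega>))) S (X k))" for k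
    unfolding absolutely_continuous_def
  proof safe
    fix E assume E: "E \<in> null_sets p"
    then have [measurable]: "E \<in> sets S" "D' k \<in> sets S" using p D'(1)[of k] by auto
    have "emeasure P {\<omega> \<in> space P. X k \<omega> \<notin> D \<and> X k \<omega> \<in> E} \<le> emeasure P (X k -` (E - D' k) \<inter> space P)"
      by (intro emeasure_mono) (auto dest: D'D)
    also have "\<dots> = 0" using D'(2)[OF E, of k] by (simp add: emeasure_distr)
    finally show "E \<in> null_sets (distr (density P (\<lambda>\<omega>. indicator (space S - D) (X k \<omega>))) S (X k))"
      using avoiding_chain(3)[OF fin DS, of E k k] by (auto simp: null_sets_def)
  qed
  \<comment> \<open>Seen from time \<open>k\<close>, the chain restricted to \<open>X k\<close>
    outside \<open>D\<close> starts absolutely continuous and stays so by invariance of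
    \<open>p\<close>; hence it has no mass on the null set \<open>D\<close> at any later
    time.\<close>
  have ret: "emeasure P {\<omega> \<in> space P. X k \<omega> \<notin> D \<and> X n \<omega> \<in> D} = 0" if "k \<le> n" for k n
  proof -
    let ?Q = "density P (\<lambda>\<omega>. indicator (space S - D) (X k \<omega>))"
    interpret Q: mchain ?Q S K "\<lambda>n. X (n + k)" by standard (rule avoiding_chain(1)[OF fin DS])
    have "absolutely_continuous p (distr ?Q S (X (n - k + k)))"
      by (rule Q.absolutely_continuous_law[OF p inv]) (simp_all add: ac)
    then have "absolutely_continuous p (distr ?Q S (X n))" unfolding le_add_diff_inverse2[OF that] .
    then have "D \<in> null_sets (distr ?Q S (X n))"
      using D unfolding absolutely_continuous_def by blast
    then have "emeasure (distr ?Q S (X n)) D = 0" by (rule null_setsD1)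
    then show ?thesis by (simp only: avoiding_chain(3)[OF fin DS DS])
  qed
  have "emeasure P {\<omega> \<in> space P. X n \<omega> \<in> D} \<le> emeasure P {\<omega> \<in> space P. \<forall>j\<le>n. X j \<omega> \<in> D}" for n
  proof -
    \<comment> \<open>Up to the null event \<open>?N\<close> of a return, being in \<open>D\<close>
      at time \<open>n\<close> means having been in \<open>D\<close> at every earlier time.\<close>
    let ?N = "\<Union>k\<in>{..n}. {\<omega> \<in> space P. X k \<omega> \<notin> D \<and> X n \<omega> \<in> D}"
    have "{\<omega> \<in> space P. X k \<omega> \<notin> D \<and> X n \<omega> \<in> D} \<in> null_sets P" if "k \<le> n" for k
      by (rule null_setsI[OF ret[OF that]]) measurable
    then have N: "?N \<in> null_sets P"
      by (intro null_sets_UN') simp_all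
    have C[measurable]: "{\<omega> \<in> space P. \<forall>j\<le>n. X j \<omega> \<in> D} \<in> sets P" by measurable
    have "emeasure P {\<omega> \<in> space P. X n \<omega> \<in> D} \<le> emeasure P ({\<omega> \<in> space P. \<forall>j\<le>n. X j \<omega> \<in> D} \<union> ?N)"
    proof (rule emeasure_mono)
      show "{\<omega> \<in> space P. X n \<omega> \<in> D} \<subseteq> {\<omega> \<in> space P. \<forall>j\<le>n. X j \<omega> \<in> D} \<union> ?N" by blast
      show "{\<omega> \<in> space P. \<forall>j\<le>n. X j \<omega> \<in> D} \<union> ?N \<in> sets P"
        using C null_setsD2[OF N] by (rule sets.Un)
    qed
    also have "\<dots> = emeasure P {\<omega> \<in> space P. \<forall>j\<le>n. X j \<omega> \<in> D}"
      using N C by (intro emeasure_Un_null_set)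
    finally show ?thesis .
  qed
  note le = this
  have up: "(\<lambda>n. emeasure P {\<omega> \<in> space P. \<forall>j\<le>n. X j \<omega> \<in> D}) \<longlonglongrightarrow> 0"
    by (rule confined_tendsto_0(1)[OF fin DS hit[OF D]])
  have "(\<lambda>n. emeasure P {\<omega> \<in> space P. X n \<omega> \<in> D}) \<longlonglongrightarrow> 0"
  proof (rule tendsto_sandwich[OF _ _ tendsto_const up])
    show "\<forall>\<^sub>F n in sequentially. emeasure P {\<omega> \<in> space P. X n \<omega> \<in> D} \<le> emeasure P {\<omega> \<in> space P. \<forall>j\<le>n. X j \<omega> \<in> D}"
      using le by (rule always_eventually[OF allI])
  qed simp
  with D ac show thesis by (rule that)
qed

end

lemma (in stationary_chain) stationary_past:
  "distr P (PiM {..n} (\<lambda>_. S)) (past (\<lambda>n. X (n + k)) n) = distr P (PiM {..n} (\<lambda>_. S)) (past X n)"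
  by (rule markov_chain_law_unique[OF markov_chain_shift mc finite_measure_axioms]) (simp add: law)

text \<open>The parameter \<open>m\<close> is fixed first to make \<open>a m\<close> small, and only
  then does \<open>n\<close> tend to infinity; no uniformity of the limits of \<open>w m\<close> in
  \<open>m\<close> is asked.\<close>

lemma two_scale_tendsto_0:
  fixes z :: "nat \<Rightarrow> 'b :: real_normed_vector" and a :: "nat \<Rightarrow> real"
  assumes le: "\<And>m. eventually (\<lambda>n. norm (z n) \<le> a m + w m n) sequentially"
    and a: "a \<longlonglongrightarrow> 0" and w: "\<And>m. w m \<longlonglongrightarrow> 0"
  shows "z \<longlonglongrightarrow> 0"
proof (rule tendsto_norm_zero_cancel, rule order_tendstoI)
  fix e :: real assume e: "0 < e"
  obtain m where m: "a m < e / 2"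
    using order_tendstoD(2)[OF a half_gt_zero[OF e]] by (auto simp: eventually_sequentially)
  have "eventually (\<lambda>n. w m n < e / 2) sequentially"
    by (rule order_tendstoD(2)[OF w half_gt_zero[OF e]])
  with le[of m] show "eventually (\<lambda>n. norm (z n) < e) sequentially"
    by eventually_elim (use m in linarith)
next
  fix e :: real assume "e < 0"
  then show "eventually (\<lambda>n. e < norm (z n)) sequentially"
    by (intro always_eventually allI) (rule less_le_trans, assumption, rule norm_ge_zero)
qed

lemma (in prob_space) truncated_scaling_tendsto_0:
  fixes Z :: "'a \<Rightarrow> real"
  assumes [measurable]: "Z \<in> borel_measurable M"
  shows "(\<lambda>n. \<integral>\<omega>. min 2 \<bar>t / sqrt (real n) * Z \<omega>\<bar> \<partial>M) \<longlonglongrightarrow> 0"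
proof -
  have "(\<lambda>n. \<integral>\<omega>. min 2 \<bar>t / sqrt (real n) * Z \<omega>\<bar> \<partial>M) \<longlonglongrightarrow> (\<integral>\<omega>. 0 \<partial>M)"
  proof (rule integral_dominated_convergence[where w = "\<lambda>_. 2"])
    show "AE \<omega> in M. (\<lambda>n. min 2 \<bar>t / sqrt (real n) * Z \<omega>\<bar>) \<longlonglongrightarrow> 0"
    proof (rule AE_I2)
      fix \<omega>
      have "(\<lambda>n. t / sqrt (real n)) \<longlonglongrightarrow> 0"
        by (intro real_tendsto_divide_at_top[OF tendsto_const] filterlim_compose[OF sqrt_at_top] filterlim_real_sequentially)
      then have "(\<lambda>n. min 2 \<bar>t / sqrt (real n) * Z \<omega>\<bar>) \<longlonglongrightarrow> min 2 \<bar>0 * Z \<omega>\<bar>"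
        by (intro tendsto_intros)
      then show "(\<lambda>n. min 2 \<bar>t / sqrt (real n) * Z \<omega>\<bar>) \<longlonglongrightarrow> 0" by simp
    qed
  qed (auto intro!: AE_I2)
  then show ?thesis by simp
qed

text \<open>At frequency \<open>t / sqrt (real n)\<close> the expectation of \<open>phase\<close>
  for the centred function is the characteristic function at \<open>t\<close> of the normalized
  mean. The argument is a sequence, so that it can be a path or a finite history.\<close>

definition phase :: "('a \<Rightarrow> real) \<Rightarrow> real \<Rightarrow> nat \<Rightarrow> (nat \<Rightarrow> 'a) \<Rightarrow> complex" where
  "phase f s n x = iexp (s * (\<Sum>i<n. f (x i)))"

lemma norm_phase[simp]: "cmod (phase f s n x) = 1"
  by (simp add: phase_def)

lemma phase_past: "n \<le> Suc m \<Longrightarrow> phase f s n (past X m \<omega>) = phase f s n (\<lambda>i. X i \<omega>)"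
  by (simp add: phase_def)

lemma phase_measurable:
  assumes "f \<in> borel_measurable S" "n \<le> Suc m"
  shows "phase f s n \<in> borel_measurable (PiM {..m} (\<lambda>_. S))"
proof -
  have "(\<lambda>x. f (x i)) \<in> borel_measurable (PiM {..m} (\<lambda>_. S))" if "i < n" for i
    using that assms by (intro measurable_compose[OF measurable_component_singleton]) auto
  then have [measurable]: "(\<lambda>x. \<Sum>i<n. f (x i)) \<in> borel_measurable (PiM {..m} (\<lambda>_. S))"
    by (intro borel_measurable_sum) auto
  show ?thesis unfolding phase_def by measurable
qed

context prob_chain begin

lemma phase_X_measurable[measurable]:
  assumes [measurable]: "f \<in> borel_measurable S"
  shows "(\<lambda>\<omega>. phase f s n (\<lambda>i. X (h i) \<omega>)) \<in> borel_measurable P"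
  unfolding phase_def by measurable

lemma integrable_weighted_phase:
  assumes [measurable]: "f \<in> borel_measurable S" and g: "integrable P g"
  shows "integrable P (\<lambda>\<omega>. complex_of_real (g \<omega>) * phase f s n (\<lambda>i. X (h i) \<omega>))"
  using g by (rule Bochner_Integration.integrable_bound) (use g in \<open>auto simp: norm_mult\<close>)

end

context stationary_chain begin

text \<open>Bounds the expected cost of adding or deleting one summand of the exponent; by
  stationarity the position of the summand does not matter.\<close>

definition phase_defect :: "('a \<Rightarrow> real) \<Rightarrow> real \<Rightarrow> real" where
  "phase_defect f s = (\<integral>x. min 2 \<bar>s * f x\<bar> \<partial>p)"

lemma phase_defect_X:
  assumes [measurable]: "f \<in> borel_measurable S"
  shows "(\<integral>\<omega>. min 2 \<bar>s * f (X i \<omega>)\<bar> \<partial>P) = phase_defect f s"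
    and "integrable P (\<lambda>\<omega>. min 2 \<bar>s * f (X i \<omega>)\<bar>)"
  unfolding phase_defect_def
  by (rule integral_X) (auto intro!: integrable_const_bound[where B = 2])

lemma phase_drop:
  assumes [measurable]: "f \<in> borel_measurable S"
  shows "(\<integral>\<omega>. cmod (phase f s n (\<lambda>i. X i \<omega>) - phase f s (n + k) (\<lambda>i. X i \<omega>)) \<partial>P) \<le> real k * phase_defect f s"
proof -
  have "(\<integral>\<omega>. cmod (phase f s n (\<lambda>i. X i \<omega>) - phase f s (n + k) (\<lambda>i. X i \<omega>)) \<partial>P)
      \<le> (\<integral>\<omega>. (\<Sum>j<k. min 2 \<bar>s * f (X (j + n) \<omega>)\<bar>) \<partial>P)"
  proof (rule integral_mono)
    show "integrable P (\<lambda>\<omega>. cmod (phase f s n (\<lambda>i. X i \<omega>) - phase f s (n + k) (\<lambda>i. X i \<omega>)))"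
      by (rule integrable_const_bound[where B = 2])
        (auto intro!: AE_I2 order_trans[OF norm_triangle_ineq4])
    show "integrable P (\<lambda>\<omega>. \<Sum>j<k. min 2 \<bar>s * f (X (j + n) \<omega>)\<bar>)"
      by (intro Bochner_Integration.integrable_sum phase_defect_X) simp
    fix \<omega>
    have "cmod (phase f s n (\<lambda>i. X i \<omega>) - phase f s (n + k) (\<lambda>i. X i \<omega>))
        \<le> min 2 \<bar>s * (\<Sum>i<n. f (X i \<omega>)) - s * (\<Sum>i<n + k. f (X i \<omega>))\<bar>"
      unfolding phase_def by (rule norm_iexp_diff_le)
    also have "s * (\<Sum>i<n. f (X i \<omega>)) - s * (\<Sum>i<n + k. f (X i \<omega>)) = - (\<Sum>j<k. s * f (X (j + n) \<omega>))"
      unfolding add.commute[of n k] sum_shift_split[of _ k n] by (simp add: sum_distrib_left algebra_simps)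
    also have "min 2 \<bar>- (\<Sum>j<k. s * f (X (j + n) \<omega>))\<bar> \<le> (\<Sum>j<k. min 2 \<bar>s * f (X (j + n) \<omega>)\<bar>)"
      unfolding abs_minus_cancel by (rule min_abs_sum_le) simp
    finally show "cmod (phase f s n (\<lambda>i. X i \<omega>) - phase f s (n + k) (\<lambda>i. X i \<omega>))
        \<le> (\<Sum>j<k. min 2 \<bar>s * f (X (j + n) \<omega>)\<bar>)" .
  qed
  also have "\<dots> = real k * phase_defect f s"
    by (subst Bochner_Integration.integral_sum) (simp_all add: phase_defect_X)
  finally show ?thesis .
qed

text \<open>A shift by \<open>k\<close> adds \<open>k\<close> summands at the end and deletes
  \<open>k\<close> at the beginning, whence the factor \<open>2 * real k\<close>; the bound does not
  grow with the number \<open>n\<close> of summands.\<close>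

lemma phase_shift:
  assumes [measurable]: "f \<in> borel_measurable S"
  shows "(\<integral>\<omega>. cmod (phase f s n (\<lambda>i. X (i + k) \<omega>) - phase f s n (\<lambda>i. X i \<omega>)) \<partial>P) \<le> 2 * real k * phase_defect f s"
proof -
  have "(\<integral>\<omega>. cmod (phase f s n (\<lambda>i. X (i + k) \<omega>) - phase f s n (\<lambda>i. X i \<omega>)) \<partial>P)
      \<le> (\<integral>\<omega>. (\<Sum>j<k. min 2 \<bar>s * f (X (j + n) \<omega>)\<bar> + min 2 \<bar>s * f (X j \<omega>)\<bar>) \<partial>P)"
  proof (rule integral_mono)
    show "integrable P (\<lambda>\<omega>. cmod (phase f s n (\<lambda>i. X (i + k) \<omega>) - phase f s n (\<lambda>i. X i \<omega>)))"
      by (rule integrable_const_bound[where B = 2])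
        (auto intro!: AE_I2 order_trans[OF norm_triangle_ineq4])
    show "integrable P (\<lambda>\<omega>. \<Sum>j<k. min 2 \<bar>s * f (X (j + n) \<omega>)\<bar> + min 2 \<bar>s * f (X j \<omega>)\<bar>)"
      by (intro Bochner_Integration.integrable_sum Bochner_Integration.integrable_add phase_defect_X) simp_all
    fix \<omega>
    have "cmod (phase f s n (\<lambda>i. X (i + k) \<omega>) - phase f s n (\<lambda>i. X i \<omega>))
        \<le> min 2 \<bar>s * (\<Sum>i<n. f (X (i + k) \<omega>)) - s * (\<Sum>i<n. f (X i \<omega>))\<bar>"
      unfolding phase_def by (rule norm_iexp_diff_le)
    also have "s * (\<Sum>i<n. f (X (i + k) \<omega>)) - s * (\<Sum>i<n. f (X i \<omega>))
        = (\<Sum>j<k. s * f (X (j + n) \<omega>) - s * f (X j \<omega>))"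
    proof -
      have "(\<Sum>i<n. f (X (i + k) \<omega>)) - (\<Sum>i<n. f (X i \<omega>)) = (\<Sum>j<k. f (X (j + n) \<omega>)) - (\<Sum>j<k. f (X j \<omega>))"
        using sum_shift_split[of "\<lambda>i. f (X i \<omega>)" n k] sum_shift_split[of "\<lambda>i. f (X i \<omega>)" k n]
        by (simp add: add.commute)
      then show ?thesis
        by (simp add: sum_subtractf sum_distrib_left[symmetric] right_diff_distrib[symmetric])
    qed
    also have "min 2 \<bar>\<Sum>j<k. s * f (X (j + n) \<omega>) - s * f (X j \<omega>)\<bar>
        \<le> (\<Sum>j<k. min 2 \<bar>s * f (X (j + n) \<omega>) - s * f (X j \<omega>)\<bar>)"
      by (rule min_abs_sum_le) simp
    also have "\<dots> \<le> (\<Sum>j<k. min 2 \<bar>s * f (X (j + n) \<omega>)\<bar> + min 2 \<bar>s * f (X j \<omega>)\<bar>)"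
    proof (rule sum_mono)
      have "min 2 \<bar>u - v\<bar> \<le> min 2 \<bar>u\<bar> + min 2 \<bar>v\<bar>" for u v :: real by (auto simp: min_def)
      then show "min 2 \<bar>s * f (X (j + n) \<omega>) - s * f (X j \<omega>)\<bar>
          \<le> min 2 \<bar>s * f (X (j + n) \<omega>)\<bar> + min 2 \<bar>s * f (X j \<omega>)\<bar>" for j .
    qed
    finally show "cmod (phase f s n (\<lambda>i. X (i + k) \<omega>) - phase f s n (\<lambda>i. X i \<omega>))
        \<le> (\<Sum>j<k. min 2 \<bar>s * f (X (j + n) \<omega>)\<bar> + min 2 \<bar>s * f (X j \<omega>)\<bar>)" .
  qed
  also have "\<dots> = 2 * real k * phase_defect f s"
    by (subst Bochner_Integration.integral_sum) (simp_all add: phase_defect_X)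
  finally show ?thesis .
qed

lemma weighted_phase_stationary:
  assumes [measurable]: "f \<in> borel_measurable S" "g \<in> borel_measurable S"
  shows "(\<integral>\<omega>. complex_of_real (g (X k \<omega>)) * phase f s n (\<lambda>i. X (i + k) \<omega>) \<partial>P)
       = (\<integral>\<omega>. complex_of_real (g (X 0 \<omega>)) * phase f s n (\<lambda>i. X i \<omega>) \<partial>P)"
proof -
  let ?S = "PiM {..n} (\<lambda>_. S)"
  let ?h = "\<lambda>x. complex_of_real (g (x 0)) * phase f s n x"
  have [measurable]: "phase f s n \<in> borel_measurable ?S" by (rule phase_measurable) simp_all
  have h: "?h \<in> borel_measurable ?S" by measurable
  have "(\<integral>x. ?h x \<partial>distr P ?S (past (\<lambda>n. X (n + k)) n)) = (\<integral>x. ?h x \<partial>distr P ?S (past X n))"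
    by (simp only: stationary_past)
  then show ?thesis
    by (subst (asm) (1 2) integral_distr) (simp_all add: h phase_past)
qed

end

context harris_chain begin

text \<open>Let Y be the phase. Stationarity makes the expectation of \<open>g (X j)\<close> times Y
  shifted by \<open>j\<close> the same for all \<open>j\<close>. Replacing the shifted Y by Y costs
  \<open>phase_shift\<close>; averaging over \<open>j\<close> then leaves Y paired with a path
  average of \<open>g\<close>, which is small in L1 by ergodicity.\<close>

lemma phase_mixing_bounded:
  assumes f[measurable]: "f \<in> borel_measurable S" and g: "bounded_on S B g" and zero: "(\<integral>x. g x \<partial>p) = 0"
  shows "(\<lambda>n. \<integral>\<omega>. complex_of_real (g (X 0 \<omega>)) * phase f (t / sqrt (real n)) n (\<lambda>i. X i \<omega>) \<partial>P) \<longlonglongrightarrow> 0"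
proof -
  note [measurable] = bounded_onD(1)[OF g]
  define a where "a m = (\<integral>\<omega>. \<bar>(\<Sum>k<m. g (X k \<omega>)) / real m\<bar> \<partial>P)" for m
  have a: "a \<longlonglongrightarrow> 0" using path_averages_L1[OF g] unfolding a_def zero by simp
  let ?D = "\<lambda>n. phase_defect f (t / sqrt (real n))"
  have D: "?D \<longlonglongrightarrow> 0"
    unfolding phase_defect_def by (rule p.truncated_scaling_tendsto_0) simp
  obtain x0 where "x0 \<in> space S" using p.not_empty by auto
  then have B: "0 \<le> B" using bounded_onD(2)[OF g] abs_ge_zero[of "g x0"] by (meson order_trans)
  have iX: "integrable P (\<lambda>\<omega>. g (X k \<omega>))" for k by (rule integrable_bounded_on_compose[OF g]) simp
  show ?thesis
  \<comment> \<open>The length of the averaging window is fixed before \<open>n\<close> grows; it is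
    \<open>Suc m\<close>, hence never 0.\<close>
  proof (rule two_scale_tendsto_0)
    show "(\<lambda>m. a (Suc m)) \<longlonglongrightarrow> 0" by (rule LIMSEQ_Suc[OF a])
    show "(\<lambda>n. (\<Sum>j<Suc m. B * (2 * real j * ?D n)) / real (Suc m)) \<longlonglongrightarrow> 0" for m
    proof -
      have "(\<lambda>n. (\<Sum>j<Suc m. B * (2 * real j * ?D n)) / real (Suc m)) \<longlonglongrightarrow> (\<Sum>j<Suc m. B * (2 * real j * 0)) / real (Suc m)"
        by (intro tendsto_intros D) simp
      then show ?thesis by simp
    qed
    fix m
    show "eventually (\<lambda>n. norm (\<integral>\<omega>. complex_of_real (g (X 0 \<omega>)) * phase f (t / sqrt (real n)) n (\<lambda>i. X i \<omega>) \<partial>P)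
        \<le> a (Suc m) + (\<Sum>j<Suc m. B * (2 * real j * ?D n)) / real (Suc m)) sequentially"
    proof (rule always_eventually, rule allI)
      fix n
      let ?s = "t / sqrt (real n)"
      let ?Y = "\<lambda>j \<omega>. phase f ?s n (\<lambda>i. X (i + j) \<omega>)"
      let ?I = "\<integral>\<omega>. complex_of_real (g (X 0 \<omega>)) * phase f ?s n (\<lambda>i. X i \<omega>) \<partial>P"
      let ?M = "Suc m"
      have i1: "integrable P (\<lambda>\<omega>. complex_of_real (g (X j \<omega>)) * ?Y j' \<omega>)" for j j'
        by (rule integrable_weighted_phase[OF f iX])
      have "of_nat ?M * ?I = (\<Sum>j<?M. \<integral>\<omega>. complex_of_real (g (X j \<omega>)) * ?Y j \<omega> \<partial>P)"
        by (simp add: weighted_phase_stationary)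
      also have "\<dots> = (\<Sum>j<?M. (\<integral>\<omega>. complex_of_real (g (X j \<omega>)) * ?Y 0 \<omega> \<partial>P)
          + (\<integral>\<omega>. complex_of_real (g (X j \<omega>)) * (?Y j \<omega> - ?Y 0 \<omega>) \<partial>P))"
        using i1[of _ 0] i1 by (intro sum.cong refl) (simp add: right_diff_distrib)
      also have "\<dots> = (\<integral>\<omega>. complex_of_real (\<Sum>j<?M. g (X j \<omega>)) * ?Y 0 \<omega> \<partial>P)
          + (\<Sum>j<?M. \<integral>\<omega>. complex_of_real (g (X j \<omega>)) * (?Y j \<omega> - ?Y 0 \<omega>) \<partial>P)"
        unfolding sum.distrib of_real_sum sum_distrib_right
        using i1[of _ 0] by (subst Bochner_Integration.integral_sum) simp_all
      finally have eq: "of_nat ?M * ?I = (\<integral>\<omega>. complex_of_real (\<Sum>j<?M. g (X j \<omega>)) * ?Y 0 \<omega> \<partial>P)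
          + (\<Sum>j<?M. \<integral>\<omega>. complex_of_real (g (X j \<omega>)) * (?Y j \<omega> - ?Y 0 \<omega>) \<partial>P)" .
      have n1: "norm (\<integral>\<omega>. complex_of_real (\<Sum>j<?M. g (X j \<omega>)) * ?Y 0 \<omega> \<partial>P) \<le> real ?M * a ?M"
      proof -
        have "norm (\<integral>\<omega>. complex_of_real (\<Sum>j<?M. g (X j \<omega>)) * ?Y 0 \<omega> \<partial>P)
            \<le> (\<integral>\<omega>. norm (complex_of_real (\<Sum>j<?M. g (X j \<omega>)) * ?Y 0 \<omega>) \<partial>P)"
          by (rule integral_norm_bound)
        also have "\<dots> = (\<integral>\<omega>. real ?M * \<bar>(\<Sum>j<?M. g (X j \<omega>)) / real ?M\<bar> \<partial>P)"
          unfolding norm_mult norm_of_real norm_phase by (intro Bochner_Integration.integral_cong) auto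
        also have "\<dots> = real ?M * a ?M" unfolding a_def by simp
        finally show ?thesis .
      qed
      have n2: "norm (\<integral>\<omega>. complex_of_real (g (X j \<omega>)) * (?Y j \<omega> - ?Y 0 \<omega>) \<partial>P) \<le> B * (2 * real j * ?D n)" for j
      proof -
        have iY: "integrable P (\<lambda>\<omega>. cmod (?Y j \<omega> - ?Y 0 \<omega>))"
          by (rule integrable_const_bound[where B = 2])
            (auto intro!: AE_I2 order_trans[OF norm_triangle_ineq4])
        have "norm (\<integral>\<omega>. complex_of_real (g (X j \<omega>)) * (?Y j \<omega> - ?Y 0 \<omega>) \<partial>P)
            \<le> (\<integral>\<omega>. norm (complex_of_real (g (X j \<omega>)) * (?Y j \<omega> - ?Y 0 \<omega>)) \<partial>P)"
          by (rule integral_norm_bound)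
        also have "\<dots> \<le> (\<integral>\<omega>. B * cmod (?Y j \<omega> - ?Y 0 \<omega>) \<partial>P)"
        proof (rule integral_mono)
          show "integrable P (\<lambda>\<omega>. norm (complex_of_real (g (X j \<omega>)) * (?Y j \<omega> - ?Y 0 \<omega>)))"
            using i1[of j j] i1[of j 0] by (simp only: right_diff_distrib) (intro integrable_norm Bochner_Integration.integrable_diff)
          show "integrable P (\<lambda>\<omega>. B * cmod (?Y j \<omega> - ?Y 0 \<omega>))" using iY by simp
          show "norm (complex_of_real (g (X j \<omega>)) * (?Y j \<omega> - ?Y 0 \<omega>)) \<le> B * cmod (?Y j \<omega> - ?Y 0 \<omega>)"
            if "\<omega> \<in> space P" for \<omega>
            unfolding norm_mult norm_of_real
            by (intro mult_right_mono bounded_onD(2)[OF g] X_space[OF that]) simp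
        qed
        also have "\<dots> = B * (\<integral>\<omega>. cmod (?Y j \<omega> - ?Y 0 \<omega>) \<partial>P)" by simp
        also have "\<dots> \<le> B * (2 * real j * ?D n)"
          using phase_shift[OF f, of ?s n j] B by (intro mult_left_mono) simp_all
        finally show ?thesis .
      qed
      have "real ?M * norm ?I = norm (of_nat ?M * ?I)" by (simp only: norm_mult norm_of_nat)
      also have "\<dots> \<le> real ?M * a ?M + (\<Sum>j<?M. B * (2 * real j * ?D n))"
        unfolding eq by (intro order_trans[OF norm_triangle_ineq] add_mono n1 order_trans[OF norm_sum] sum_mono n2)
      finally have "norm ?I \<le> (real ?M * a ?M + (\<Sum>j<?M. B * (2 * real j * ?D n))) / real ?M"
        by (simp only: pos_le_divide_eq[of "real ?M"] mult.commute[of "real ?M"])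
      then show "norm ?I \<le> a ?M + (\<Sum>j<?M. B * (2 * real j * ?D n)) / real ?M"
        by (simp only: add_divide_distrib) simp
    qed
  qed
qed

end

lemma norm_decomposition_le:
  fixes x :: "'b :: real_normed_vector"
  assumes "x = a + b + c - e" "norm a \<le> \<alpha>" "norm b \<le> \<beta>" "norm e \<le> \<gamma>"
  shows "norm x \<le> \<alpha> + \<beta> + norm c + \<gamma>"
  using assms norm_triangle_ineq4[of "a + b + c" e] norm_triangle_ineq[of "a + b" c] norm_triangle_ineq[of a b]
  by simp

text \<open>For \<open>n = 0\<close> both sides are 0 by the convention for division, so the
  identity needs no side condition.\<close>

lemma normalized_mean_eq:
  "normalized_mean Y \<mu> n \<omega> = (\<Sum>i<n. Y i \<omega> - \<mu>) / sqrt (real n)"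
proof (cases "n = 0")
  case False
  then have "sqrt (real n) * sqrt (real n) = real n" "sqrt (real n) \<noteq> 0" by auto
  then show ?thesis
    by (simp add: normalized_mean_def sum_subtractf field_simps)
qed (simp add: normalized_mean_def)

context harris_chain begin

text \<open>Eagleson's principle: a limit law under the stationary chain is also the limit law under every
  start that is absolutely continuous with respect to the stationary law.\<close>

lemma phase_mixing:
  assumes f[measurable]: "f \<in> borel_measurable S" and g[measurable]: "g \<in> borel_measurable S"
    and int: "integrable p g" and nn: "\<And>x. 0 \<le> g x"
  shows "(\<lambda>n. (\<integral>\<omega>. complex_of_real (g (X 0 \<omega>)) * phase f (t / sqrt (real n)) (n - k) (\<lambda>i. X i \<omega>) \<partial>P)
    - complex_of_real (\<integral>x. g x \<partial>p) * (\<integral>\<omega>. phase f (t / sqrt (real n)) n (\<lambda>i. X i \<omega>) \<partial>P)) \<longlonglongrightarrow> 0"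
proof -
  let ?D = "\<lambda>n. phase_defect f (t / sqrt (real n))"
  let ?Y = "\<lambda>n \<omega>. phase f (t / sqrt (real n)) n (\<lambda>i. X i \<omega>)"
  \<comment> \<open>\<open>?Z\<close> has only \<open>n - k\<close> summands, at the frequency
    belonging to \<open>n\<close>: this is what a chain with another start offers once its first
    \<open>k\<close> steps are dropped.\<close>
  let ?Z = "\<lambda>n \<omega>. phase f (t / sqrt (real n)) (n - k) (\<lambda>i. X i \<omega>)"
  have D: "?D \<longlonglongrightarrow> 0"
    unfolding phase_defect_def by (rule p.truncated_scaling_tendsto_0) simp
  \<comment> \<open>Truncation at \<open>m\<close> reduces an integrable density to the bounded
    case; the part cut off is controlled by the gap of the integrals, uniformly in
    \<open>n\<close>.\<close>
  define G where "G m x = min (g x) (real m)" for m x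
  define c where "c m = (\<integral>x. G m x \<partial>p)" for m
  have Gb: "bounded_on S (real m) (G m)" for m
    using nn unfolding bounded_on_def G_def by auto
  note [measurable] = bounded_onD(1)[OF Gb]
  have intG: "integrable p (G m)" for m by (rule p.integrable_bounded_on[OF Gb]) simp
  have c: "c \<longlonglongrightarrow> (\<integral>x. g x \<partial>p)"
    unfolding c_def
  proof (rule integral_dominated_convergence[where w = g])
    show "AE x in p. (\<lambda>m. G m x) \<longlonglongrightarrow> g x"
    proof (rule AE_I2)
      fix x
      obtain m where m: "g x \<le> real m" using real_arch_simple by blast
      have "eventually (\<lambda>j. G j x = g x) sequentially"
        using eventually_ge_at_top[of m]
        by eventually_elim (use m in \<open>auto simp: G_def min_def\<close>)
      then show "(\<lambda>m. G m x) \<longlonglongrightarrow> g x" by (rule tendsto_eventually)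
    qed
    show "AE x in p. norm (G m x) \<le> g x" for m using nn by (auto simp: G_def)
  qed (use int in auto)
  define w where "w m n = cmod (\<integral>\<omega>. complex_of_real (G m (X 0 \<omega>) - c m) * ?Y n \<omega> \<partial>P) + real m * (real k * ?D n)" for m n
  show ?thesis
  proof (rule two_scale_tendsto_0)
    \<comment> \<open>The part cut off enters twice: paired with the phase (\<open>n1\<close>) and
      in the product of expectations (\<open>n3\<close>).\<close>
    show "(\<lambda>m. 2 * ((\<integral>x. g x \<partial>p) - c m)) \<longlonglongrightarrow> 0"
      using tendsto_mult_left[OF tendsto_diff[OF tendsto_const[of "\<integral>x. g x \<partial>p"] c], of 2] by simp
    show "w m \<longlonglongrightarrow> 0" for m
    proof -
      have "bounded_on S (real m + \<bar>c m\<bar>) (\<lambda>x. G m x - c m)"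
        by (intro bounded_on_diff Gb bounded_on_const)
      moreover have "measure p (space S) = 1" using p.prob_space by simp
      then have "(\<integral>x. G m x - c m \<partial>p) = 0" using intG by (simp add: c_def)
      ultimately have "(\<lambda>n. \<integral>\<omega>. complex_of_real (G m (X 0 \<omega>) - c m) * ?Y n \<omega> \<partial>P) \<longlonglongrightarrow> 0"
        by (rule phase_mixing_bounded[OF f])
      then have "(\<lambda>n. cmod (\<integral>\<omega>. complex_of_real (G m (X 0 \<omega>) - c m) * ?Y n \<omega> \<partial>P) + real m * (real k * ?D n)) \<longlonglongrightarrow> 0 + real m * (real k * 0)"
        by (intro tendsto_add tendsto_norm_zero tendsto_mult_left D)
      then show ?thesis by (simp add: w_def[abs_def])
    qed
    fix m
    show "eventually (\<lambda>n. norm ((\<integral>\<omega>. complex_of_real (g (X 0 \<omega>)) * ?Z n \<omega> \<partial>P)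
        - complex_of_real (\<integral>x. g x \<partial>p) * (\<integral>\<omega>. ?Y n \<omega> \<partial>P)) \<le> 2 * ((\<integral>x. g x \<partial>p) - c m) + w m n) sequentially"
      using eventually_ge_at_top[of k]
    proof eventually_elim
      case (elim n)
      have gX: "integrable P (\<lambda>\<omega>. g (X 0 \<omega>))" "(\<integral>\<omega>. g (X 0 \<omega>) \<partial>P) = (\<integral>x. g x \<partial>p)"
        using int integrable_distr[of "X 0" P S g] by (simp_all add: law integral_X)
      have GX: "integrable P (\<lambda>\<omega>. G m (X 0 \<omega>))" "(\<integral>\<omega>. G m (X 0 \<omega>) \<partial>P) = c m"
        by (simp_all add: integrable_bounded_on_compose[OF Gb] integral_X c_def)
      have iY: "integrable P (?Y n)" "integrable P (?Z n)"
        by (auto intro!: integrable_const_bound[where B = 1])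
      have i: "integrable P (\<lambda>\<omega>. complex_of_real (g (X 0 \<omega>)) * ?Z n \<omega>)"
        "integrable P (\<lambda>\<omega>. complex_of_real (G m (X 0 \<omega>)) * ?Z n \<omega>)"
        "integrable P (\<lambda>\<omega>. complex_of_real (G m (X 0 \<omega>)) * ?Y n \<omega>)"
        using gX GX by (auto intro!: integrable_weighted_phase[OF f])
      have n1: "cmod (\<integral>\<omega>. complex_of_real (g (X 0 \<omega>) - G m (X 0 \<omega>)) * ?Z n \<omega> \<partial>P) \<le> (\<integral>x. g x \<partial>p) - c m"
      proof -
        have "cmod (\<integral>\<omega>. complex_of_real (g (X 0 \<omega>) - G m (X 0 \<omega>)) * ?Z n \<omega> \<partial>P)
            \<le> (\<integral>\<omega>. cmod (complex_of_real (g (X 0 \<omega>) - G m (X 0 \<omega>)) * ?Z n \<omega>) \<partial>P)"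
          by (rule integral_norm_bound)
        also have "\<dots> = (\<integral>\<omega>. g (X 0 \<omega>) - G m (X 0 \<omega>) \<partial>P)"
          unfolding norm_mult norm_of_real norm_phase
          by (intro Bochner_Integration.integral_cong) (auto simp: G_def)
        also have "\<dots> = (\<integral>x. g x \<partial>p) - c m" using gX GX by simp
        finally show ?thesis .
      qed
      have n2: "cmod (\<integral>\<omega>. complex_of_real (G m (X 0 \<omega>)) * (?Z n \<omega> - ?Y n \<omega>) \<partial>P) \<le> real m * (real k * ?D n)"
      proof -
        have "cmod (\<integral>\<omega>. complex_of_real (G m (X 0 \<omega>)) * (?Z n \<omega> - ?Y n \<omega>) \<partial>P)
            \<le> (\<integral>\<omega>. cmod (complex_of_real (G m (X 0 \<omega>)) * (?Z n \<omega> - ?Y n \<omega>)) \<partial>P)"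
          by (rule integral_norm_bound)
        also have "\<dots> \<le> (\<integral>\<omega>. real m * cmod (?Z n \<omega> - ?Y n \<omega>) \<partial>P)"
        proof (rule integral_mono)
          show "integrable P (\<lambda>\<omega>. cmod (complex_of_real (G m (X 0 \<omega>)) * (?Z n \<omega> - ?Y n \<omega>)))"
            using i(2,3) by (simp only: right_diff_distrib) (intro integrable_norm Bochner_Integration.integrable_diff)
          show "integrable P (\<lambda>\<omega>. real m * cmod (?Z n \<omega> - ?Y n \<omega>))"
            by (intro integrable_mult_right integrable_norm Bochner_Integration.integrable_diff iY)
          show "cmod (complex_of_real (G m (X 0 \<omega>)) * (?Z n \<omega> - ?Y n \<omega>)) \<le> real m * cmod (?Z n \<omega> - ?Y n \<omega>)"
            if "\<omega> \<in> space P" for \<omega>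
            unfolding norm_mult norm_of_real
            by (intro mult_right_mono bounded_onD(2)[OF Gb] X_space[OF that]) simp
        qed
        also have "\<dots> = real m * (\<integral>\<omega>. cmod (?Z n \<omega> - ?Y n \<omega>) \<partial>P)" by simp
        also have "\<dots> \<le> real m * (real k * ?D n)"
          using phase_drop[OF f, of "t / sqrt (real n)" "n - k" k] elim by (intro mult_left_mono) simp_all
        finally show ?thesis .
      qed
      have n3: "cmod (complex_of_real ((\<integral>x. g x \<partial>p) - c m) * (\<integral>\<omega>. ?Y n \<omega> \<partial>P)) \<le> (\<integral>x. g x \<partial>p) - c m"
      proof -
        have "cmod (\<integral>\<omega>. ?Y n \<omega> \<partial>P) \<le> (\<integral>\<omega>. cmod (?Y n \<omega>) \<partial>P)" by (rule integral_norm_bound)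
        then have 1: "cmod (\<integral>\<omega>. ?Y n \<omega> \<partial>P) \<le> 1" by (simp add: prob_space)
        have "c m \<le> (\<integral>x. g x \<partial>p)"
          unfolding c_def using int intG by (intro integral_mono) (auto simp: G_def)
        then show ?thesis
          using mult_left_le[OF 1, of "(\<integral>x. g x \<partial>p) - c m"] by (simp add: norm_mult flip: of_real_diff)
      qed
      have "(\<integral>\<omega>. complex_of_real (g (X 0 \<omega>)) * ?Z n \<omega> \<partial>P) - complex_of_real (\<integral>x. g x \<partial>p) * (\<integral>\<omega>. ?Y n \<omega> \<partial>P)
        = (\<integral>\<omega>. complex_of_real (g (X 0 \<omega>) - G m (X 0 \<omega>)) * ?Z n \<omega> \<partial>P)
        + (\<integral>\<omega>. complex_of_real (G m (X 0 \<omega>)) * (?Z n \<omega> - ?Y n \<omega>) \<partial>P)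
        + (\<integral>\<omega>. complex_of_real (G m (X 0 \<omega>) - c m) * ?Y n \<omega> \<partial>P)
        - complex_of_real ((\<integral>x. g x \<partial>p) - c m) * (\<integral>\<omega>. ?Y n \<omega> \<partial>P)" (is "?L = ?A + ?B + ?C - ?E")
        using i iY by (simp add: left_diff_distrib right_diff_distrib)
      from norm_decomposition_le[OF this n1 n2 n3]
      show ?case unfolding w_def by (simp only: mult_2 add_ac)
    qed
  qed
qed

text \<open>The chain with the new start is split at time \<open>k\<close>. Outside \<open>D\<close>
  its law has a density \<open>g\<close> with respect to \<open>p\<close>, and from then on it
  behaves like the stationary chain reweighted by \<open>g\<close>, to which
  \<open>phase_mixing\<close> applies; on \<open>D\<close> its mass \<open>q k\<close> is small for
  large \<open>k\<close>. For fixed \<open>k\<close> the first \<open>k\<close> summands are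
  negligible.\<close>

lemma phase_transfer:
  fixes P' :: "'v measure" and X' :: "nat \<Rightarrow> 'v \<Rightarrow> 'a"
  assumes f[measurable]: "f \<in> borel_measurable S"
    and P': "prob_space P'" and mc': "markov_chain P' S K X'"
    and lim: "(\<lambda>n. \<integral>\<omega>. phase f (t / sqrt (real n)) n (\<lambda>i. X i \<omega>) \<partial>P) \<longlonglongrightarrow> L"
  shows "(\<lambda>n. \<integral>\<omega>. phase f (t / sqrt (real n)) n (\<lambda>i. X' i \<omega>) \<partial>P') \<longlonglongrightarrow> L"
proof -
  interpret C: prob_chain P' S K X'
    using P' mc' by (intro prob_chain.intro mchain.intro)
  have fin': "finite_measure P'" by unfold_locales
  obtain D where D: "D \<in> null_sets p"
    and ac: "\<And>k. absolutely_continuous p (distr (density P' (\<lambda>\<omega>. indicator (space S - D) (X' k \<omega>))) S (X' k))"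
    and van: "(\<lambda>n. emeasure P' {\<omega> \<in> space P'. X' n \<omega> \<in> D}) \<longlonglongrightarrow> 0"
    by (rule C.singular_part_vanishes[OF fin' sets_p invariant conull_hit]) auto
  have DS[measurable]: "D \<in> sets S" using D by auto
  define q where "q k = measure P' {\<omega> \<in> space P'. X' k \<omega> \<in> D}" for k
  have q: "q \<longlonglongrightarrow> 0"
    using tendsto_enn2real[OF van[folded ennreal_0]] unfolding q_def measure_def by simp
  let ?s = "\<lambda>n. t / sqrt (real n)"
  let ?Y = "\<lambda>n \<omega>. phase f (?s n) n (\<lambda>i. X i \<omega>)"
  let ?Y' = "\<lambda>n \<omega>. phase f (?s n) n (\<lambda>i. X' i \<omega>)"
  let ?Z' = "\<lambda>k n \<omega>. phase f (?s n) (n - k) (\<lambda>i. X' (i + k) \<omega>)"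
  have key: "(\<lambda>n. \<integral>\<omega>. complex_of_real (indicator (space S - D) (X' k \<omega>)) * ?Z' k n \<omega> \<partial>P') \<longlonglongrightarrow> complex_of_real (1 - q k) * L" for k
  proof -
    let ?Q = "density P' (\<lambda>\<omega>. indicator (space S - D) (X' k \<omega>))"
    interpret Q: finite_measure ?Q by (rule C.avoiding_chain(2)[OF fin' DS])
    interpret Qd: finite_measure "distr ?Q S (X' k)" by (rule Q.finite_measure_distr) simp
    \<comment> \<open>A real-valued version of the Radon-Nikodym density is taken, as it will
      multiply complex phases.\<close>
    obtain g where g: "g \<in> borel_measurable p" "AE x in p. RN_deriv p (distr ?Q S (X' k)) x = ennreal (g x)" "\<And>x. 0 \<le> g x"
      using p.real_RN_deriv[OF Qd.finite_measure_axioms ac] by auto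
    have g'[measurable]: "g \<in> borel_measurable S" using g(1) by (simp cong: measurable_cong_sets)
    have dens: "density p (\<lambda>x. ennreal (g x)) = distr ?Q S (X' k)"
    proof -
      have "density p (\<lambda>x. ennreal (g x)) = density p (RN_deriv p (distr ?Q S (X' k)))"
        using g by (intro density_cong) (auto elim: eventually_mono)
      also have "\<dots> = distr ?Q S (X' k)" by (rule p.density_RN_deriv[OF ac]) simp
      finally show ?thesis .
    qed
    have total: "(\<integral>\<^sup>+x. ennreal (g x) \<partial>p) = ennreal (1 - q k)"
    proof -
      have "(\<integral>\<^sup>+x. ennreal (g x) \<partial>p) = emeasure (density p (\<lambda>x. ennreal (g x))) (space S)"
        by (subst emeasure_density) (auto intro!: nn_integral_cong)
      also have "\<dots> = emeasure P' {\<omega> \<in> space P'. X' k \<omega> \<notin> D \<and> X' k \<omega> \<in> space S}"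
        unfolding dens by (rule C.avoiding_chain(3)[OF fin' DS]) simp
      also have "{\<omega> \<in> space P'. X' k \<omega> \<notin> D \<and> X' k \<omega> \<in> space S} = space P' - {\<omega> \<in> space P'. X' k \<omega> \<in> D}"
        by (auto simp: C.X_space)
      also have "emeasure P' \<dots> = ennreal (1 - q k)"
        unfolding q_def by (simp add: C.emeasure_eq_measure C.prob_compl)
      finally show ?thesis .
    qed
    have q1: "q k \<le> 1" unfolding q_def by simp
    have gint: "integrable p g" "(\<integral>x. g x \<partial>p) = 1 - q k"
      using total g q1 by (auto simp: integrable_iff_bounded integral_eq_nn_integral less_top[symmetric])
    \<comment> \<open>The stationary chain started from the density \<open>g\<close>. It shares
      initial law and kernel with the restricted shifted chain, hence all finite-dimensional laws,
      although the two live on different spaces.\<close>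
    let ?R = "density P (\<lambda>\<omega>. ennreal (g (X 0 \<omega>)))"
    have R: "markov_chain ?R S K X" by (rule markov_chain_density) simp
    have "distr ?R S (X 0) = density (distr P S (X 0)) (\<lambda>x. ennreal (g x))"
      by (rule density_distr[symmetric]) simp_all
    then have init: "distr ?Q S (X' (0 + k)) = distr ?R S (X 0)" by (simp add: law dens)
    have same: "(\<integral>\<omega>. complex_of_real (indicator (space S - D) (X' k \<omega>)) * ?Z' k n \<omega> \<partial>P')
        = (\<integral>\<omega>. complex_of_real (g (X 0 \<omega>)) * phase f (?s n) (n - k) (\<lambda>i. X i \<omega>) \<partial>P)" for n
    proof -
      let ?S = "PiM {..n} (\<lambda>_. S)"
      let ?h = "phase f (?s n) (n - k)"
      have h: "?h \<in> borel_measurable ?S" by (rule phase_measurable[OF f]) simp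
      have eq: "distr ?Q ?S (past (\<lambda>n. X' (n + k)) n) = distr ?R ?S (past X n)"
        by (rule markov_chain_law_unique[OF C.avoiding_chain(1)[OF fin' DS] R Q.finite_measure_axioms init])
      have "(\<integral>\<omega>. complex_of_real (indicator (space S - D) (X' k \<omega>)) * ?Z' k n \<omega> \<partial>P')
        = (\<integral>\<omega>. ?Z' k n \<omega> \<partial>density P' (\<lambda>\<omega>. ennreal (indicator (space S - D) (X' k \<omega>))))"
        by (subst integral_density) (auto simp: scaleR_conv_of_real)
      also have "\<dots> = (\<integral>x. ?h x \<partial>distr ?Q ?S (past (\<lambda>n. X' (n + k)) n))"
        by (subst integral_distr) (simp_all add: h phase_past ennreal_indicator)
      also have "\<dots> = (\<integral>\<omega>. ?h (\<lambda>i. X i \<omega>) \<partial>?R)"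
        unfolding eq by (subst integral_distr) (simp_all add: h phase_past)
      also have "\<dots> = (\<integral>\<omega>. complex_of_real (g (X 0 \<omega>)) * phase f (?s n) (n - k) (\<lambda>i. X i \<omega>) \<partial>P)"
        using g(3) by (subst integral_density) (auto simp: scaleR_conv_of_real)
      finally show ?thesis .
    qed
    have "(\<lambda>n. ((\<integral>\<omega>. complex_of_real (g (X 0 \<omega>)) * phase f (?s n) (n - k) (\<lambda>i. X i \<omega>) \<partial>P)
        - complex_of_real (\<integral>x. g x \<partial>p) * (\<integral>\<omega>. ?Y n \<omega> \<partial>P)) + complex_of_real (\<integral>x. g x \<partial>p) * (\<integral>\<omega>. ?Y n \<omega> \<partial>P))
        \<longlonglongrightarrow> 0 + complex_of_real (\<integral>x. g x \<partial>p) * L"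
      by (intro tendsto_add phase_mixing[OF f g' gint(1) g(3)] tendsto_mult_left lim)
    then show ?thesis by (simp add: same gint(2))
  qed
  \<comment> \<open>The bound lets the product of \<open>L\<close> with the missing mass
    \<open>q k\<close> be counted as an error.\<close>
  have L1: "cmod L \<le> 1"
  proof (rule LIMSEQ_le_const2[OF tendsto_norm[OF lim]], intro exI allI impI)
    fix n
    have "cmod (\<integral>\<omega>. ?Y n \<omega> \<partial>P) \<le> (\<integral>\<omega>. cmod (?Y n \<omega>) \<partial>P)" by (rule integral_norm_bound)
    then show "cmod (\<integral>\<omega>. ?Y n \<omega> \<partial>P) \<le> 1" by (simp add: prob_space)
  qed
  define d where "d k n = (\<integral>\<omega>. min 2 \<bar>?s n * (\<Sum>i<k. f (X' i \<omega>))\<bar> \<partial>P')" for k n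
  define w where "w k n = d k n
      + cmod ((\<integral>\<omega>. complex_of_real (indicator (space S - D) (X' k \<omega>)) * ?Z' k n \<omega> \<partial>P') - complex_of_real (1 - q k) * L)" for k n
  have "(\<lambda>n. (\<integral>\<omega>. ?Y' n \<omega> \<partial>P') - L) \<longlonglongrightarrow> 0"
  proof (rule two_scale_tendsto_0)
    \<comment> \<open>One \<open>q k\<close> comes from the event in \<open>D\<close>, the other
      from the mass missing in front of \<open>L\<close>.\<close>
    show "(\<lambda>k. 2 * q k) \<longlonglongrightarrow> 0" using tendsto_mult_left[OF q, of 2] by simp
    show "w k \<longlonglongrightarrow> 0" for k
    proof -
      have "(\<lambda>n. \<integral>\<omega>. min 2 \<bar>?s n * (\<Sum>i<k. f (X' i \<omega>))\<bar> \<partial>P') \<longlonglongrightarrow> 0"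
        by (rule C.truncated_scaling_tendsto_0) measurable
      moreover have "(\<lambda>n. cmod ((\<integral>\<omega>. complex_of_real (indicator (space S - D) (X' k \<omega>)) * ?Z' k n \<omega> \<partial>P') - complex_of_real (1 - q k) * L)) \<longlonglongrightarrow> 0"
        using key[of k] by (intro tendsto_norm_zero) (rule LIM_zero)
      ultimately have "(\<lambda>n. d k n + cmod ((\<integral>\<omega>. complex_of_real (indicator (space S - D) (X' k \<omega>)) * ?Z' k n \<omega> \<partial>P') - complex_of_real (1 - q k) * L)) \<longlonglongrightarrow> 0 + 0"
        unfolding d_def by (rule tendsto_add)
      then show ?thesis unfolding w_def[abs_def] by (simp only: add_0_right)
    qed
    fix k
    show "eventually (\<lambda>n. norm ((\<integral>\<omega>. ?Y' n \<omega> \<partial>P') - L) \<le> 2 * q k + w k n) sequentially"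
      using eventually_ge_at_top[of k]
    proof eventually_elim
      case (elim n)
      let ?i = "\<lambda>A \<omega>. complex_of_real (indicator A (X' k \<omega>))"
      have iY: "integrable P' (?Y' n)" "integrable P' (?Z' k n)"
        by (auto intro!: C.integrable_const_bound[where B = 1])
      have iZ: "integrable P' (\<lambda>\<omega>. ?i A \<omega> * ?Z' k n \<omega>)" if [measurable]: "A \<in> sets S" for A
        by (rule C.integrable_weighted_phase[OF f])
          (auto intro!: C.integrable_const_bound[where B = 1] simp: indicator_def)
      have n1: "cmod (\<integral>\<omega>. ?Y' n \<omega> - ?Z' k n \<omega> \<partial>P') \<le> d k n"
      proof -
        have "cmod (\<integral>\<omega>. ?Y' n \<omega> - ?Z' k n \<omega> \<partial>P') \<le> (\<integral>\<omega>. cmod (?Y' n \<omega> - ?Z' k n \<omega>) \<partial>P')"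
          by (rule integral_norm_bound)
        also have "\<dots> \<le> d k n"
          unfolding d_def
        proof (rule integral_mono)
          show "integrable P' (\<lambda>\<omega>. cmod (?Y' n \<omega> - ?Z' k n \<omega>))" using iY by (intro integrable_norm Bochner_Integration.integrable_diff)
          show "integrable P' (\<lambda>\<omega>. min 2 \<bar>?s n * (\<Sum>i<k. f (X' i \<omega>))\<bar>)"
            by (rule C.integrable_const_bound[where B = 2]) auto
          fix \<omega>
          have "cmod (?Y' n \<omega> - ?Z' k n \<omega>) \<le> min 2 \<bar>?s n * (\<Sum>i<n. f (X' i \<omega>)) - ?s n * (\<Sum>i<n - k. f (X' (i + k) \<omega>))\<bar>"
            unfolding phase_def by (rule norm_iexp_diff_le)
          also have "?s n * (\<Sum>i<n. f (X' i \<omega>)) - ?s n * (\<Sum>i<n - k. f (X' (i + k) \<omega>)) = ?s n * (\<Sum>i<k. f (X' i \<omega>))"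
            using sum_shift_split[of "\<lambda>i. f (X' i \<omega>)" "n - k" k] elim
            by (simp add: distrib_left add_divide_distrib)
          finally show "cmod (?Y' n \<omega> - ?Z' k n \<omega>) \<le> min 2 \<bar>?s n * (\<Sum>i<k. f (X' i \<omega>))\<bar>" .
        qed
        finally show ?thesis .
      qed
      have n2: "cmod (\<integral>\<omega>. ?i D \<omega> * ?Z' k n \<omega> \<partial>P') \<le> q k"
      proof -
        have "cmod (\<integral>\<omega>. ?i D \<omega> * ?Z' k n \<omega> \<partial>P') \<le> (\<integral>\<omega>. cmod (?i D \<omega> * ?Z' k n \<omega>) \<partial>P')"
          by (rule integral_norm_bound)
        also have "\<dots> = (\<integral>\<omega>. indicator {\<omega> \<in> space P'. X' k \<omega> \<in> D} \<omega> \<partial>P')"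
          by (intro Bochner_Integration.integral_cong) (auto simp: norm_mult indicator_def)
        also have "\<dots> = q k" unfolding q_def by (simp add: Int_absorb1)
        finally show ?thesis .
      qed
      have n3: "cmod (complex_of_real (q k) * L) \<le> q k"
        using mult_left_le[OF L1, of "q k"] by (simp add: norm_mult q_def)
      have "(\<integral>\<omega>. ?Z' k n \<omega> \<partial>P') = (\<integral>\<omega>. ?i D \<omega> * ?Z' k n \<omega> + ?i (space S - D) \<omega> * ?Z' k n \<omega> \<partial>P')"
        by (intro Bochner_Integration.integral_cong) (auto simp: indicator_def C.X_space)
      also have "\<dots> = (\<integral>\<omega>. ?i D \<omega> * ?Z' k n \<omega> \<partial>P') + (\<integral>\<omega>. ?i (space S - D) \<omega> * ?Z' k n \<omega> \<partial>P')"
        by (intro Bochner_Integration.integral_add iZ) auto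
      finally have "(\<integral>\<omega>. ?Y' n \<omega> \<partial>P') - L = (\<integral>\<omega>. ?Y' n \<omega> - ?Z' k n \<omega> \<partial>P') + (\<integral>\<omega>. ?i D \<omega> * ?Z' k n \<omega> \<partial>P')
          + ((\<integral>\<omega>. ?i (space S - D) \<omega> * ?Z' k n \<omega> \<partial>P') - complex_of_real (1 - q k) * L) - complex_of_real (q k) * L"
        (is "?L = ?A + ?B + ?C - ?E")
        using iY by (simp add: left_diff_distrib)
      from norm_decomposition_le[OF this n1 n2 n3]
      show ?case unfolding w_def by (simp only: mult_2 add_ac)
    qed
  qed
  then show ?thesis by (simp add: LIM_zero_iff)
qed

text \<open>Levy's continuity theorem, used in both directions, turns \<open>phase_transfer\<close>
  into a statement on weak convergence; the limit law need not be normal.\<close>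

theorem weak_conv_any_start:
  fixes P' :: "'v measure" and X' :: "nat \<Rightarrow> 'v \<Rightarrow> 'a"
  assumes F[measurable]: "F \<in> borel_measurable S"
    and P': "prob_space P'" and mc': "markov_chain P' S K X'" and Q: "real_distribution Q"
    and conv: "weak_conv_m (\<lambda>n. distr P borel (normalized_mean (\<lambda>i \<omega>. F (X i \<omega>)) \<mu> n)) Q"
  shows "weak_conv_m (\<lambda>n. distr P' borel (normalized_mean (\<lambda>i \<omega>. F (X' i \<omega>)) \<mu> n)) Q"
proof -
  interpret C: prob_chain P' S K X'
    using P' mc' by (intro prob_chain.intro mchain.intro)
  let ?f = "\<lambda>x. F x - \<mu>"
  have m[measurable]: "normalized_mean (\<lambda>i \<omega>. F (X i \<omega>)) \<mu> n \<in> borel_measurable P" for n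
    unfolding normalized_mean_def[abs_def] by measurable
  have m'[measurable]: "normalized_mean (\<lambda>i \<omega>. F (X' i \<omega>)) \<mu> n \<in> borel_measurable P'" for n
    unfolding normalized_mean_def[abs_def] by measurable
  have rd: "real_distribution (distr P borel (normalized_mean (\<lambda>i \<omega>. F (X i \<omega>)) \<mu> n))" for n
    by (rule real_distribution_distr) simp
  have rd': "real_distribution (distr P' borel (normalized_mean (\<lambda>i \<omega>. F (X' i \<omega>)) \<mu> n))" for n
    by (rule C.real_distribution_distr) simp
  have ch: "char (distr P borel (normalized_mean (\<lambda>i \<omega>. F (X i \<omega>)) \<mu> n)) t
      = (\<integral>\<omega>. phase ?f (t / sqrt (real n)) n (\<lambda>i. X i \<omega>) \<partial>P)" for n t
    unfolding char_def phase_def by (subst integral_distr) (simp_all add: normalized_mean_eq)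
  have ch': "char (distr P' borel (normalized_mean (\<lambda>i \<omega>. F (X' i \<omega>)) \<mu> n)) t
      = (\<integral>\<omega>. phase ?f (t / sqrt (real n)) n (\<lambda>i. X' i \<omega>) \<partial>P')" for n t
    unfolding char_def phase_def by (subst integral_distr) (simp_all add: normalized_mean_eq)
  show ?thesis
  proof (rule levy_continuity[OF rd' Q])
    fix t
    have "(\<lambda>n. \<integral>\<omega>. phase ?f (t / sqrt (real n)) n (\<lambda>i. X i \<omega>) \<partial>P) \<longlonglongrightarrow> char Q t"
      using levy_continuity1[OF rd Q conv] by (simp only: ch)
    then show "(\<lambda>n. char (distr P' borel (normalized_mean (\<lambda>i \<omega>. F (X' i \<omega>)) \<mu> n)) t) \<longlonglongrightarrow> char Q t"
      unfolding ch' by (intro phase_transfer[OF _ P' mc']) simp_all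
  qed
qed

end

section \<open>The records of a multiple-proposal simulation\<close>

locale finite_chain =
  fixes J :: "nat set" and a :: "nat \<Rightarrow> nat \<Rightarrow> real"
  assumes finite_J: "finite J" and row_sum: "\<And>i. i \<in> J \<Longrightarrow> (\<Sum>j\<in>J. a i j) = 1"
begin

definition apply_matrix :: "(nat \<Rightarrow> real) \<Rightarrow> nat \<Rightarrow> real" where
  "apply_matrix b i = (\<Sum>j\<in>J. a i j * b j)"

text \<open>The starting weights are not normalised, because they will be the unnormalised densities
  \<open>q\<close> at a frozen vector of points.\<close>

abbreviation weight :: "(nat \<Rightarrow> real) \<Rightarrow> nat \<Rightarrow> (nat \<Rightarrow> nat) \<Rightarrow> real" where
  "weight w M \<iota> \<equiv> w (\<iota> 0) * (\<Prod>m=1..M. a (\<iota> (m - 1)) (\<iota> m))"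

lemma sum_paths_0: "(\<Sum>\<iota>\<in>{0::nat} \<rightarrow>\<^sub>E J. G (\<iota> 0)) = (\<Sum>i\<in>J. G i)"
proof -
  have "bij_betw (\<lambda>\<iota>. \<iota> 0) ({0::nat} \<rightarrow>\<^sub>E J) J"
    by (rule bij_betwI[where g = "\<lambda>i. \<lambda>j\<in>{0}. i"])
      (auto simp: PiE_iff extensional_def fun_eq_iff)
  then show ?thesis by (rule sum.reindex_bij_betw[where h = "\<lambda>\<iota>. \<iota> 0" and g = G])
qed

text \<open>A path up to \<open>Suc M\<close> is a path up to \<open>M\<close> with one more value,
  and the last factor of the weight separates.\<close>

lemma sum_paths_Suc:
  "(\<Sum>\<iota>\<in>{0..Suc M} \<rightarrow>\<^sub>E J. weight w (Suc M) \<iota> * G \<iota>)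
     = (\<Sum>\<iota>\<in>{0..M} \<rightarrow>\<^sub>E J. weight w M \<iota> * (\<Sum>j\<in>J. a (\<iota> M) j * G (\<iota>(Suc M := j))))"
proof -
  have ins: "{0..Suc M} = insert (Suc M) {0..M}" by auto
  have inj: "inj_on (\<lambda>(j, \<iota>). \<iota>(Suc M := j)) (J \<times> ({0..M} \<rightarrow>\<^sub>E J))"
    using inj_combinator[of "Suc M" "{0..M}" "\<lambda>_. J"] by simp
  have "(\<Sum>\<iota>\<in>{0..Suc M} \<rightarrow>\<^sub>E J. weight w (Suc M) \<iota> * G \<iota>)
      = (\<Sum>(j, \<iota>)\<in>J \<times> ({0..M} \<rightarrow>\<^sub>E J). weight w (Suc M) (\<iota>(Suc M := j)) * G (\<iota>(Suc M := j)))"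
    unfolding ins PiE_insert_eq by (subst sum.reindex[OF inj]) (simp add: comp_def case_prod_beta)
  also have "\<dots> = (\<Sum>j\<in>J. \<Sum>\<iota>\<in>{0..M} \<rightarrow>\<^sub>E J. weight w (Suc M) (\<iota>(Suc M := j)) * G (\<iota>(Suc M := j)))"
    by (rule sum.cartesian_product[symmetric])
  also have "\<dots> = (\<Sum>\<iota>\<in>{0..M} \<rightarrow>\<^sub>E J. \<Sum>j\<in>J. weight w (Suc M) (\<iota>(Suc M := j)) * G (\<iota>(Suc M := j)))"
    by (rule sum.swap)
  also have "\<dots> = (\<Sum>\<iota>\<in>{0..M} \<rightarrow>\<^sub>E J. weight w M \<iota> * (\<Sum>j\<in>J. a (\<iota> M) j * G (\<iota>(Suc M := j))))"
  proof (intro sum.cong refl)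
    fix \<iota> :: "nat \<Rightarrow> nat"
    have "(\<Prod>m=1..M. a ((\<iota>(Suc M := j)) (m - 1)) ((\<iota>(Suc M := j)) m)) = (\<Prod>m=1..M. a (\<iota> (m - 1)) (\<iota> m))" for j
      by (intro prod.cong) auto
    then have "weight w (Suc M) (\<iota>(Suc M := j)) = weight w M \<iota> * a (\<iota> M) j" for j
      by simp
    then show "(\<Sum>j\<in>J. weight w (Suc M) (\<iota>(Suc M := j)) * G (\<iota>(Suc M := j)))
        = weight w M \<iota> * (\<Sum>j\<in>J. a (\<iota> M) j * G (\<iota>(Suc M := j)))"
      by (simp only: sum_distrib_left mult.assoc)
  qed
  finally show ?thesis .
qed

text \<open>Steps after the last index that \<open>G\<close> looks at are summed out one at a time,
  each giving a row sum 1.\<close>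

lemma sum_paths_drop:
  assumes "m \<le> M" "\<And>\<iota> \<iota>'. (\<And>j. j \<le> m \<Longrightarrow> \<iota> j = \<iota>' j) \<Longrightarrow> G \<iota> = G \<iota>'"
  shows "(\<Sum>\<iota>\<in>{0..M} \<rightarrow>\<^sub>E J. weight w M \<iota> * G \<iota>) = (\<Sum>\<iota>\<in>{0..m} \<rightarrow>\<^sub>E J. weight w m \<iota> * G \<iota>)"
  using assms(1)
proof (induction M rule: dec_induct)
  case (step M)
  have "(\<Sum>j\<in>J. a (\<iota> M) j * G (\<iota>(Suc M := j))) = G \<iota>" if "\<iota> \<in> {0..M} \<rightarrow>\<^sub>E J" for \<iota>
  proof -
    have "G (\<iota>(Suc M := j)) = G \<iota>" for j using step(1) by (intro assms(2)) auto
    moreover have "\<iota> M \<in> J" using that by (auto simp: PiE_iff)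
    ultimately show ?thesis using row_sum[of "\<iota> M"] by (simp add: sum_distrib_right[symmetric])
  qed
  then show ?case
    using step.IH sum_paths_Suc[where w = w and M = M and G = G] by (simp cong: sum.cong)
qed simp

lemma sum_paths_weight: "(\<Sum>\<iota>\<in>{0..M} \<rightarrow>\<^sub>E J. weight w M \<iota>) = (\<Sum>i\<in>J. w i)"
  using sum_paths_drop[of 0 M "\<lambda>_. 1" w] sum_paths_0[of w] by simp

lemma sum_paths_last:
  assumes stat: "\<And>j. j \<in> J \<Longrightarrow> (\<Sum>i\<in>J. w i * a i j) = w j"
  shows "(\<Sum>\<iota>\<in>{0..M} \<rightarrow>\<^sub>E J. weight w M \<iota> * h (\<iota> M)) = (\<Sum>i\<in>J. w i * h i)"
proof (induction M arbitrary: h)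
  case 0 then show ?case using sum_paths_0[of "\<lambda>i. w i * h i"] by simp
next
  case (Suc M)
  have "(\<Sum>\<iota>\<in>{0..Suc M} \<rightarrow>\<^sub>E J. weight w (Suc M) \<iota> * h (\<iota> (Suc M)))
      = (\<Sum>\<iota>\<in>{0..M} \<rightarrow>\<^sub>E J. weight w M \<iota> * apply_matrix h (\<iota> M))"
    using sum_paths_Suc[where w = w and M = M and G = "\<lambda>\<iota>. h (\<iota> (Suc M))"]
    by (simp only: apply_matrix_def fun_upd_same)
  also have "\<dots> = (\<Sum>i\<in>J. w i * apply_matrix h i)" by (rule Suc)
  also have "\<dots> = (\<Sum>j\<in>J. (\<Sum>i\<in>J. w i * a i j) * h j)"
    unfolding apply_matrix_def sum_distrib_left sum_distrib_right by (subst sum.swap) (simp add: mult_ac)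
  also have "\<dots> = (\<Sum>j\<in>J. w j * h j)" by (intro sum.cong) (simp_all add: stat)
  finally show ?case .
qed

text \<open>Steps after \<open>m\<close> drop out, each step from \<open>l\<close> to
  \<open>m\<close> becomes one application of the matrix to \<open>b\<close>, and the steps before
  \<open>l\<close> leave the invariant weights unchanged.\<close>

lemma sum_paths_pair:
  assumes stat: "\<And>j. j \<in> J \<Longrightarrow> (\<Sum>i\<in>J. w i * a i j) = w j" and "l \<le> m" "m \<le> M"
  shows "(\<Sum>\<iota>\<in>{0..M} \<rightarrow>\<^sub>E J. weight w M \<iota> * (c (\<iota> l) * b (\<iota> m)))
       = (\<Sum>i\<in>J. w i * (c i * (apply_matrix ^^ (m - l)) b i))"
proof -
  have "(\<Sum>\<iota>\<in>{0..M} \<rightarrow>\<^sub>E J. weight w M \<iota> * (c (\<iota> l) * b (\<iota> m)))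
      = (\<Sum>\<iota>\<in>{0..m} \<rightarrow>\<^sub>E J. weight w m \<iota> * (c (\<iota> l) * b (\<iota> m)))"
    using assms by (intro sum_paths_drop) auto
  also have "\<dots> = (\<Sum>i\<in>J. w i * (c i * (apply_matrix ^^ (m - l)) b i))"
    using \<open>l \<le> m\<close>
  proof (induction m arbitrary: b rule: dec_induct)
    case base
    then show ?case using sum_paths_last[OF stat, where h = "\<lambda>i. c i * b i" and M = l] by simp
  next
    case (step m)
    have "(\<Sum>\<iota>\<in>{0..Suc m} \<rightarrow>\<^sub>E J. weight w (Suc m) \<iota> * (c (\<iota> l) * b (\<iota> (Suc m))))
        = (\<Sum>\<iota>\<in>{0..m} \<rightarrow>\<^sub>E J. weight w m \<iota> * (c (\<iota> l) * apply_matrix b (\<iota> m)))"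
    proof -
      have "(\<Sum>j\<in>J. a (\<iota> m) j * (c ((\<iota>(Suc m := j)) l) * b ((\<iota>(Suc m := j)) (Suc m)))) = c (\<iota> l) * apply_matrix b (\<iota> m)" for \<iota>
        using step(1) by (simp add: apply_matrix_def sum_distrib_left mult.left_commute)
      then show ?thesis
        using sum_paths_Suc[where w = w and M = m and G = "\<lambda>\<iota>. c (\<iota> l) * b (\<iota> (Suc m))"] by (simp only:)
    qed
    also have "\<dots> = (\<Sum>i\<in>J. w i * (c i * (apply_matrix ^^ (m - l)) (apply_matrix b) i))"
      by (rule step.IH)
    finally show ?case using step(1) by (simp add: Suc_diff_le funpow_Suc_right del: funpow.simps)
  qed
  finally show ?thesis .
qed

end

context mp_mcmc
begin

declare One_nat_def[simp del]

abbreviation Leb :: "(real^'d) measure" where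
  "Leb \<equiv> restrict_space lborel \<Omega>"

abbreviation idx :: "nat set" where
  "idx \<equiv> {1..N+1}"

text \<open>The joint density of the points and the index, up to the factor 1 / (N+1). The balance
  condition says that these weights form a left invariant vector of the matrix
  \<open>A y\<close>.\<close>

definition q :: "nat \<Rightarrow> (nat \<Rightarrow> real^'d) \<Rightarrow> real" where
  "q i y = \<pi> (y i) * \<kappa> (y i) (del_at N i y)"

lemma sets_Leb[measurable_cong, simp]: "sets Leb = sets (Om \<Omega>)"
  by (intro sets_restrict_space_cong) simp

lemma space_Leb[simp]: "space Leb = \<Omega>"
  by (simp add: space_restrict_space)

lemma space_Om[simp]: "space (Om \<Omega>) = \<Omega>"
  by (simp add: space_restrict_space)

lemma sets_leb_pow[measurable_cong, simp]: "sets (leb_pow \<Omega> n) = sets (Om_pow \<Omega> n)"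
  by (rule sets_PiM_cong[OF refl sets_Leb])

lemma space_leb_pow[simp]: "space (leb_pow \<Omega> n) = space (Om_pow \<Omega> n)"
  by (rule sets_eq_imp_space_eq) simp

sublocale Leb: sigma_finite_measure Leb
  using Omega_borel by (intro sigma_finite_measure_restrict_space sigma_finite_lborel) auto

sublocale LebP: product_sigma_finite "\<lambda>_. Leb"
  by standard

lemma sigma_finite_leb_pow: "sigma_finite_measure (leb_pow \<Omega> n)"
  by (rule LebP.sigma_finite) simp

lemma ins_at_measurable:
  assumes "i \<in> idx"
  shows "(\<lambda>(x, u). ins_at N i x u) \<in> Om \<Omega> \<Otimes>\<^sub>M Om_pow \<Omega> N \<rightarrow>\<^sub>M Om_pow \<Omega> (N+1)"
  unfolding ins_at_def case_prod_beta
proof (rule measurable_restrict)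
  fix j assume j: "j \<in> {1..N+1}"
  show "(\<lambda>p. if j < i then snd p j else if j = i then fst p else snd p (j - 1)) \<in> Om \<Omega> \<Otimes>\<^sub>M Om_pow \<Omega> N \<rightarrow>\<^sub>M Om \<Omega>"
  proof (cases "j < i")
    case True
    then have "j \<in> {1..N}" using assms j by auto
    then show ?thesis using True by (auto intro!: measurable_compose[OF measurable_snd measurable_component_singleton])
  next
    case False
    show ?thesis
    proof (cases "j = i")
      case False
      then have "j - 1 \<in> {1..N}" using \<open>\<not> j < i\<close> assms j by auto
      then show ?thesis using False \<open>\<not> j < i\<close>
        by (auto intro!: measurable_compose[OF measurable_snd measurable_component_singleton])
    qed simp
  qed
qed

lemma del_at_measurable[measurable]: "del_at N i \<in> Om_pow \<Omega> (N+1) \<rightarrow>\<^sub>M Om_pow \<Omega> N"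
  unfolding del_at_def
proof (rule measurable_restrict)
  fix j assume "j \<in> {1..N}"
  then show "(\<lambda>y. if j < i then y j else y (Suc j)) \<in> Om_pow \<Omega> (N+1) \<rightarrow>\<^sub>M Om \<Omega>"
    by (cases "j < i") (auto intro!: measurable_component_singleton)
qed

lemma del_ins: "u \<in> space (Om_pow \<Omega> N) \<Longrightarrow> i \<in> idx \<Longrightarrow> del_at N i (ins_at N i x u) = u"
  by (auto simp: del_at_def ins_at_def fun_eq_iff space_PiM PiE_iff extensional_def)

lemma ins_at_nth: "i \<in> idx \<Longrightarrow> ins_at N i x u i = x"
  by (simp add: ins_at_def)

lemma nth_space: "y \<in> space (Om_pow \<Omega> (N+1)) \<Longrightarrow> i \<in> idx \<Longrightarrow> y i \<in> \<Omega>"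
  by (auto simp: space_PiM PiE_iff)

lemma q_ins_at: "u \<in> space (Om_pow \<Omega> N) \<Longrightarrow> i \<in> idx \<Longrightarrow> q i (ins_at N i x u) = \<pi> x * \<kappa> x u"
  by (simp add: q_def del_ins ins_at_nth)

lemma q_nonneg: "y \<in> space (Om_pow \<Omega> (N+1)) \<Longrightarrow> i \<in> idx \<Longrightarrow> 0 \<le> q i y"
  unfolding q_def
  using measurable_space[OF del_at_measurable]
  by (intro mult_nonneg_nonneg target_nonneg kernel_nonneg nth_space) auto

lemma nth_measurable[measurable]: "i \<in> idx \<Longrightarrow> (\<lambda>y. y i) \<in> Om_pow \<Omega> (N+1) \<rightarrow>\<^sub>M Om \<Omega>"
  by (rule measurable_component_singleton)

lemma q_measurable[measurable]:
  assumes [measurable]: "i \<in> idx"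
  shows "q i \<in> borel_measurable (Om_pow \<Omega> (N+1))"
proof -
  note [measurable] = target_measurable
  have "(\<lambda>y. (y i, del_at N i y)) \<in> Om_pow \<Omega> (N+1) \<rightarrow>\<^sub>M Om \<Omega> \<Otimes>\<^sub>M Om_pow \<Omega> N"
    using assms by (intro measurable_Pair nth_measurable del_at_measurable)
  from measurable_compose[OF this kernel_measurable]
  have [measurable]: "(\<lambda>y. \<kappa> (y i) (del_at N i y)) \<in> borel_measurable (Om_pow \<Omega> (N+1))" by simp
  have [measurable]: "(\<lambda>y. \<pi> (y i)) \<in> borel_measurable (Om_pow \<Omega> (N+1))"
    by (rule measurable_compose[OF nth_measurable[OF assms] target_measurable])
  show ?thesis unfolding q_def[abs_def] by measurable
qed

lemma kappa_measurable: "x \<in> \<Omega> \<Longrightarrow> \<kappa> x \<in> borel_measurable (Om_pow \<Omega> N)"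
  using measurable_compose[OF measurable_Pair1' kernel_measurable, of x] by simp

text \<open>Product Lebesgue measure does not depend on the position at which a coordinate is
  inserted. On boxes this is a reordering of the factors by \<open>sk\<close>, the increasing
  enumeration of \<open>idx - {i}\<close>.\<close>

lemma distr_ins_at:
  assumes i: "i \<in> idx"
  shows "distr (Leb \<Otimes>\<^sub>M leb_pow \<Omega> N) (leb_pow \<Omega> (N+1)) (\<lambda>(x, u). ins_at N i x u) = leb_pow \<Omega> (N+1)"
proof (rule LebP.PiM_eqI)
  interpret lp: sigma_finite_measure "leb_pow \<Omega> N" by (rule sigma_finite_leb_pow)
  fix B :: "nat \<Rightarrow> (real^'d) set" assume "\<And>j. j \<in> {1..N+1} \<Longrightarrow> B j \<in> sets Leb"
  then have B: "B j \<in> sets (Om \<Omega>)" if "j \<in> idx" for j using that by simp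
  then have B\<Omega>: "B j \<subseteq> \<Omega>" if "j \<in> idx" for j using that sets.sets_into_space[of "B j" "Om \<Omega>"] by simp
  define sk where "sk j = (if j < i then j else Suc j)" for j :: nat
  have sk: "bij_betw sk {1..N} (idx - {i})"
    using i by (intro bij_betwI[where g = "\<lambda>j. if j < i then j else j - 1"]) (auto simp: sk_def split: if_splits)
  have skB: "B (sk j) \<in> sets (Om \<Omega>)" if "j \<in> {1..N}" for j
    using that bij_betwE[OF sk] by (intro B) auto
  have meas: "(\<lambda>(x, u). ins_at N i x u) \<in> Leb \<Otimes>\<^sub>M leb_pow \<Omega> N \<rightarrow>\<^sub>M leb_pow \<Omega> (N+1)"
    using ins_at_measurable[OF i] by (simp cong: measurable_cong_sets)
  have iff: "ins_at N i x u \<in> Pi\<^sub>E idx B \<longleftrightarrow> x \<in> B i \<and> (\<forall>j\<in>{1..N}. u j \<in> B (sk j))" for x u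
  proof -
    have "ins_at N i x u \<in> Pi\<^sub>E idx B \<longleftrightarrow> (\<forall>j\<in>idx. ins_at N i x u j \<in> B j)"
      by (auto simp: PiE_iff ins_at_def)
    also have "\<dots> \<longleftrightarrow> x \<in> B i \<and> (\<forall>j\<in>idx - {i}. ins_at N i x u j \<in> B j)"
    proof -
      have "(\<forall>j\<in>insert i (idx - {i}). Q j) \<longleftrightarrow> Q i \<and> (\<forall>j\<in>idx - {i}. Q j)" for Q by blast
      from this[of "\<lambda>j. ins_at N i x u j \<in> B j"] show ?thesis
        unfolding insert_Diff[OF i] ins_at_nth[OF i] .
    qed
    also have "(\<forall>j\<in>idx - {i}. ins_at N i x u j \<in> B j) \<longleftrightarrow> (\<forall>j\<in>{1..N}. ins_at N i x u (sk j) \<in> B (sk j))"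
      unfolding bij_betw_imp_surj_on[OF sk, symmetric] by blast
    also have "\<dots> \<longleftrightarrow> (\<forall>j\<in>{1..N}. u j \<in> B (sk j))"
      using i by (intro ball_cong refl) (auto simp: ins_at_def sk_def)
    finally show ?thesis by simp
  qed
  have "emeasure (distr (Leb \<Otimes>\<^sub>M leb_pow \<Omega> N) (leb_pow \<Omega> (N+1)) (\<lambda>(x, u). ins_at N i x u)) (Pi\<^sub>E idx B)
      = emeasure (Leb \<Otimes>\<^sub>M leb_pow \<Omega> N) ((\<lambda>(x, u). ins_at N i x u) -` Pi\<^sub>E idx B \<inter> space (Leb \<Otimes>\<^sub>M leb_pow \<Omega> N))"
    using B by (intro emeasure_distr meas) (auto intro!: sets_PiM_I_finite)
  also have "(\<lambda>(x, u). ins_at N i x u) -` Pi\<^sub>E idx B \<inter> space (Leb \<Otimes>\<^sub>M leb_pow \<Omega> N) = B i \<times> Pi\<^sub>E {1..N} (\<lambda>j. B (sk j))"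
  proof (intro set_eqI, clarify)
    fix x u
    have "(x, u) \<in> (\<lambda>(x, u). ins_at N i x u) -` Pi\<^sub>E idx B \<inter> space (Leb \<Otimes>\<^sub>M leb_pow \<Omega> N)
        \<longleftrightarrow> (x \<in> B i \<and> (\<forall>j\<in>{1..N}. u j \<in> B (sk j))) \<and> x \<in> \<Omega> \<and> (\<forall>j\<in>{1..N}. u j \<in> \<Omega>) \<and> u \<in> extensional {1..N}"
      by (simp only: iff[symmetric]) (simp add: space_pair_measure space_PiM PiE_iff[of u])
    also have "\<dots> \<longleftrightarrow> (x, u) \<in> B i \<times> Pi\<^sub>E {1..N} (\<lambda>j. B (sk j))"
      using B\<Omega>[OF i] skB[THEN sets.sets_into_space] unfolding mem_Times_iff fst_conv snd_conv PiE_iff space_Om by blast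
    finally show "(x, u) \<in> (\<lambda>(x, u). ins_at N i x u) -` Pi\<^sub>E idx B \<inter> space (Leb \<Otimes>\<^sub>M leb_pow \<Omega> N)
        \<longleftrightarrow> (x, u) \<in> B i \<times> Pi\<^sub>E {1..N} (\<lambda>j. B (sk j))" .
  qed
  also have "emeasure (Leb \<Otimes>\<^sub>M leb_pow \<Omega> N) \<dots> = emeasure Leb (B i) * emeasure (leb_pow \<Omega> N) (Pi\<^sub>E {1..N} (\<lambda>j. B (sk j)))"
    using B[OF i] skB by (intro lp.emeasure_pair_measure_Times) (auto intro!: sets_PiM_I_finite)
  also have "emeasure (leb_pow \<Omega> N) (Pi\<^sub>E {1..N} (\<lambda>j. B (sk j))) = (\<Prod>j\<in>{1..N}. emeasure Leb (B (sk j)))"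
    using skB by (intro LebP.emeasure_PiM) auto
  also have "\<dots> = (\<Prod>j\<in>idx - {i}. emeasure Leb (B j))"
    by (rule prod.reindex_bij_betw[OF sk])
  also have "emeasure Leb (B i) * \<dots> = (\<Prod>j\<in>idx. emeasure Leb (B j))"
    using i by (intro prod.remove[symmetric]) auto
  finally show "emeasure (distr (Leb \<Otimes>\<^sub>M leb_pow \<Omega> N) (leb_pow \<Omega> (N+1)) (\<lambda>(x, u). ins_at N i x u)) (Pi\<^sub>E idx B)
      = (\<Prod>j\<in>idx. emeasure Leb (B j))" .
qed simp_all

lemma nn_integral_ins_at:
  assumes i: "i \<in> idx" and G: "G \<in> borel_measurable (Om_pow \<Omega> (N+1))"
  shows "(\<integral>\<^sup>+x. (\<integral>\<^sup>+u. G (ins_at N i x u) \<partial>leb_pow \<Omega> N) \<partial>Leb) = (\<integral>\<^sup>+y. G y \<partial>leb_pow \<Omega> (N+1))"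
proof -
  interpret lp: sigma_finite_measure "leb_pow \<Omega> N" by (rule sigma_finite_leb_pow)
  have meas: "(\<lambda>(x, u). ins_at N i x u) \<in> Leb \<Otimes>\<^sub>M leb_pow \<Omega> N \<rightarrow>\<^sub>M leb_pow \<Omega> (N+1)"
    using ins_at_measurable[OF i] by (simp cong: measurable_cong_sets)
  have G': "G \<in> borel_measurable (leb_pow \<Omega> (N+1))" using G by (simp cong: measurable_cong_sets)
  have "(\<integral>\<^sup>+y. G y \<partial>leb_pow \<Omega> (N+1)) = (\<integral>\<^sup>+z. G ((\<lambda>(x, u). ins_at N i x u) z) \<partial>(Leb \<Otimes>\<^sub>M leb_pow \<Omega> N))"
    by (subst distr_ins_at[OF i, symmetric], subst nn_integral_distr[OF meas]) (simp_all add: G')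
  also have "\<dots> = (\<integral>\<^sup>+x. (\<integral>\<^sup>+u. G (ins_at N i x u) \<partial>leb_pow \<Omega> N) \<partial>Leb)"
    using measurable_compose[OF meas G'] by (subst lp.nn_integral_fst[symmetric]) simp_all
  finally show ?thesis by simp
qed

section \<open>One iteration as a probability kernel\<close>

abbreviation states :: "((real^'d) \<times> nat) measure" where
  "states \<equiv> state_space \<Omega> N"

abbreviation paths :: "(nat \<Rightarrow> nat) set" where
  "paths \<equiv> index_paths N M"

abbreviation records :: "((nat \<Rightarrow> real^'d) \<times> (nat \<Rightarrow> nat)) measure" where
  "records \<equiv> record_space \<Omega> N M"

abbreviation Y :: "(nat \<Rightarrow> real^'d) measure" where
  "Y \<equiv> Om_pow \<Omega> (N+1)"

definition path_prob :: "(nat \<Rightarrow> real^'d) \<Rightarrow> (nat \<Rightarrow> nat) \<Rightarrow> real" where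
  "path_prob y \<iota> = (\<Prod>m=1..M. A y (\<iota> (m - 1)) (\<iota> m))"

lemma finite_chain_A: "y \<in> space Y \<Longrightarrow> finite_chain idx (A y)"
  by (rule finite_chain.intro[OF _ stoch_sum]) simp_all

lemma finite_paths: "finite paths"
  by (intro finite_PiE) auto

lemma paths_nth: "\<iota> \<in> paths \<Longrightarrow> m \<le> M \<Longrightarrow> \<iota> m \<in> idx"
  by (rule PiE_mem[where S = "{0..M}"]) simp_all

lemma path_prob_nonneg:
  assumes "y \<in> space Y" "\<iota> \<in> paths"
  shows "0 \<le> path_prob y \<iota>"
  unfolding path_prob_def
proof (rule prod_nonneg)
  fix m assume "m \<in> {1..M}"
  then have "m \<le> M" "m - 1 \<le> M" by auto
  then show "0 \<le> A y (\<iota> (m - 1)) (\<iota> m)"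
    by (intro stoch_nonneg[OF assms(1)] paths_nth[OF assms(2)])
qed

lemma path_prob_measurable[measurable]:
  assumes "\<iota> \<in> paths"
  shows "(\<lambda>y. path_prob y \<iota>) \<in> borel_measurable Y"
  unfolding path_prob_def
proof (rule borel_measurable_prod)
  fix m assume "m \<in> {1..M}"
  then have "m \<le> M" "m - 1 \<le> M" by auto
  then show "(\<lambda>y. A y (\<iota> (m - 1)) (\<iota> m)) \<in> borel_measurable Y"
    by (intro stoch_measurable paths_nth[OF assms])
qed

lemma sum_path_prob:
  assumes "y \<in> space Y" "i \<in> idx"
  shows "(\<Sum>\<iota>\<in>paths. of_bool (\<iota> 0 = i) * path_prob y \<iota>) = 1"
proof -
  interpret finite_chain idx "A y" by (rule finite_chain_A) fact
  show ?thesis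
    unfolding path_prob_def using sum_paths_weight[of "\<lambda>j. of_bool (j = i)" M] assms(2)
    by (simp add: of_bool_def)
qed

lemma index_law_eq: "index_law N M (A y) i = density (count_space paths) (\<lambda>\<iota>. ennreal (of_bool (\<iota> 0 = i) * path_prob y \<iota>))"
  unfolding index_law_def path_prob_def by (intro arg_cong[where f = "density _"]) (auto simp: fun_eq_iff)

lemma nn_integral_index_law:
  "(\<integral>\<^sup>+\<iota>. g \<iota> \<partial>index_law N M (A y) i) = (\<Sum>\<iota>\<in>paths. ennreal (of_bool (\<iota> 0 = i) * path_prob y \<iota>) * g \<iota>)"
  unfolding index_law_eq
  by (subst nn_integral_density) (simp_all add: nn_integral_count_space_finite finite_paths)

lemma sets_index_law[simp]: "sets (index_law N M (A y) i) = sets (count_space paths)"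
  unfolding index_law_def by simp

lemma prob_space_index_law:
  assumes "y \<in> space Y" "i \<in> idx"
  shows "prob_space (index_law N M (A y) i)"
proof
  have "emeasure (index_law N M (A y) i) (space (index_law N M (A y) i)) = (\<integral>\<^sup>+\<iota>. 1 \<partial>index_law N M (A y) i)"
    by simp
  also have "\<dots> = (\<Sum>\<iota>\<in>paths. ennreal (of_bool (\<iota> 0 = i) * path_prob y \<iota>))"
    unfolding nn_integral_index_law by simp
  also have "\<dots> = ennreal (\<Sum>\<iota>\<in>paths. of_bool (\<iota> 0 = i) * path_prob y \<iota>)"
  proof (rule sum_ennreal)
    show "0 \<le> of_bool (\<iota> 0 = i) * path_prob y \<iota>" if "\<iota> \<in> paths" for \<iota>
      using path_prob_nonneg[OF assms(1) that] by simp
  qed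
  also have "\<dots> = ennreal 1" by (simp only: sum_path_prob[OF assms])
  finally show "emeasure (index_law N M (A y) i) (space (index_law N M (A y) i)) = 1" by simp
qed

lemma index_law_measurable:
  "(\<lambda>p. index_law N M (A (snd p)) (snd (fst p))) \<in> states \<Otimes>\<^sub>M Y \<rightarrow>\<^sub>M prob_algebra (count_space paths)"
proof (rule measurable_prob_algebraI)
  show ps: "prob_space (index_law N M (A (snd p)) (snd (fst p)))" if "p \<in> space (states \<Otimes>\<^sub>M Y)" for p
    using that by (intro prob_space_index_law) (auto simp: space_pair_measure)
  show "(\<lambda>p. index_law N M (A (snd p)) (snd (fst p))) \<in> states \<Otimes>\<^sub>M Y \<rightarrow>\<^sub>M subprob_algebra (count_space paths)"
  proof (rule measurable_subprob_algebra)
    fix B assume "B \<in> sets (count_space paths)"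
    then have "(\<lambda>p :: ((real^'d) \<times> nat) \<times> (nat \<Rightarrow> real^'d). emeasure (index_law N M (A (snd p)) (snd (fst p))) B)
        = (\<lambda>p. \<Sum>\<iota>\<in>paths. ennreal (of_bool (\<iota> 0 = snd (fst p)) * path_prob (snd p) \<iota>) * indicator B \<iota>)"
      by (subst nn_integral_index_law[symmetric]) simp
    moreover have "(\<lambda>p. \<Sum>\<iota>\<in>paths. ennreal (of_bool (\<iota> 0 = snd (fst p)) * path_prob (snd p) \<iota>) * indicator B \<iota>)
        \<in> borel_measurable (states \<Otimes>\<^sub>M Y)"
    proof (intro borel_measurable_sum borel_measurable_times_ennreal measurable_compose[OF _ measurable_ennreal] borel_measurable_times borel_measurable_const)
      fix \<iota> assume \<iota>: "\<iota> \<in> paths"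
      show "(\<lambda>p. of_bool (\<iota> 0 = snd (fst p)) :: real) \<in> borel_measurable (states \<Otimes>\<^sub>M Y)"
        by (rule measurable_compose[OF measurable_compose[OF measurable_fst measurable_snd], where g = "\<lambda>i. of_bool (\<iota> 0 = i)"]) simp
      show "(\<lambda>p. path_prob (snd p) \<iota>) \<in> borel_measurable (states \<Otimes>\<^sub>M Y)"
        by (rule measurable_compose[OF measurable_snd path_prob_measurable[OF \<iota>]])
    qed
    ultimately show "(\<lambda>p. emeasure (index_law N M (A (snd p)) (snd (fst p))) B) \<in> borel_measurable (states \<Otimes>\<^sub>M Y)"
      by (simp only:)
  qed (rule prob_space_imp_subprob_space[OF ps], assumption, simp)
qed

text \<open>The insertion position is itself part of the state; it takes finitely many values, so
  measurability is checked position by position.\<close>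

lemma ins_at_states_measurable:
  "(\<lambda>(s, u). ins_at N (snd s) (fst s) u) \<in> states \<Otimes>\<^sub>M Om_pow \<Omega> N \<rightarrow>\<^sub>M Y"
  unfolding case_prod_beta
proof (rule measurable_compose_countable'[where I = idx and f = "\<lambda>i p. ins_at N i (fst (fst p)) (snd p)" and g = "\<lambda>p. snd (fst p)"])
  fix i assume i: "i \<in> idx"
  have "(\<lambda>p. (fst (fst p), snd p)) \<in> states \<Otimes>\<^sub>M Om_pow \<Omega> N \<rightarrow>\<^sub>M Om \<Omega> \<Otimes>\<^sub>M Om_pow \<Omega> N" by measurable
  from measurable_compose[OF this ins_at_measurable[OF i]]
  show "(\<lambda>p. ins_at N i (fst (fst p)) (snd p)) \<in> states \<Otimes>\<^sub>M Om_pow \<Omega> N \<rightarrow>\<^sub>M Y" by simp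
next
  show "(\<lambda>p. snd (fst p)) \<in> states \<Otimes>\<^sub>M Om_pow \<Omega> N \<rightarrow>\<^sub>M count_space idx"
    by (rule measurable_compose[OF measurable_fst measurable_snd])
qed simp

lemma kernel_density_measurable:
  "(\<lambda>s. density (leb_pow \<Omega> N) (\<lambda>u. ennreal (\<kappa> (fst s) u))) \<in> states \<rightarrow>\<^sub>M prob_algebra (Om_pow \<Omega> N)"
proof (rule measurable_prob_algebraI)
  interpret lp: sigma_finite_measure "leb_pow \<Omega> N" by (rule sigma_finite_leb_pow)
  have km: "\<kappa> x \<in> borel_measurable (leb_pow \<Omega> N)" if "x \<in> \<Omega>" for x
    using kappa_measurable[OF that] by (simp cong: measurable_cong_sets)
  show ps: "prob_space (density (leb_pow \<Omega> N) (\<lambda>u. ennreal (\<kappa> (fst s) u)))" if "s \<in> space states" for s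
  proof
    have x: "fst s \<in> \<Omega>" using that by (auto simp: space_pair_measure)
    note [measurable] = km[OF x]
    have "emeasure (density (leb_pow \<Omega> N) (\<lambda>u. ennreal (\<kappa> (fst s) u))) (space (leb_pow \<Omega> N)) = (\<integral>\<^sup>+u. ennreal (\<kappa> (fst s) u) \<partial>leb_pow \<Omega> N)"
      by (subst emeasure_density[OF _ sets.top]) (auto intro!: nn_integral_cong simp del: space_leb_pow)
    then show "emeasure (density (leb_pow \<Omega> N) (\<lambda>u. ennreal (\<kappa> (fst s) u))) (space (density (leb_pow \<Omega> N) (\<lambda>u. ennreal (\<kappa> (fst s) u)))) = 1"
      using kernel_density[OF x] by simp
  qed
  show "(\<lambda>s. density (leb_pow \<Omega> N) (\<lambda>u. ennreal (\<kappa> (fst s) u))) \<in> states \<rightarrow>\<^sub>M subprob_algebra (Om_pow \<Omega> N)"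
  proof (rule measurable_subprob_algebra)
    fix B assume B: "B \<in> sets (Om_pow \<Omega> N)"
    then have B'[measurable]: "B \<in> sets (leb_pow \<Omega> N)" by simp
    have eq: "emeasure (density (leb_pow \<Omega> N) (\<lambda>u. ennreal (\<kappa> (fst s) u))) B = (\<integral>\<^sup>+u. ennreal (\<kappa> (fst s) u) * indicator B u \<partial>leb_pow \<Omega> N)"
      if "s \<in> space states" for s
    proof -
      have "fst s \<in> \<Omega>" using that by (auto simp: space_pair_measure)
      note [measurable] = km[OF this]
      show ?thesis by (rule emeasure_density) measurable
    qed
    have "(\<lambda>p. (fst (fst p), snd p)) \<in> states \<Otimes>\<^sub>M leb_pow \<Omega> N \<rightarrow>\<^sub>M Om \<Omega> \<Otimes>\<^sub>M Om_pow \<Omega> N"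
      by (intro measurable_Pair measurable_compose[OF measurable_fst measurable_fst])
        (simp cong: measurable_cong_sets)
    from measurable_compose[OF this kernel_measurable]
    have [measurable]: "(\<lambda>p. \<kappa> (fst (fst p)) (snd p)) \<in> borel_measurable (states \<Otimes>\<^sub>M leb_pow \<Omega> N)" by simp
    have "(\<lambda>s. \<integral>\<^sup>+u. ennreal (\<kappa> (fst s) u) * indicator B u \<partial>leb_pow \<Omega> N) \<in> borel_measurable states"
      by (rule lp.borel_measurable_nn_integral) (simp add: case_prod_beta)
    then show "(\<lambda>s. emeasure (density (leb_pow \<Omega> N) (\<lambda>u. ennreal (\<kappa> (fst s) u))) B) \<in> borel_measurable states"
      by (subst measurable_cong[OF eq]) simp_all
  qed (rule prob_space_imp_subprob_space[OF ps], assumption, simp)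
qed

lemma proposal_measurable: "proposal_law \<Omega> N \<kappa> \<in> states \<rightarrow>\<^sub>M prob_algebra Y"
proof -
  have "(\<lambda>s. distr (density (leb_pow \<Omega> N) (\<lambda>u. ennreal (\<kappa> (fst s) u))) Y (ins_at N (snd s) (fst s))) \<in> states \<rightarrow>\<^sub>M prob_algebra Y"
    by (rule measurable_distr_prob_space2[OF kernel_density_measurable ins_at_states_measurable])
  then show ?thesis unfolding proposal_law_def case_prod_beta .
qed

lemma return_record_measurable:
  "(\<lambda>p. return records (snd (fst p), snd p)) \<in> (states \<Otimes>\<^sub>M Y) \<Otimes>\<^sub>M count_space paths \<rightarrow>\<^sub>M prob_algebra records"
  by (rule measurable_compose[OF _ measurable_return_prob_space]) measurable

lemma inner_measurable:
  "(\<lambda>p. index_law N M (A (snd p)) (snd (fst p)) \<bind> (\<lambda>\<iota>. return records (snd p, \<iota>))) \<in> states \<Otimes>\<^sub>M Y \<rightarrow>\<^sub>M prob_algebra records"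
  using measurable_bind_prob_space2[OF index_law_measurable, of "\<lambda>p \<iota>. return records (snd p, \<iota>)" records]
    return_record_measurable by (simp add: case_prod_beta)

lemma mp_iteration_measurable: "mp_iteration \<Omega> N M \<kappa> A \<in> states \<rightarrow>\<^sub>M prob_algebra records"
  unfolding mp_iteration_def
  using measurable_bind_prob_space2[OF proposal_measurable, of "\<lambda>s y. index_law N M (A y) (snd s) \<bind> (\<lambda>\<iota>. return records (y, \<iota>))" records]
    inner_measurable by (simp add: case_prod_beta)

text \<open>Both stages of the iteration are written out as an integral over the proposals and a
  finite sum over index paths, so that no bind is left in later computations.\<close>

lemma nn_integral_mp_iteration:
  assumes x: "x \<in> \<Omega>" and i: "i \<in> idx" and \<Phi>[measurable]: "\<Phi> \<in> borel_measurable records"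
  shows "(\<integral>\<^sup>+w. \<Phi> w \<partial>mp_iteration \<Omega> N M \<kappa> A (x, i)) = (\<integral>\<^sup>+u. ennreal (\<kappa> x u) *
    (\<Sum>\<iota>\<in>paths. ennreal (of_bool (\<iota> 0 = i) * path_prob (ins_at N i x u) \<iota>) * \<Phi> (ins_at N i x u, \<iota>)) \<partial>leb_pow \<Omega> N)"
proof -
  let ?s = "(x, i)"
  let ?in = "\<lambda>y. index_law N M (A y) i \<bind> (\<lambda>\<iota>. return records (y, \<iota>))"
  let ?h = "\<lambda>y. \<Sum>\<iota>\<in>paths. ennreal (of_bool (\<iota> 0 = i) * path_prob y \<iota>) * \<Phi> (y, \<iota>)"
  have s: "?s \<in> space states" using x i by (simp add: space_pair_measure)
  have ik1: "?in \<in> Y \<rightarrow>\<^sub>M subprob_algebra records"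
    using measurable_prob_algebraD[OF measurable_compose[OF measurable_Pair1'[OF s] inner_measurable]] by simp
  have sets_prop: "sets (proposal_law \<Omega> N \<kappa> ?s) = sets Y" by (simp add: proposal_law_def)
  have ik2: "?in \<in> proposal_law \<Omega> N \<kappa> ?s \<rightarrow>\<^sub>M subprob_algebra records"
    using ik1 by (simp add: measurable_cong_sets[OF sets_prop refl])
  have "(\<integral>\<^sup>+w. \<Phi> w \<partial>mp_iteration \<Omega> N M \<kappa> A ?s) = (\<integral>\<^sup>+y. (\<integral>\<^sup>+w. \<Phi> w \<partial>?in y) \<partial>proposal_law \<Omega> N \<kappa> ?s)"
    unfolding mp_iteration_def snd_conv by (rule nn_integral_bind[OF \<Phi> ik2])
  also have "\<dots> = (\<integral>\<^sup>+y. ?h y \<partial>proposal_law \<Omega> N \<kappa> ?s)"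
  proof (rule nn_integral_cong)
    fix y assume "y \<in> space (proposal_law \<Omega> N \<kappa> ?s)"
    then have y: "y \<in> space Y" using sets_eq_imp_space_eq[OF sets_prop] by simp
    have r: "(\<lambda>\<iota>. return records (y, \<iota>)) \<in> index_law N M (A y) i \<rightarrow>\<^sub>M subprob_algebra records"
      unfolding measurable_cong_sets[OF sets_index_law refl]
    proof (rule measurable_compose[OF _ return_measurable])
      show "Pair y \<in> count_space paths \<rightarrow>\<^sub>M records" using y by (rule measurable_Pair1')
    qed
    have "(\<integral>\<^sup>+w. \<Phi> w \<partial>?in y) = (\<integral>\<^sup>+\<iota>. (\<integral>\<^sup>+w. \<Phi> w \<partial>return records (y, \<iota>)) \<partial>index_law N M (A y) i)"
      by (rule nn_integral_bind[OF \<Phi> r])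
    also have "\<dots> = ?h y"
      unfolding nn_integral_index_law
    proof (intro sum.cong[OF refl] arg_cong2[where f = "(*)", OF refl])
      fix \<iota> assume "\<iota> \<in> paths"
      then show "(\<integral>\<^sup>+w. \<Phi> w \<partial>return records (y, \<iota>)) = \<Phi> (y, \<iota>)"
        using y by (intro nn_integral_return \<Phi>) (simp add: space_pair_measure)
    qed
    finally show "(\<integral>\<^sup>+w. \<Phi> w \<partial>?in y) = ?h y" .
  qed
  also have "\<dots> = (\<integral>\<^sup>+u. ennreal (\<kappa> x u) * ?h (ins_at N i x u) \<partial>leb_pow \<Omega> N)"
  proof -
    have \<Phi>': "(\<lambda>y. \<Phi> (y, \<iota>)) \<in> borel_measurable Y" if "\<iota> \<in> paths" for \<iota>
      using that by (intro measurable_compose[OF _ \<Phi>]) simp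
    have h: "?h \<in> borel_measurable Y"
      by (intro borel_measurable_sum borel_measurable_times_ennreal \<Phi>' measurable_compose[OF _ measurable_ennreal]
          borel_measurable_times borel_measurable_const path_prob_measurable)
    have km: "\<kappa> x \<in> borel_measurable (leb_pow \<Omega> N)"
      using kappa_measurable[OF x] by (simp cong: measurable_cong_sets)
    have ins: "ins_at N i x \<in> leb_pow \<Omega> N \<rightarrow>\<^sub>M Y"
      using measurable_compose[OF measurable_Pair1'[of x "Om \<Omega>"] ins_at_measurable[OF i]] x
      by (simp cong: measurable_cong_sets)
    have "(\<integral>\<^sup>+y. ?h y \<partial>proposal_law \<Omega> N \<kappa> ?s)
        = (\<integral>\<^sup>+u. ?h (ins_at N i x u) \<partial>density (leb_pow \<Omega> N) (\<lambda>u. ennreal (\<kappa> x u)))"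
      unfolding proposal_law_def prod.case
      by (rule nn_integral_distr) (simp_all only: measurable_density_eq1 measurable_distr_eq1 ins h)
    also have "\<dots> = (\<integral>\<^sup>+u. ennreal (\<kappa> x u) * ?h (ins_at N i x u) \<partial>leb_pow \<Omega> N)"
      by (rule nn_integral_density[OF measurable_compose[OF km measurable_ennreal] measurable_compose[OF ins h]])
    finally show ?thesis .
  qed
  finally show ?thesis .
qed

section \<open>The stationary law of one record\<close>

abbreviation start_law :: "((real^'d) \<times> nat) measure" where
  "start_law \<equiv> target \<Omega> \<pi> \<Otimes>\<^sub>M uniform_count_measure idx"

definition record_law :: "((nat \<Rightarrow> real^'d) \<times> (nat \<Rightarrow> nat)) measure" where
  "record_law = start_law \<bind> mp_iteration \<Omega> N M \<kappa> A"

text \<open>Time inside one iteration: 0 gives the incoming state, \<open>M\<close> the state handed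
  on, and 1 to \<open>M\<close> the output samples together with their indices.\<close>

definition st :: "nat \<Rightarrow> (nat \<Rightarrow> real^'d) \<times> (nat \<Rightarrow> nat) \<Rightarrow> (real^'d) \<times> nat" where
  "st m w = (fst w (snd w m), snd w m)"

lemma end_state_eq: "end_state M = st M"
  by (simp add: end_state_def st_def fun_eq_iff case_prod_beta)

lemma batch_nth: "m \<in> {1..M} \<Longrightarrow> batch M w m = fst (st m w)"
  by (simp add: batch_def st_def case_prod_beta)

lemma path_nth_measurable:
  assumes "m \<le> M"
  shows "(\<lambda>w. snd w m) \<in> records \<rightarrow>\<^sub>M count_space idx"
proof (rule measurable_compose[OF measurable_snd])
  show "(\<lambda>\<iota>. \<iota> m) \<in> count_space paths \<rightarrow>\<^sub>M count_space idx"
    unfolding measurable_count_space_eq1 space_count_space using paths_nth[OF _ assms] by (rule Pi_I)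
qed

lemma record_fun_measurable:
  assumes m: "m \<le> M" and b: "\<And>i. i \<in> idx \<Longrightarrow> (\<lambda>y. b y i) \<in> Y \<rightarrow>\<^sub>M L"
  shows "(\<lambda>w. b (fst w) (snd w m)) \<in> records \<rightarrow>\<^sub>M L"
  by (rule measurable_compose_countable'[where f = "\<lambda>i w. b (fst w) i", OF _ path_nth_measurable[OF m]])
    (erule measurable_compose[OF measurable_fst b], simp)

lemma st_measurable[measurable]: "m \<le> M \<Longrightarrow> st m \<in> records \<rightarrow>\<^sub>M states"
  unfolding st_def by (intro measurable_Pair path_nth_measurable record_fun_measurable[where b = "\<lambda>y i. y i"] nth_measurable)

lemma pi_measurable: "(\<lambda>x. ennreal (\<pi> x)) \<in> borel_measurable Leb"
  using target_measurable by (simp cong: measurable_cong_sets)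

lemma sets_target[measurable_cong, simp]: "sets (target \<Omega> \<pi>) = sets (Om \<Omega>)"
  by (simp add: target_def)

lemma prob_space_target: "prob_space (target \<Omega> \<pi>)"
proof
  show "emeasure (target \<Omega> \<pi>) (space (target \<Omega> \<pi>)) = 1"
  proof -
    have "emeasure (target \<Omega> \<pi>) (space Leb) = (\<integral>\<^sup>+x. ennreal (\<pi> x) * indicator (space Leb) x \<partial>Leb)"
      unfolding target_def by (rule emeasure_density[OF pi_measurable sets.top])
    also have "\<dots> = (\<integral>\<^sup>+x. ennreal (\<pi> x) \<partial>Leb)" by (intro nn_integral_cong) simp
    finally show ?thesis using target_density by (simp add: target_def)
  qed
qed

lemma prob_space_idx: "prob_space (uniform_count_measure idx)"
  by (rule prob_space_uniform_count_measure) auto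

lemma start_law_in: "start_law \<in> space (prob_algebra states)"
  by (auto simp: space_prob_algebra intro!: sets_pair_measure_cong prob_space_pair prob_space_target prob_space_idx sets_uniform_count_measure_count_space)

lemma nn_integral_start_law:
  assumes g: "g \<in> borel_measurable states"
  shows "(\<integral>\<^sup>+s. g s \<partial>start_law) = (\<Sum>i\<in>idx. ennreal (1 / real (N+1)) * (\<integral>\<^sup>+x. ennreal (\<pi> x) * g (x, i) \<partial>Leb))"
proof -
  interpret U: prob_space "uniform_count_measure idx" by (rule prob_space_idx)
  have sets: "sets start_law = sets states" using start_law_in by (simp add: space_prob_algebra)
  have g': "g \<in> borel_measurable start_law" using g by (simp cong: measurable_cong_sets add: sets)
  have gi: "(\<lambda>x. g (x, i)) \<in> borel_measurable Leb" if "i \<in> idx" for i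
    using measurable_compose[OF measurable_Pair2'[of i "count_space idx" "Om \<Omega>"] g] that by (simp cong: measurable_cong_sets)
  have "(\<integral>\<^sup>+s. g s \<partial>start_law) = (\<integral>\<^sup>+x. (\<integral>\<^sup>+i. g (x, i) \<partial>uniform_count_measure idx) \<partial>target \<Omega> \<pi>)"
    by (rule U.nn_integral_fst[OF g', symmetric])
  also have "\<dots> = (\<integral>\<^sup>+x. (\<Sum>i\<in>idx. ennreal (1 / real (N+1)) * g (x, i)) \<partial>target \<Omega> \<pi>)"
    unfolding uniform_count_measure_def by (subst nn_integral_point_measure_finite) (simp_all add: mult.commute)
  also have "\<dots> = (\<integral>\<^sup>+x. ennreal (\<pi> x) * (\<Sum>i\<in>idx. ennreal (1 / real (N+1)) * g (x, i)) \<partial>Leb)"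
    unfolding target_def
    by (rule nn_integral_density[OF pi_measurable]) (intro borel_measurable_sum borel_measurable_times_ennreal borel_measurable_const gi)
  also have "\<dots> = (\<integral>\<^sup>+x. (\<Sum>i\<in>idx. ennreal (1 / real (N+1)) * (ennreal (\<pi> x) * g (x, i))) \<partial>Leb)"
    by (simp only: sum_distrib_left mult.left_commute)
  also have "\<dots> = (\<Sum>i\<in>idx. \<integral>\<^sup>+x. ennreal (1 / real (N+1)) * (ennreal (\<pi> x) * g (x, i)) \<partial>Leb)"
    by (rule nn_integral_sum) (intro borel_measurable_times_ennreal borel_measurable_const gi pi_measurable)
  also have "\<dots> = (\<Sum>i\<in>idx. ennreal (1 / real (N+1)) * (\<integral>\<^sup>+x. ennreal (\<pi> x) * g (x, i) \<partial>Leb))"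
    by (intro sum.cong refl nn_integral_cmult borel_measurable_times_ennreal gi pi_measurable)
  finally show ?thesis .
qed

lemma record_law_in: "record_law \<in> space (prob_algebra records)"
  unfolding record_law_def
  using prob_space_bind'[OF start_law_in mp_iteration_measurable] sets_bind'[OF start_law_in mp_iteration_measurable]
  by (simp add: space_prob_algebra)

lemma sets_record_law[measurable_cong, simp]: "sets record_law = sets records"
  using record_law_in by (simp add: space_prob_algebra)

sublocale RL: prob_space record_law
  using record_law_in by (simp add: space_prob_algebra)

lemma mp_iteration_start_measurable: "mp_iteration \<Omega> N M \<kappa> A \<in> start_law \<rightarrow>\<^sub>M subprob_algebra records"
proof -
  have "sets start_law = sets states" using start_law_in by (simp add: space_prob_algebra)
  from measurable_cong_sets[OF this refl] show ?thesis
    using measurable_prob_algebraD[OF mp_iteration_measurable] by simp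
qed

text \<open>The start gives position i the weight \<open>\<pi> x / (N+1)\<close> and the proposal
  contributes \<open>\<kappa> x u\<close>; reassembled by \<open>ins_at\<close>, the product is
  \<open>q i y / (N+1)\<close>. Summation over i removes the constraint on the first index, which
  reappears as the argument of \<open>q\<close>.\<close>

lemma nn_integral_record_law:
  assumes \<Phi>[measurable]: "\<Phi> \<in> borel_measurable records"
  shows "(\<integral>\<^sup>+w. \<Phi> w \<partial>record_law)
    = (\<integral>\<^sup>+y. (\<Sum>\<iota>\<in>paths. ennreal (q (\<iota> 0) y * path_prob y \<iota> / real (N+1)) * \<Phi> (y, \<iota>)) \<partial>leb_pow \<Omega> (N+1))"
proof -
  let ?c = "ennreal (1 / real (N+1))"
  let ?H = "\<lambda>i y. \<Sum>\<iota>\<in>paths. ennreal (of_bool (\<iota> 0 = i) * path_prob y \<iota>) * \<Phi> (y, \<iota>)"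
  let ?G = "\<lambda>i y. ennreal (q i y) * ?H i y"
  have \<Phi>': "(\<lambda>y. \<Phi> (y, \<iota>)) \<in> borel_measurable Y" if "\<iota> \<in> paths" for \<iota>
    using that by (intro measurable_compose[OF _ \<Phi>]) simp
  have H: "?H i \<in> borel_measurable Y" for i
    by (intro borel_measurable_sum borel_measurable_times_ennreal \<Phi>' measurable_compose[OF _ measurable_ennreal]
        borel_measurable_times borel_measurable_const path_prob_measurable)
  have G: "?G i \<in> borel_measurable Y" if "i \<in> idx" for i
    by (intro borel_measurable_times_ennreal H measurable_compose[OF _ measurable_ennreal] q_measurable that)
  have J: "(\<lambda>s. \<integral>\<^sup>+w. \<Phi> w \<partial>mp_iteration \<Omega> N M \<kappa> A s) \<in> borel_measurable states"
    by (rule measurable_compose[OF measurable_prob_algebraD[OF mp_iteration_measurable] nn_integral_measurable_subprob_algebra[OF \<Phi>]])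
  have inner: "(\<integral>\<^sup>+x. ennreal (\<pi> x) * (\<integral>\<^sup>+w. \<Phi> w \<partial>mp_iteration \<Omega> N M \<kappa> A (x, i)) \<partial>Leb) = (\<integral>\<^sup>+y. ?G i y \<partial>leb_pow \<Omega> (N+1))"
    if i: "i \<in> idx" for i
  proof -
    have "(\<integral>\<^sup>+x. ennreal (\<pi> x) * (\<integral>\<^sup>+w. \<Phi> w \<partial>mp_iteration \<Omega> N M \<kappa> A (x, i)) \<partial>Leb)
        = (\<integral>\<^sup>+x. (\<integral>\<^sup>+u. ?G i (ins_at N i x u) \<partial>leb_pow \<Omega> N) \<partial>Leb)"
    proof (rule nn_integral_cong)
      fix x assume "x \<in> space Leb"
      then have x: "x \<in> \<Omega>" by simp
      have km: "\<kappa> x \<in> borel_measurable (leb_pow \<Omega> N)"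
        using kappa_measurable[OF x] by (simp cong: measurable_cong_sets)
      have ins: "ins_at N i x \<in> leb_pow \<Omega> N \<rightarrow>\<^sub>M Y"
        using measurable_compose[OF measurable_Pair1'[of x "Om \<Omega>"] ins_at_measurable[OF i]] x
        by (simp cong: measurable_cong_sets)
      have "ennreal (\<pi> x) * (\<integral>\<^sup>+w. \<Phi> w \<partial>mp_iteration \<Omega> N M \<kappa> A (x, i))
          = (\<integral>\<^sup>+u. ennreal (\<pi> x) * (ennreal (\<kappa> x u) * ?H i (ins_at N i x u)) \<partial>leb_pow \<Omega> N)"
        unfolding nn_integral_mp_iteration[OF x i \<Phi>]
        by (rule nn_integral_cmult[symmetric])
          (intro borel_measurable_times_ennreal measurable_compose[OF km measurable_ennreal] measurable_compose[OF ins H])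
      also have "\<dots> = (\<integral>\<^sup>+u. ?G i (ins_at N i x u) \<partial>leb_pow \<Omega> N)"
      proof (rule nn_integral_cong)
        fix u assume "u \<in> space (leb_pow \<Omega> N)"
        then have u: "u \<in> space (Om_pow \<Omega> N)" by simp
        have "ennreal (\<pi> x) * ennreal (\<kappa> x u) = ennreal (q i (ins_at N i x u))"
          unfolding q_ins_at[OF u i] by (rule ennreal_mult[symmetric, OF target_nonneg[OF x] kernel_nonneg[OF x u]])
        then show "ennreal (\<pi> x) * (ennreal (\<kappa> x u) * ?H i (ins_at N i x u)) = ?G i (ins_at N i x u)"
          by (simp only: mult.assoc[symmetric])
      qed
      finally show "ennreal (\<pi> x) * (\<integral>\<^sup>+w. \<Phi> w \<partial>mp_iteration \<Omega> N M \<kappa> A (x, i))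
          = (\<integral>\<^sup>+u. ?G i (ins_at N i x u) \<partial>leb_pow \<Omega> N)" .
    qed
    also have "\<dots> = (\<integral>\<^sup>+y. ?G i y \<partial>leb_pow \<Omega> (N+1))"
      by (rule nn_integral_ins_at[OF i G[OF i]])
    finally show ?thesis .
  qed
  have G': "?G i \<in> borel_measurable (leb_pow \<Omega> (N+1))" if "i \<in> idx" for i
    unfolding measurable_cong_sets[OF sets_leb_pow refl] by (rule G[OF that])
  have "(\<integral>\<^sup>+w. \<Phi> w \<partial>record_law) = (\<integral>\<^sup>+s. (\<integral>\<^sup>+w. \<Phi> w \<partial>mp_iteration \<Omega> N M \<kappa> A s) \<partial>start_law)"
    unfolding record_law_def by (rule nn_integral_bind[OF \<Phi> mp_iteration_start_measurable])
  also have "\<dots> = (\<Sum>i\<in>idx. ?c * (\<integral>\<^sup>+y. ?G i y \<partial>leb_pow \<Omega> (N+1)))"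
    unfolding nn_integral_start_law[OF J] by (intro sum.cong[OF refl] arg_cong2[where f = "(*)", OF refl] inner)
  also have "\<dots> = (\<Sum>i\<in>idx. \<integral>\<^sup>+y. ?c * ?G i y \<partial>leb_pow \<Omega> (N+1))"
    by (intro sum.cong[OF refl] nn_integral_cmult[symmetric] G')
  also have "\<dots> = (\<integral>\<^sup>+y. (\<Sum>i\<in>idx. ?c * ?G i y) \<partial>leb_pow \<Omega> (N+1))"
    by (intro nn_integral_sum[symmetric] borel_measurable_times_ennreal borel_measurable_const G')
  also have "\<dots> = (\<integral>\<^sup>+y. (\<Sum>\<iota>\<in>paths. ennreal (q (\<iota> 0) y * path_prob y \<iota> / real (N+1)) * \<Phi> (y, \<iota>)) \<partial>leb_pow \<Omega> (N+1))"
  proof (rule nn_integral_cong)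
    fix y assume "y \<in> space (leb_pow \<Omega> (N+1))"
    then have y: "y \<in> space Y" by simp
    have "(\<Sum>i\<in>idx. ?c * ?G i y) = (\<Sum>\<iota>\<in>paths. \<Sum>i\<in>idx. ?c * (ennreal (q i y) * (ennreal (of_bool (\<iota> 0 = i) * path_prob y \<iota>) * \<Phi> (y, \<iota>))))"
      unfolding sum_distrib_left by (rule sum.swap)
    also have "\<dots> = (\<Sum>\<iota>\<in>paths. ennreal (q (\<iota> 0) y * path_prob y \<iota> / real (N+1)) * \<Phi> (y, \<iota>))"
    proof (rule sum.cong[OF refl])
      fix \<iota> assume \<iota>: "\<iota> \<in> paths"
      have \<iota>0: "\<iota> 0 \<in> idx" by (rule paths_nth[OF \<iota>]) simp
      have "(\<Sum>i\<in>idx. ?c * (ennreal (q i y) * (ennreal (of_bool (\<iota> 0 = i) * path_prob y \<iota>) * \<Phi> (y, \<iota>))))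
          = (\<Sum>i\<in>idx. if \<iota> 0 = i then ?c * (ennreal (q (\<iota> 0) y) * (ennreal (path_prob y \<iota>) * \<Phi> (y, \<iota>))) else 0)"
        by (intro sum.cong[OF refl]) (simp only: of_bool_def mult_1 mult_zero_left mult_zero_right ennreal_0 split: if_split, simp)
      also have "\<dots> = ?c * (ennreal (q (\<iota> 0) y) * (ennreal (path_prob y \<iota>) * \<Phi> (y, \<iota>)))"
        using \<iota>0 by (simp only: sum.delta[OF finite_atLeastAtMost] sum.delta'[OF finite_atLeastAtMost] if_True)
      also have "\<dots> = (?c * ennreal (q (\<iota> 0) y) * ennreal (path_prob y \<iota>)) * \<Phi> (y, \<iota>)"
        by (simp only: mult.assoc)
      also have "?c * ennreal (q (\<iota> 0) y) * ennreal (path_prob y \<iota>) = ennreal (1 / real (N+1) * q (\<iota> 0) y * path_prob y \<iota>)"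
      proof -
        have c: "0 \<le> 1 / real (N+1)" by simp
        show ?thesis
          by (simp only: ennreal_mult[OF mult_nonneg_nonneg[OF c q_nonneg[OF y \<iota>0]] path_prob_nonneg[OF y \<iota>]]
              ennreal_mult[OF c q_nonneg[OF y \<iota>0]])
      qed
      finally show "(\<Sum>i\<in>idx. ?c * (ennreal (q i y) * (ennreal (of_bool (\<iota> 0 = i) * path_prob y \<iota>) * \<Phi> (y, \<iota>))))
          = ennreal (q (\<iota> 0) y * path_prob y \<iota> / real (N+1)) * \<Phi> (y, \<iota>)"
        by (simp only: times_divide_eq_left mult_1)
    qed
    finally show "(\<Sum>i\<in>idx. ?c * ?G i y) = (\<Sum>\<iota>\<in>paths. ennreal (q (\<iota> 0) y * path_prob y \<iota> / real (N+1)) * \<Phi> (y, \<iota>))" .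
  qed
  finally show ?thesis .
qed

definition record_weight :: "(nat \<Rightarrow> real^'d) \<times> (nat \<Rightarrow> nat) \<Rightarrow> real" where
  "record_weight w = q (snd w 0) (fst w) * path_prob (fst w) (snd w) / real (N+1)"

lemma record_weight_measurable: "record_weight \<in> borel_measurable records"
  unfolding record_weight_def
proof (rule measurable_compose_countable'[where f = "\<lambda>\<iota> w. q (\<iota> 0) (fst w) * path_prob (fst w) \<iota> / real (N+1)", OF _ measurable_snd])
  fix \<iota> assume \<iota>: "\<iota> \<in> paths"
  have "\<iota> 0 \<in> idx" by (rule paths_nth[OF \<iota>]) simp
  then show "(\<lambda>w. q (\<iota> 0) (fst w) * path_prob (fst w) \<iota> / real (N+1)) \<in> borel_measurable records"
    by (intro borel_measurable_divide borel_measurable_times borel_measurable_const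
        measurable_compose[OF measurable_fst q_measurable] measurable_compose[OF measurable_fst path_prob_measurable[OF \<iota>]])
qed (rule countable_finite[OF finite_paths])

lemma record_weight_nonneg: "w \<in> space records \<Longrightarrow> 0 \<le> record_weight w"
  unfolding record_weight_def
  by (intro divide_nonneg_nonneg mult_nonneg_nonneg q_nonneg path_prob_nonneg paths_nth) (auto simp: space_pair_measure)

abbreviation base :: "((nat \<Rightarrow> real^'d) \<times> (nat \<Rightarrow> nat)) measure" where
  "base \<equiv> leb_pow \<Omega> (N+1) \<Otimes>\<^sub>M count_space paths"

lemma sets_base: "sets base = sets records"
  by (intro sets_pair_measure_cong) simp_all

text \<open>A density with respect to a product measure, so that Bochner integrals of signed
  functions become path sums under an integral over the points.\<close>

lemma record_law_density: "record_law = density base (\<lambda>w. ennreal (record_weight w))"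
proof (rule measure_eqI)
  interpret CS: sigma_finite_measure "count_space paths"
    by (rule sigma_finite_measure_count_space_finite[OF finite_paths])
  show "sets record_law = sets (density base (\<lambda>w. ennreal (record_weight w)))" by (simp add: sets_base)
  fix E assume "E \<in> sets record_law"
  then have E: "E \<in> sets records" by simp
  have i: "(indicator E :: _ \<Rightarrow> ennreal) \<in> borel_measurable records" using E by (rule borel_measurable_indicator)
  have w: "(\<lambda>w. ennreal (record_weight w)) \<in> borel_measurable base"
    unfolding measurable_cong_sets[OF sets_base refl] by (rule measurable_compose[OF record_weight_measurable measurable_ennreal])
  have i': "(indicator E :: _ \<Rightarrow> ennreal) \<in> borel_measurable base"
    unfolding measurable_cong_sets[OF sets_base refl] by (rule i)
  have "emeasure record_law E = (\<integral>\<^sup>+w. indicator E w \<partial>record_law)"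
    using E by (intro nn_integral_indicator[symmetric]) simp
  also have "\<dots> = (\<integral>\<^sup>+y. (\<Sum>\<iota>\<in>paths. ennreal (record_weight (y, \<iota>)) * indicator E (y, \<iota>)) \<partial>leb_pow \<Omega> (N+1))"
    unfolding record_weight_def fst_conv snd_conv by (rule nn_integral_record_law[OF i])
  also have "\<dots> = (\<integral>\<^sup>+y. (\<integral>\<^sup>+\<iota>. ennreal (record_weight (y, \<iota>)) * indicator E (y, \<iota>) \<partial>count_space paths) \<partial>leb_pow \<Omega> (N+1))"
    by (simp only: nn_integral_count_space_finite[OF finite_paths])
  also have "\<dots> = (\<integral>\<^sup>+w. ennreal (record_weight w) * indicator E w \<partial>base)"
    by (rule CS.nn_integral_fst) (intro borel_measurable_times_ennreal w i')
  also have "\<dots> = emeasure (density base (\<lambda>w. ennreal (record_weight w))) E"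
    using E by (intro emeasure_density[OF w, symmetric]) (simp add: sets_base)
  finally show "emeasure record_law E = emeasure (density base (\<lambda>w. ennreal (record_weight w))) E" .
qed

lemma integral_record_law:
  fixes \<Phi> :: "_ \<Rightarrow> real"
  assumes \<Phi>: "\<Phi> \<in> borel_measurable records" and int: "integrable record_law \<Phi>"
  shows "(\<integral>w. \<Phi> w \<partial>record_law) = (\<integral>y. (\<Sum>\<iota>\<in>paths. record_weight (y, \<iota>) * \<Phi> (y, \<iota>)) \<partial>leb_pow \<Omega> (N+1))"
proof -
  interpret lp: sigma_finite_measure "leb_pow \<Omega> (N+1)" by (rule sigma_finite_leb_pow)
  interpret CS: sigma_finite_measure "count_space paths"
    by (rule sigma_finite_measure_count_space_finite[OF finite_paths])
  interpret PS: pair_sigma_finite "leb_pow \<Omega> (N+1)" "count_space paths" by standard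
  have \<Phi>': "\<Phi> \<in> borel_measurable base" "record_weight \<in> borel_measurable base"
    unfolding measurable_cong_sets[OF sets_base refl] by (rule \<Phi>, rule record_weight_measurable)
  have nn: "AE w in base. 0 \<le> record_weight w"
    using sets_eq_imp_space_eq[OF sets_base] by (intro AE_I2 record_weight_nonneg) simp
  have "integrable base (\<lambda>w. record_weight w *\<^sub>R \<Phi> w)"
    using int integrable_density[OF \<Phi>' nn] by (simp only: record_law_density)
  then have i: "integrable base (\<lambda>w. record_weight w * \<Phi> w)" by simp
  have "(\<integral>w. \<Phi> w \<partial>record_law) = (\<integral>w. record_weight w * \<Phi> w \<partial>base)"
    unfolding record_law_density using integral_density[OF \<Phi>' nn] by simp
  also have "\<dots> = (\<integral>y. (\<integral>\<iota>. record_weight (y, \<iota>) * \<Phi> (y, \<iota>) \<partial>count_space paths) \<partial>leb_pow \<Omega> (N+1))"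
    by (rule PS.integral_fst'[OF i, symmetric])
  finally show ?thesis by (simp only: lebesgue_integral_count_space_finite[OF finite_paths])
qed

text \<open>At fixed points the balance condition makes the weights \<open>q\<close> invariant under
  \<open>A y\<close>, so \<open>sum_paths_pair\<close> evaluates the path sum.\<close>

lemma integral_record_law_pair:
  assumes lm: "l \<le> m" "m \<le> M"
    and meas: "(\<lambda>w. a (fst w) (snd w l) * b (fst w) (snd w m) :: real) \<in> borel_measurable records"
    and int: "integrable record_law (\<lambda>w. a (fst w) (snd w l) * b (fst w) (snd w m))"
  shows "(\<integral>w. a (fst w) (snd w l) * b (fst w) (snd w m) \<partial>record_law)
    = (\<integral>y. (\<Sum>i\<in>idx. q i y * (a y i * (finite_chain.apply_matrix idx (A y) ^^ (m - l)) (b y) i)) / real (N+1) \<partial>leb_pow \<Omega> (N+1))"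
  unfolding integral_record_law[OF meas int]
proof (rule Bochner_Integration.integral_cong[OF refl])
  fix y assume "y \<in> space (leb_pow \<Omega> (N+1))"
  then have y: "y \<in> space Y" by simp
  interpret fc: finite_chain idx "A y" by (rule finite_chain_A[OF y])
  have stat: "(\<Sum>i\<in>idx. q i y * A y i j) = q j y" if "j \<in> idx" for j
    using balance[OF y that] by (simp add: q_def)
  have "(\<Sum>\<iota>\<in>paths. record_weight (y, \<iota>) * (a (fst (y, \<iota>)) (snd (y, \<iota>) l) * b (fst (y, \<iota>)) (snd (y, \<iota>) m)))
      = (\<Sum>\<iota>\<in>paths. (q (\<iota> 0) y * path_prob y \<iota>) * (a y (\<iota> l) * b y (\<iota> m))) / real (N+1)"
    unfolding record_weight_def fst_conv snd_conv sum_divide_distrib by (intro sum.cong[OF refl]) simp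
  also have "(\<Sum>\<iota>\<in>paths. (q (\<iota> 0) y * path_prob y \<iota>) * (a y (\<iota> l) * b y (\<iota> m)))
      = (\<Sum>i\<in>idx. q i y * (a y i * (fc.apply_matrix ^^ (m - l)) (b y) i))"
    unfolding path_prob_def by (rule fc.sum_paths_pair[where w = "\<lambda>i. q i y" and c = "a y" and b = "b y", OF stat lm])
  finally show "(\<Sum>\<iota>\<in>paths. record_weight (y, \<iota>) * (a (fst (y, \<iota>)) (snd (y, \<iota>) l) * b (fst (y, \<iota>)) (snd (y, \<iota>) m)))
      = (\<Sum>i\<in>idx. q i y * (a y i * (fc.apply_matrix ^^ (m - l)) (b y) i)) / real (N+1)" .
qed

lemma integral_record_law_states:
  assumes lm: "l \<le> m" "m \<le> M" and a: "bounded_on states C a" and b: "bounded_on states D b"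
  shows "(\<integral>w. a (st l w) * b (st m w) \<partial>record_law)
    = (\<integral>y. (\<Sum>i\<in>idx. q i y * (a (y i, i) * (finite_chain.apply_matrix idx (A y) ^^ (m - l)) (\<lambda>i. b (y i, i)) i)) / real (N+1) \<partial>leb_pow \<Omega> (N+1))"
proof -
  have l: "l \<le> M" using lm by simp
  note [measurable] = bounded_onD(1)[OF a] bounded_onD(1)[OF b] st_measurable[OF l] st_measurable[OF lm(2)]
  have meas: "(\<lambda>w. a (st l w) * b (st m w)) \<in> borel_measurable records" by measurable
  have "bounded_on records (C * D) (\<lambda>w. a (st l w) * b (st m w))"
    unfolding bounded_on_def
  proof (intro conjI ballI meas)
    fix w assume "w \<in> space records"
    then have "st l w \<in> space states" "st m w \<in> space states"
      using measurable_space[OF st_measurable[OF l]] measurable_space[OF st_measurable[OF lm(2)]] by auto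
    then show "\<bar>a (st l w) * b (st m w)\<bar> \<le> C * D"
      by (intro abs_mult_bound bounded_onD(2)[OF a] bounded_onD(2)[OF b])
  qed
  then have int: "integrable record_law (\<lambda>w. a (st l w) * b (st m w))"
    by (rule RL.integrable_bounded_on) simp
  show ?thesis
    using integral_record_law_pair[OF lm, where a = "\<lambda>y i. a (y i, i)" and b = "\<lambda>y i. b (y i, i)"] meas int
    by (simp only: st_def)
qed

text \<open>Index paths of positive weight start at i, and the point inserted at position i is x;
  the integrand of the exceptional set vanishes path by path.\<close>

lemma AE_mp_iteration_start:
  assumes x: "x \<in> \<Omega>" and i: "i \<in> idx"
  shows "AE w in mp_iteration \<Omega> N M \<kappa> A (x, i). st 0 w = (x, i)"
proof -
  let ?I = "mp_iteration \<Omega> N M \<kappa> A (x, i)"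
  have s: "(x, i) \<in> space states" using x i by (simp add: space_pair_measure)
  have sets: "sets ?I = sets records"
    using measurable_space[OF mp_iteration_measurable s] by (simp add: space_prob_algebra)
  let ?B = "space records - (st 0 -` ({x} \<times> {i}) \<inter> space records)"
  have "{x} \<in> sets (Om \<Omega>)"
    using x Omega_borel by (subst sets_restrict_space_iff) simp_all
  moreover have "{i} \<in> sets (count_space idx)" using i by simp
  ultimately have "{x} \<times> {i} \<in> sets states" by (rule pair_measureI)
  then have B: "?B \<in> sets records"
    by (intro sets.Diff sets.top measurable_sets[OF st_measurable]) simp
  have "emeasure ?I ?B = (\<integral>\<^sup>+w. indicator ?B w \<partial>?I)"
    by (rule nn_integral_indicator[symmetric]) (simp only: sets B)
  also have "\<dots> = (\<integral>\<^sup>+u. ennreal (\<kappa> x u) * (\<Sum>\<iota>\<in>paths. ennreal (of_bool (\<iota> 0 = i) * path_prob (ins_at N i x u) \<iota>) * indicator ?B (ins_at N i x u, \<iota>)) \<partial>leb_pow \<Omega> N)"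
    by (rule nn_integral_mp_iteration[OF x i borel_measurable_indicator[OF B]])
  also have "\<dots> = (\<integral>\<^sup>+u. 0 \<partial>leb_pow \<Omega> N)"
  proof (rule nn_integral_cong)
    fix u
    have "ennreal (of_bool (\<iota> 0 = i) * path_prob (ins_at N i x u) \<iota>) * indicator ?B (ins_at N i x u, \<iota>) = 0" for \<iota>
    proof (cases "\<iota> 0 = i")
      case True
      then have "st 0 (ins_at N i x u, \<iota>) = (x, i)" by (simp add: st_def ins_at_nth[OF i])
      then have "(ins_at N i x u, \<iota>) \<notin> ?B" by blast
      then have "indicator ?B (ins_at N i x u, \<iota>) = (0 :: ennreal)" by (rule indicator_simps(2))
      then show ?thesis by (simp only: mult_zero_right)
    qed simp
    then show "ennreal (\<kappa> x u) * (\<Sum>\<iota>\<in>paths. ennreal (of_bool (\<iota> 0 = i) * path_prob (ins_at N i x u) \<iota>) * indicator ?B (ins_at N i x u, \<iota>)) = 0"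
      by (simp only: sum.neutral_const mult_zero_right)
  qed
  finally have "emeasure ?I ?B = 0" by (simp only: nn_integral_const mult_zero_left)
  then have "?B \<in> null_sets ?I" by (rule null_setsI) (simp only: sets B)
  then show ?thesis
  proof (rule AE_I')
    show "{w \<in> space ?I. st 0 w \<noteq> (x, i)} \<subseteq> ?B"
      unfolding sets_eq_imp_space_eq[OF sets] by blast
  qed
qed

text \<open>With the first function equal to 1, the pair formula at \<open>l = m\<close> yields a
  value in which \<open>m\<close> no longer occurs, so all times of the iteration share one law; at
  time 0 this is the start law. This is the invariance of the law of the state under the
  updates.\<close>

lemma distr_record_law_st:
  assumes m: "m \<le> M"
  shows "distr record_law states (st m) = start_law"
proof -
  have sets_start: "sets start_law = sets states" using start_law_in by (simp add: space_prob_algebra)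
  have stm: "st m \<in> record_law \<rightarrow>\<^sub>M states" if "m \<le> M" for m
    unfolding measurable_cong_sets[OF sets_record_law refl] by (rule st_measurable[OF that])
  have eq: "emeasure (distr record_law states (st m)) B = ennreal (\<integral>y. (\<Sum>i\<in>idx. q i y * (1 * indicator B (y i, i))) / real (N+1) \<partial>leb_pow \<Omega> (N+1))"
    if m: "m \<le> M" and B: "B \<in> sets states" for m B
  proof -
    have bi: "bounded_on states 1 (indicator B :: _ \<Rightarrow> real)"
      using B by (auto simp: bounded_on_def indicator_def)
    have b1: "bounded_on states \<bar>1\<bar> (\<lambda>_. 1 :: real)" by (rule bounded_on_const)
    have "(\<integral>w. 1 * (indicator B (st m w) :: real) \<partial>record_law) = (\<integral>w. indicator (st m -` B \<inter> space record_law) w \<partial>record_law)"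
      by (intro Bochner_Integration.integral_cong) (auto simp: indicator_def)
    also have "\<dots> = measure record_law (st m -` B \<inter> space record_law)" by simp
    finally have "measure record_law (st m -` B \<inter> space record_law)
       = (\<integral>y. (\<Sum>i\<in>idx. q i y * (1 * (finite_chain.apply_matrix idx (A y) ^^ (m - m)) (\<lambda>i. indicator B (y i, i)) i)) / real (N+1) \<partial>leb_pow \<Omega> (N+1))"
      using integral_record_law_states[OF order_refl m b1 bi] by (simp only:)
    then show ?thesis
      using B by (simp only: emeasure_distr[OF stm[OF m]] RL.emeasure_eq_measure diff_self_eq_0 funpow_0)
  qed
  have "emeasure (distr record_law states (st m)) B = emeasure start_law B" if B: "B \<in> sets states" for B
  proof -
    have "emeasure (distr record_law states (st m)) B = emeasure (distr record_law states (st 0)) B"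
      using eq[OF m B] eq[OF le0 B] by (simp only:)
    also have "\<dots> = (\<integral>\<^sup>+w. indicator B (st 0 w) \<partial>record_law)"
      using B stm[OF le0] by (subst nn_integral_indicator[symmetric], simp, subst nn_integral_distr) simp_all
    also have "\<dots> = (\<integral>\<^sup>+s. (\<integral>\<^sup>+w. indicator B (st 0 w) \<partial>mp_iteration \<Omega> N M \<kappa> A s) \<partial>start_law)"
      unfolding record_law_def
      by (rule nn_integral_bind[OF measurable_compose[OF st_measurable borel_measurable_indicator[OF B]] mp_iteration_start_measurable]) simp
    also have "\<dots> = (\<integral>\<^sup>+s. indicator B s \<partial>start_law)"
    proof (rule nn_integral_cong)
      fix s assume "s \<in> space start_law"
      then have s: "s \<in> space states" using sets_eq_imp_space_eq[OF sets_start] by simp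
      interpret I: prob_space "mp_iteration \<Omega> N M \<kappa> A s"
        using measurable_space[OF mp_iteration_measurable s] by (simp add: space_prob_algebra)
      have "AE w in mp_iteration \<Omega> N M \<kappa> A s. st 0 w = s"
        using AE_mp_iteration_start[of "fst s" "snd s", unfolded prod.collapse] s
        by (simp add: space_pair_measure mem_Times_iff)
      then have "(\<integral>\<^sup>+w. indicator B (st 0 w) \<partial>mp_iteration \<Omega> N M \<kappa> A s) = (\<integral>\<^sup>+w. indicator B s \<partial>mp_iteration \<Omega> N M \<kappa> A s)"
        by (intro nn_integral_cong_AE) (elim eventually_mono, simp)
      then show "(\<integral>\<^sup>+w. indicator B (st 0 w) \<partial>mp_iteration \<Omega> N M \<kappa> A s) = indicator B s"
        by (simp add: I.emeasure_space_1)
    qed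
    also have "\<dots> = emeasure start_law B" using B sets_start by simp
    finally show ?thesis .
  qed
  then show ?thesis
    by (intro measure_eqI) (simp_all only: sets_distr sets_start)
qed

lemma distr_start_law_fst: "distr start_law (Om \<Omega>) fst = target \<Omega> \<pi>"
proof -
  have "distr start_law (Om \<Omega>) fst = distr start_law (target \<Omega> \<pi>) fst"
    by (intro distr_cong) simp_all
  also have "\<dots> = target \<Omega> \<pi>" by (rule prob_space.distr_pair_fst[OF prob_space_idx])
  finally show ?thesis .
qed

lemma distr_record_law_sample:
  assumes m: "m \<le> M"
  shows "distr record_law (Om \<Omega>) (\<lambda>w. fst (st m w)) = target \<Omega> \<pi>"
proof -
  have "distr record_law (Om \<Omega>) (\<lambda>w. fst (st m w)) = distr (distr record_law states (st m)) (Om \<Omega>) fst"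
    using st_measurable[OF m]
    by (subst distr_distr) (simp_all add: comp_def measurable_cong_sets[OF sets_record_law refl])
  then show ?thesis by (simp only: distr_record_law_st[OF m] distr_start_law_fst)
qed

abbreviation record_kernel :: "(nat \<Rightarrow> real^'d) \<times> (nat \<Rightarrow> nat) \<Rightarrow> ((nat \<Rightarrow> real^'d) \<times> (nat \<Rightarrow> nat)) measure" where
  "record_kernel w \<equiv> mp_iteration \<Omega> N M \<kappa> A (st M w)"

lemma record_kernel_measurable: "record_kernel \<in> records \<rightarrow>\<^sub>M prob_algebra records"
  by (rule measurable_compose[OF st_measurable mp_iteration_measurable]) simp

lemma prob_chain_simulation:
  assumes \<nu>: "\<nu> \<in> space (prob_algebra states)"
  shows "prob_chain (mp_simulation \<Omega> N M \<kappa> A \<nu>) records record_kernel (\<lambda>n \<omega>. \<omega> n)"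
    and "distr (mp_simulation \<Omega> N M \<kappa> A \<nu>) records (\<lambda>\<omega>. \<omega> 0) = \<nu> \<bind> mp_iteration \<Omega> N M \<kappa> A"
proof -
  have init: "\<nu> \<bind> mp_iteration \<Omega> N M \<kappa> A \<in> space (prob_algebra records)"
    using prob_space_bind'[OF \<nu> mp_iteration_measurable] sets_bind'[OF \<nu> mp_iteration_measurable]
    by (simp add: space_prob_algebra)
  note L = markov_chain_path_law[OF record_kernel_measurable init]
  show "prob_chain (mp_simulation \<Omega> N M \<kappa> A \<nu>) records record_kernel (\<lambda>n \<omega>. \<omega> n)"
    unfolding mp_simulation_def end_state_eq by (intro prob_chain.intro mchain.intro L)
  show "distr (mp_simulation \<Omega> N M \<kappa> A \<nu>) records (\<lambda>\<omega>. \<omega> 0) = \<nu> \<bind> mp_iteration \<Omega> N M \<kappa> A"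
    unfolding mp_simulation_def end_state_eq by (rule L(3))
qed

abbreviation stat_sim :: "(nat \<Rightarrow> (nat \<Rightarrow> real^'d) \<times> (nat \<Rightarrow> nat)) measure" where
  "stat_sim \<equiv> stationary_simulation \<Omega> \<pi> N M \<kappa> A"

text \<open>The next record depends on the current one through \<open>st M\<close>, whose law is
  again the start law.\<close>

sublocale RC: stationary_chain stat_sim records record_kernel "\<lambda>n \<omega>. \<omega> n" record_law
proof (rule stationary_chain.intro)
  show pc: "prob_chain stat_sim records record_kernel (\<lambda>n \<omega>. \<omega> n)"
    unfolding stationary_simulation_def by (rule prob_chain_simulation[OF start_law_in])
  interpret prob_chain stat_sim records record_kernel "\<lambda>n \<omega>. \<omega> n" by (rule pc)
  have "distr stat_sim records (\<lambda>\<omega>. \<omega> n) = record_law" for n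
  proof (induction n)
    case 0 show ?case
      unfolding stationary_simulation_def record_law_def by (rule prob_chain_simulation(2)[OF start_law_in])
  next
    case (Suc n)
    show ?case
    proof (rule measure_eqI)
      fix B assume "B \<in> sets (distr stat_sim records (\<lambda>\<omega>. \<omega> (Suc n)))"
      then have B: "B \<in> sets records" by simp
      have eB: "(\<lambda>s. emeasure (mp_iteration \<Omega> N M \<kappa> A s) B) \<in> borel_measurable states"
        by (rule measurable_emeasure_kernel[OF measurable_prob_algebraD[OF mp_iteration_measurable] B])
      have stM: "st M \<in> record_law \<rightarrow>\<^sub>M states"
        unfolding measurable_cong_sets[OF sets_record_law refl] by (rule st_measurable) simp
      have "emeasure (distr stat_sim records (\<lambda>\<omega>. \<omega> (Suc n))) B = (\<integral>\<^sup>+w. emeasure (record_kernel w) B \<partial>record_law)"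
        unfolding emeasure_law_Suc[OF B] Suc ..
      also have "\<dots> = (\<integral>\<^sup>+s. emeasure (mp_iteration \<Omega> N M \<kappa> A s) B \<partial>distr record_law states (st M))"
        by (rule nn_integral_distr[OF stM, symmetric]) (simp add: eB)
      also have "\<dots> = (\<integral>\<^sup>+s. emeasure (mp_iteration \<Omega> N M \<kappa> A s) B \<partial>start_law)"
        by (simp only: distr_record_law_st[OF order_refl])
      also have "\<dots> = emeasure record_law B"
        unfolding record_law_def
        by (rule emeasure_bind[OF _ mp_iteration_start_measurable B, symmetric])
          (use start_law_in in \<open>auto simp: space_prob_algebra dest: prob_space.not_empty\<close>)
      finally show "emeasure (distr stat_sim records (\<lambda>\<omega>. \<omega> (Suc n))) B = emeasure record_law B" .
    qed simp
  qed
  then show "stationary_chain_axioms stat_sim records (\<lambda>n \<omega>. \<omega> n) record_law"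
    by (rule stationary_chain_axioms.intro)
qed

section \<open>Nonnegative autocovariances under the standard choice\<close>

text \<open>If E denotes conditional expectation given all points, under the joint law of points and
  index, this is the integral of the product of E a and E b. Where the weights \<open>q\<close> add
  up to 0, the quotient is 0 by convention.\<close>

definition resampling_form :: "((real^'d) \<times> nat \<Rightarrow> real) \<Rightarrow> ((real^'d) \<times> nat \<Rightarrow> real) \<Rightarrow> real" where
  "resampling_form a b = (\<integral>y. (\<Sum>i\<in>idx. q i y * a (y i, i)) * (\<Sum>i\<in>idx. q i y * b (y i, i)) / (\<Sum>i\<in>idx. q i y) / real (N+1) \<partial>leb_pow \<Omega> (N+1))"

lemma resampling_form_commute: "resampling_form a b = resampling_form b a"
  unfolding resampling_form_def by (simp only: mult.commute)

lemma resampling_form_nonneg: "0 \<le> resampling_form a a"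
  unfolding resampling_form_def
proof (rule integral_nonneg_AE, rule AE_I2)
  fix y assume "y \<in> space (leb_pow \<Omega> (N+1))"
  then have y: "y \<in> space Y" by simp
  have "0 \<le> (\<Sum>i\<in>idx. q i y)" by (intro sum_nonneg q_nonneg[OF y])
  then show "0 \<le> (\<Sum>i\<in>idx. q i y * a (y i, i)) * (\<Sum>i\<in>idx. q i y * a (y i, i)) / (\<Sum>i\<in>idx. q i y) / real (N+1)"
    by (intro divide_nonneg_nonneg zero_le_square) simp_all
qed

text \<open>All rows of the matrix coincide, so one application already yields the constant weighted
  mean of \<open>b\<close>, and further ones do not change it.\<close>

lemma standard_choice_power:
  assumes sc: "standard_choice \<Omega> \<pi> N \<kappa> A" and y: "y \<in> space Y" and k: "0 < k"
  shows "(\<Sum>i\<in>idx. q i y * (a i * (finite_chain.apply_matrix idx (A y) ^^ k) b i))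
    = (\<Sum>i\<in>idx. q i y * a i) * (\<Sum>i\<in>idx. q i y * b i) / (\<Sum>i\<in>idx. q i y)"
proof -
  interpret fc: finite_chain idx "A y" by (rule finite_chain_A[OF y])
  let ?t = "\<Sum>i\<in>idx. q i y"
  have nn: "0 \<le> q i y" if "i \<in> idx" for i by (rule q_nonneg[OF y that])
  show ?thesis
  proof (cases "?t > 0")
    case True
    have A: "A y i j = q j y / ?t" if "i \<in> idx" "j \<in> idx" for i j
      using sc y True that unfolding standard_choice_def q_def by blast
    let ?c = "(\<Sum>j\<in>idx. q j y * b j) / ?t"
    have "(fc.apply_matrix ^^ Suc k') b i = ?c" if "i \<in> idx" for k' i
      using that
    proof (induction k' arbitrary: i)
      case 0
      have "fc.apply_matrix b i = (\<Sum>j\<in>idx. q j y * b j / ?t)"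
        unfolding fc.apply_matrix_def by (intro sum.cong[OF refl]) (simp add: A[OF 0])
      then show ?case by (simp add: sum_divide_distrib)
    next
      case (Suc k')
      have "(fc.apply_matrix ^^ Suc (Suc k')) b i = (\<Sum>j\<in>idx. A y i j * (fc.apply_matrix ^^ Suc k') b j)"
        by (simp only: funpow.simps(2)[of "Suc k'"] comp_def fc.apply_matrix_def[of "(fc.apply_matrix ^^ Suc k') b"])
      also have "\<dots> = (\<Sum>j\<in>idx. A y i j * ?c)"
        by (intro sum.cong[OF refl] arg_cong2[where f = "(*)", OF refl] Suc.IH)
      also have "\<dots> = ?c" using fc.row_sum[OF Suc(2)] by (simp only: sum_distrib_right[symmetric] mult_1)
      finally show ?case .
    qed
    then have "(fc.apply_matrix ^^ k) b i = ?c" if "i \<in> idx" for i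
      using that k by (cases k) simp_all
    then have "(\<Sum>i\<in>idx. q i y * (a i * (fc.apply_matrix ^^ k) b i)) = (\<Sum>i\<in>idx. (q i y * a i) * ?c)"
      by (intro sum.cong[OF refl]) simp
    also have "\<dots> = (\<Sum>i\<in>idx. q i y * a i) * ?c" by (rule sum_distrib_right[symmetric])
    finally show ?thesis by simp
  next
    \<comment> \<open>Here the standard choice says nothing about \<open>A\<close>, but nonnegative
      weights with sum 0 all vanish, and so do both sides.\<close>
    case False
    then have "?t = 0" using sum_nonneg[of idx "\<lambda>i. q i y"] nn by force
    then have "q i y = 0" if "i \<in> idx" for i
      using sum_nonneg_eq_0_iff[of idx "\<lambda>i. q i y"] nn that by auto
    then have "(\<Sum>i\<in>idx. q i y * z i) = 0" for z :: "nat \<Rightarrow> real" by (intro sum.neutral) simp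
    then show ?thesis by (simp only: mult_zero_left div_0)
  qed
qed

lemma standard_choice_pair:
  assumes sc: "standard_choice \<Omega> \<pi> N \<kappa> A" and lm: "l < m" "m \<le> M"
    and a: "bounded_on states C a" and b: "bounded_on states D b"
  shows "(\<integral>w. a (st l w) * b (st m w) \<partial>record_law) = resampling_form a b"
  unfolding integral_record_law_states[OF less_imp_le[OF lm(1)] lm(2) a b] resampling_form_def
proof (rule Bochner_Integration.integral_cong[OF refl])
  fix y assume "y \<in> space (leb_pow \<Omega> (N+1))"
  then have y: "y \<in> space Y" by simp
  have "0 < m - l" using lm by simp
  from standard_choice_power[OF sc y this, of "\<lambda>i. a (y i, i)" "\<lambda>i. b (y i, i)"]
  show "(\<Sum>i\<in>idx. q i y * (a (y i, i) * (finite_chain.apply_matrix idx (A y) ^^ (m - l)) (\<lambda>i. b (y i, i)) i)) / real (N+1)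
    = (\<Sum>i\<in>idx. q i y * a (y i, i)) * (\<Sum>i\<in>idx. q i y * b (y i, i)) / (\<Sum>i\<in>idx. q i y) / real (N+1)"
    by (simp only:)
qed

text \<open>The operator of one iteration on functions of the state, read off at time
  \<open>m\<close>; for \<open>m = M\<close> it is the transition operator of the chain of states
  handed on.\<close>

definition resample :: "nat \<Rightarrow> ((real^'d) \<times> nat \<Rightarrow> real) \<Rightarrow> (real^'d) \<times> nat \<Rightarrow> real" where
  "resample m b s = (\<integral>w. b (st m w) \<partial>mp_iteration \<Omega> N M \<kappa> A s)"

lemma bounded_on_st: "m \<le> M \<Longrightarrow> bounded_on states D b \<Longrightarrow> bounded_on records D (\<lambda>w. b (st m w))"
  unfolding bounded_on_def
  using measurable_compose[OF st_measurable] measurable_space[OF st_measurable] by blast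

lemma mp_iteration_prob:
  assumes "s \<in> space states"
  shows "prob_space (mp_iteration \<Omega> N M \<kappa> A s)" "sets (mp_iteration \<Omega> N M \<kappa> A s) = sets records"
  using measurable_space[OF mp_iteration_measurable assms] by (auto simp: space_prob_algebra)

lemma resample_bounded:
  assumes m: "m \<le> M" and b: "bounded_on states D b"
  shows "bounded_on states D (resample m b)"
  unfolding bounded_on_def
proof (intro conjI ballI)
  note h = bounded_on_st[OF m b]
  show "resample m b \<in> borel_measurable states"
    unfolding resample_def
    by (rule measurable_compose[OF measurable_prob_algebraD[OF mp_iteration_measurable]
          integral_measurable_subprob_algebra[OF bounded_onD(1)[OF h]]])
  fix s assume s: "s \<in> space states"
  interpret I: prob_space "mp_iteration \<Omega> N M \<kappa> A s" by (rule mp_iteration_prob[OF s])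
  note sets = mp_iteration_prob(2)[OF s]
  have int: "integrable (mp_iteration \<Omega> N M \<kappa> A s) (\<lambda>w. b (st m w))"
    by (rule I.integrable_bounded_on[OF h sets])
  have "\<bar>resample m b s\<bar> \<le> (\<integral>w. \<bar>b (st m w)\<bar> \<partial>mp_iteration \<Omega> N M \<kappa> A s)"
    unfolding resample_def by (rule integral_abs_bound)
  also have "\<dots> \<le> (\<integral>w. D \<partial>mp_iteration \<Omega> N M \<kappa> A s)"
    using int bounded_onD(2)[OF h] sets_eq_imp_space_eq[OF sets] by (intro integral_mono) auto
  finally show "\<bar>resample m b s\<bar> \<le> D" by (simp add: I.prob_space)
qed

lemma resample_power_bounded: "bounded_on states D b \<Longrightarrow> bounded_on states D ((resample M ^^ k) b)"
  by (induction k) (simp_all add: resample_bounded)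

lemma sets_start_law: "sets start_law = sets states"
  using start_law_in by (simp add: space_prob_algebra)

lemma space_start_law: "space start_law = space states"
  by (rule sets_eq_imp_space_eq[OF sets_start_law])

sublocale SL: prob_space start_law
  using start_law_in by (simp add: space_prob_algebra)

lemma bounded_on_mult: "bounded_on S C a \<Longrightarrow> bounded_on S D b \<Longrightarrow> bounded_on S (C * D) (\<lambda>x. a x * b x)"
  unfolding bounded_on_def by (auto intro: abs_mult_bound simp del: abs_mult)

text \<open>The state at time 0 of an iteration is its start, so a pairing within one record becomes
  a pairing with \<open>resample m b\<close> under the start law.\<close>

lemma integral_resample:
  assumes m: "m \<le> M" and a: "bounded_on states C a" and b: "bounded_on states D b"
  shows "(\<integral>s. a s * resample m b s \<partial>start_law) = (\<integral>w. a (st 0 w) * b (st m w) \<partial>record_law)"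
proof -
  have h: "bounded_on records (C * D) (\<lambda>w. a (st 0 w) * b (st m w))"
    by (intro bounded_on_mult bounded_on_st a b m) simp
  have "(\<integral>w. a (st 0 w) * b (st m w) \<partial>record_law)
      = (\<integral>s. (\<integral>w. a (st 0 w) * b (st m w) \<partial>mp_iteration \<Omega> N M \<kappa> A s) \<partial>start_law)"
    unfolding record_law_def
  proof (rule integral_bind[OF bounded_onD(1)[OF h] bounded_onD(2)[OF h] mp_iteration_start_measurable SL.finite_measure_axioms])
    show "AE s in start_law. emeasure (mp_iteration \<Omega> N M \<kappa> A s) (space (mp_iteration \<Omega> N M \<kappa> A s)) \<le> ennreal 1"
    proof (rule AE_I2)
      fix s assume "s \<in> space start_law"
      then have "s \<in> space states" by (simp only: space_start_law)
      from prob_space.emeasure_space_1[OF mp_iteration_prob(1)[OF this]]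
      show "emeasure (mp_iteration \<Omega> N M \<kappa> A s) (space (mp_iteration \<Omega> N M \<kappa> A s)) \<le> ennreal 1" by simp
    qed
  qed
  also have "\<dots> = (\<integral>s. a s * resample m b s \<partial>start_law)"
  proof (rule Bochner_Integration.integral_cong[OF refl])
    fix s assume "s \<in> space start_law"
    then have s: "s \<in> space states" by (simp only: space_start_law)
    then have si: "fst s \<in> \<Omega>" "snd s \<in> idx" by (simp_all add: space_pair_measure mem_Times_iff)
    note sets = mp_iteration_prob(2)[OF s]
    have st0: "AE w in mp_iteration \<Omega> N M \<kappa> A s. st 0 w = s"
      using AE_mp_iteration_start[OF si, unfolded prod.collapse] .
    have "(\<integral>w. a (st 0 w) * b (st m w) \<partial>mp_iteration \<Omega> N M \<kappa> A s) = (\<integral>w. a s * b (st m w) \<partial>mp_iteration \<Omega> N M \<kappa> A s)"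
    proof (rule integral_cong_AE)
      show "AE w in mp_iteration \<Omega> N M \<kappa> A s. a (st 0 w) * b (st m w) = a s * b (st m w)"
        using st0 by eventually_elim (simp only:)
      show "(\<lambda>w. a (st 0 w) * b (st m w)) \<in> borel_measurable (mp_iteration \<Omega> N M \<kappa> A s)"
        unfolding measurable_cong_sets[OF sets refl] by (rule bounded_onD(1)[OF h])
      show "(\<lambda>w. a s * b (st m w)) \<in> borel_measurable (mp_iteration \<Omega> N M \<kappa> A s)"
        unfolding measurable_cong_sets[OF sets refl]
        by (intro borel_measurable_times borel_measurable_const bounded_onD(1)[OF bounded_on_st[OF m b]])
    qed
    then show "(\<integral>w. a (st 0 w) * b (st m w) \<partial>mp_iteration \<Omega> N M \<kappa> A s) = a s * resample m b s"
      by (simp only: integral_mult_right_zero resample_def)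
  qed
  finally show ?thesis by (rule sym)
qed

text \<open>The form on the right is symmetric, nonnegative on the diagonal and independent of
  \<open>m\<close>; so \<open>resample m\<close> acts on bounded functions as a symmetric positive
  operator for the start law.\<close>

lemma resample_form:
  assumes sc: "standard_choice \<Omega> \<pi> N \<kappa> A" and m: "1 \<le> m" "m \<le> M"
    and a: "bounded_on states C a" and b: "bounded_on states D b"
  shows "(\<integral>s. a s * resample m b s \<partial>start_law) = resampling_form a b"
  unfolding integral_resample[OF m(2) a b] using m(1) by (intro standard_choice_pair[OF sc _ m(2) a b]) simp

text \<open>All samples of a batch are conditionally independent draws from the same law, so it does not
  matter which of them is looked at.\<close>

lemma resample_AE_eq:
  assumes sc: "standard_choice \<Omega> \<pi> N \<kappa> A" and m: "1 \<le> m" "m \<le> M" and b: "bounded_on states D b"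
  shows "AE s in start_law. resample m b s = resample M b s"
proof -
  \<comment> \<open>Testing the difference of the two functions against itself shows that its L2
    norm vanishes.\<close>
  define a where "a s = resample m b s - resample M b s" for s
  have ab: "bounded_on states (D + D) a"
    unfolding a_def by (intro bounded_on_diff resample_bounded b m(2) order_refl)
  note Tb = resample_bounded[OF m(2) b] resample_bounded[OF order_refl b]
  have int: "integrable start_law (\<lambda>s. a s * resample m b s)" "integrable start_law (\<lambda>s. a s * resample M b s)"
    by (rule SL.integrable_bounded_on[OF bounded_on_mult[OF ab Tb(1)] sets_start_law],
        rule SL.integrable_bounded_on[OF bounded_on_mult[OF ab Tb(2)] sets_start_law])
  have "(\<integral>s. a s * a s \<partial>start_law) = (\<integral>s. a s * resample m b s - a s * resample M b s \<partial>start_law)"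
    unfolding a_def by (simp only: right_diff_distrib)
  also have "\<dots> = resampling_form a b - resampling_form a b"
    using int resample_form[OF sc m ab b] resample_form[OF sc M_pos order_refl ab b]
    by (simp only: Bochner_Integration.integral_diff)
  finally have "(\<integral>s. a s * a s \<partial>start_law) = 0" by simp
  moreover have "integrable start_law (\<lambda>s. a s * a s)"
    using bounded_on_mult[OF ab ab] by (rule SL.integrable_bounded_on) (rule sets_start_law)
  ultimately have "AE s in start_law. a s * a s = 0"
    by (subst (asm) integral_nonneg_eq_0_iff_AE) simp_all
  then show ?thesis by eventually_elim (simp add: a_def)
qed

text \<open>Symmetry moves half of the powers to the left factor. An even power leaves a square; an
  odd power leaves one operator in the middle, and its quadratic form is nonnegative by
  \<open>resampling_form_nonneg\<close>.\<close>

lemma inner_resample_power_nonneg: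
  assumes sc: "standard_choice \<Omega> \<pi> N \<kappa> A" and a: "bounded_on states C a"
  shows "0 \<le> (\<integral>s. a s * (resample M ^^ n) a s \<partial>start_law)"
proof -
  have move: "(\<integral>s. u s * resample M v s \<partial>start_law) = (\<integral>s. resample M u s * v s \<partial>start_law)"
    if "bounded_on states C u" "bounded_on states C v" for u v
    using resample_form[OF sc M_pos order_refl that] resample_form[OF sc M_pos order_refl that(2,1)]
    by (simp only: mult.commute resampling_form_commute)
  have shift: "(\<integral>s. u s * (resample M ^^ (j + i)) v s \<partial>start_law) = (\<integral>s. (resample M ^^ j) u s * (resample M ^^ i) v s \<partial>start_law)"
    if u: "bounded_on states C u" and v: "bounded_on states C v" for u v i j
    using u
  proof (induction j arbitrary: u)
    case (Suc j)
    have "(\<integral>s. u s * (resample M ^^ (Suc j + i)) v s \<partial>start_law) = (\<integral>s. u s * resample M ((resample M ^^ (j + i)) v) s \<partial>start_law)" by simp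
    also have "\<dots> = (\<integral>s. resample M u s * (resample M ^^ (j + i)) v s \<partial>start_law)"
      by (rule move[OF Suc(2) resample_power_bounded[OF v]])
    also have "\<dots> = (\<integral>s. (resample M ^^ j) (resample M u) s * (resample M ^^ i) v s \<partial>start_law)"
      by (rule Suc.IH[OF resample_bounded[OF order_refl Suc(2)]])
    finally show ?case by (simp only: funpow_Suc_right comp_def)
  qed simp
  note Tj = resample_power_bounded[OF a]
  show ?thesis
  proof (cases "even n")
    case True
    then obtain j where "n = j + j" by (metis evenE mult_2)
    then show ?thesis by (simp only: shift[OF a a]) (intro integral_nonneg_AE AE_I2 zero_le_square)
  next
    case False
    then obtain j where n: "n = j + (Suc j)" by (metis oddE mult_2 add_Suc_right Suc_eq_plus1)
    have "(\<integral>s. a s * (resample M ^^ n) a s \<partial>start_law) = (\<integral>s. (resample M ^^ j) a s * resample M ((resample M ^^ j) a) s \<partial>start_law)"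
      unfolding n shift[OF a a] by simp
    also have "\<dots> = resampling_form ((resample M ^^ j) a) ((resample M ^^ j) a)"
      by (rule resample_form[OF sc M_pos order_refl Tj Tj])
    finally show ?thesis using resampling_form_nonneg by simp
  qed
qed

text \<open>The kernel of the records sees only the state handed on, so powers of its operator act
  on functions of \<open>st M\<close> as powers of \<open>resample M\<close>.\<close>

lemma kop_st_power:
  assumes b: "bounded_on states D b" and w: "w \<in> space records"
  shows "(RC.kop ^^ k) (\<lambda>w. b (st M w)) w = (resample M ^^ k) b (st M w)"
  using w
proof (induction k arbitrary: w)
  case (Suc k)
  have "(RC.kop ^^ Suc k) (\<lambda>w. b (st M w)) w = RC.kop (\<lambda>w. (resample M ^^ k) b (st M w)) w"
    using Suc by (auto intro: RC.kop_cong)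
  also have "\<dots> = resample M ((resample M ^^ k) b) (st M w)"
    unfolding RC.kop_def[of "\<lambda>w. (resample M ^^ k) b (st M w)"] resample_def[of M "(resample M ^^ k) b"] ..
  finally show ?case by simp
qed simp

text \<open>The later position may be taken to be \<open>M\<close> by \<open>resample_AE_eq\<close>;
  the covariance is then \<open>a\<close> at position \<open>l\<close> paired with a power of
  \<open>resample M\<close> at the end of the same record. For \<open>l = M\<close> the pairing is
  at a single state; for \<open>l < M\<close> the passage from \<open>l\<close> to \<open>M\<close>
  acts as one more resampling and raises the power by one. Both cases end in
  \<open>inner_resample_power_nonneg\<close>.\<close>

lemma standard_choice_covariance_nonneg:
  assumes sc: "standard_choice \<Omega> \<pi> N \<kappa> A" and a: "bounded_on states C a"
    and l: "1 \<le> l" "l \<le> M" and m: "1 \<le> m" "m \<le> M"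
  shows "0 \<le> (\<integral>\<omega>. a (st l (\<omega> i)) * a (st m (\<omega> (i + Suc k))) \<partial>stat_sim)"
proof -
  let ?E = "\<lambda>m. \<integral>\<omega>. a (st l (\<omega> i)) * a (st m (\<omega> (i + Suc k))) \<partial>stat_sim"
  have coord: "(\<lambda>\<omega>. \<omega> j) \<in> stat_sim \<rightarrow>\<^sub>M records" for j by (rule RC.X_measurable)
  have stm: "(\<lambda>\<omega>. c (st m (\<omega> j))) \<in> borel_measurable stat_sim" if "m \<le> M" "c \<in> borel_measurable states" for c m j
    by (rule measurable_compose[OF coord measurable_compose[OF st_measurable[OF that(1)] that(2)]])
  have step: "?E m' = (\<integral>\<omega>. a (st l (\<omega> i)) * resample m' a (st M (\<omega> (i + k))) \<partial>stat_sim)" if m': "m' \<le> M" for m'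
  proof -
    have pa: "bounded_on (PiM {..i + k} (\<lambda>_. records)) C (\<lambda>x. a (st l (x i)))"
      unfolding bounded_on_def
    proof (intro conjI ballI)
      have c: "(\<lambda>x. x i) \<in> PiM {..i + k} (\<lambda>_. records) \<rightarrow>\<^sub>M records" by (rule measurable_component_singleton) simp
      show "(\<lambda>x. a (st l (x i))) \<in> borel_measurable (PiM {..i + k} (\<lambda>_. records))"
        by (rule measurable_compose[OF c bounded_onD(1)[OF bounded_on_st[OF l(2) a]]])
      show "\<bar>a (st l (x i))\<bar> \<le> C" if "x \<in> space (PiM {..i + k} (\<lambda>_. records))" for x
        by (rule bounded_onD(2)[OF bounded_on_st[OF l(2) a] measurable_space[OF c that]])
    qed
    show ?thesis
      using RC.step_real[OF pa bounded_on_st[OF m' a]] by (simp add: RC.kop_def resample_def)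
  qed
  have "AE w in record_law. resample m a (st M w) = resample M a (st M w)"
  proof -
    have "AE s in distr record_law states (st M). resample m a s = resample M a s"
      unfolding distr_record_law_st[OF order_refl] by (rule resample_AE_eq[OF sc m a])
    then show ?thesis
      by (rule AE_distrD[rotated]) (simp add: measurable_cong_sets[OF sets_record_law refl] st_measurable)
  qed
  then have "AE \<omega> in stat_sim. resample m a (st M (\<omega> (i + k))) = resample M a (st M (\<omega> (i + k)))"
    unfolding RC.law[of "i + k", symmetric] by (rule AE_distrD[OF coord])
  then have "?E m = ?E M"
    unfolding step[OF m(2)] step[OF order_refl]
    by (intro integral_cong_AE borel_measurable_times stm l order_refl bounded_onD(1)[OF a]
        bounded_onD(1)[OF resample_bounded[OF m(2) a]] bounded_onD(1)[OF resample_bounded[OF order_refl a]])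
      (elim eventually_mono, simp)
  also have "\<dots> = (\<integral>\<omega>. a (st l (\<omega> i)) * (RC.kop ^^ Suc k) (\<lambda>w. a (st M w)) (\<omega> i) \<partial>stat_sim)"
    by (rule RC.step_power[OF bounded_on_st[OF l(2) a] bounded_on_st[OF order_refl a]])
  also have "\<dots> = (\<integral>w. a (st l w) * (RC.kop ^^ Suc k) (\<lambda>w. a (st M w)) w \<partial>record_law)"
    by (rule RC.integral_X) (intro borel_measurable_times bounded_onD(1)[OF bounded_on_st[OF l(2) a]]
        bounded_onD(1)[OF RC.kop_power_bounded[OF bounded_on_st[OF order_refl a]]])
  also have "\<dots> = (\<integral>w. a (st l w) * (resample M ^^ Suc k) a (st M w) \<partial>record_law)"
  proof (rule Bochner_Integration.integral_cong[OF refl])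
    fix w assume "w \<in> space record_law"
    then have "w \<in> space records" using sets_eq_imp_space_eq[OF sets_record_law] by simp
    from kop_st_power[OF a this, of "Suc k"]
    show "a (st l w) * (RC.kop ^^ Suc k) (\<lambda>w. a (st M w)) w = a (st l w) * (resample M ^^ Suc k) a (st M w)"
      by (simp only:)
  qed
  also have "0 \<le> \<dots>"
  proof (cases "l = M")
    case True
    have "(\<integral>w. a (st M w) * (resample M ^^ Suc k) a (st M w) \<partial>record_law) = (\<integral>s. a s * (resample M ^^ Suc k) a s \<partial>distr record_law states (st M))"
      by (rule integral_distr[symmetric])
        (simp_all only: measurable_cong_sets[OF sets_record_law refl] st_measurable order_refl borel_measurable_times
          bounded_onD(1)[OF a] bounded_onD(1)[OF resample_power_bounded[OF a]])
    then show ?thesis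
      using True inner_resample_power_nonneg[OF sc a, of "Suc k"] by (simp only: distr_record_law_st[OF order_refl])
  next
    case False
    then have lM: "l < M" using l by simp
    note Tk = resample_power_bounded[OF a, of "Suc k"]
    have "(\<integral>w. a (st l w) * (resample M ^^ Suc k) a (st M w) \<partial>record_law) = resampling_form a ((resample M ^^ Suc k) a)"
      by (rule standard_choice_pair[OF sc lM order_refl a Tk])
    also have "\<dots> = (\<integral>s. a s * resample M ((resample M ^^ Suc k) a) s \<partial>start_law)"
      by (rule resample_form[OF sc M_pos order_refl a Tk, symmetric])
    also have "\<dots> = (\<integral>s. a s * (resample M ^^ Suc (Suc k)) a s \<partial>start_law)" by simp
    finally show ?thesis using inner_resample_power_nonneg[OF sc a, of "Suc (Suc k)"] by (simp only:)
  qed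
  finally show ?thesis .
qed

end

section \<open>The variance of the stationary mean\<close>

lemma cesaro_sums_unique: "cesaro_sums a s \<Longrightarrow> cesaro_sums a s' \<Longrightarrow> s = s'"
  unfolding cesaro_sums_def by (rule LIMSEQ_unique)

lemma sums_imp_cesaro_sums: "a sums s \<Longrightarrow> cesaro_sums a s"
  unfolding sums_def cesaro_sums_def by (rule cesaro_mean_tendsto)

lemma summable_cesaro_sums: "summable a \<Longrightarrow> cesaro_sums a s \<Longrightarrow> a sums s"
  using sums_imp_cesaro_sums[OF summable_sums, of a] cesaro_sums_unique[of a s "suminf a"] summable_sums[of a]
  by simp

text \<open>Partial sums of a nonnegative series increase, so the one at n is at most each of those
  from n to 2n - 1. These make up half of the terms of the Cesaro mean at 2n, which bounds the
  partial sum by twice the bound of the means.\<close>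

lemma nonneg_cesaro_sums_summable:
  assumes nn: "\<And>k. 0 \<le> a k" and cs: "cesaro_sums a s"
  shows "summable a"
proof -
  let ?S = "\<lambda>j. \<Sum>k<j. a k"
  have "Bseq (\<lambda>n. (\<Sum>j<n. ?S j) / real n)"
    using cs unfolding cesaro_sums_def by (intro convergent_imp_Bseq convergentI)
  then obtain B where B: "\<And>n. norm ((\<Sum>j<n. ?S j) / real n) \<le> B" unfolding Bseq_def by auto
  have S0: "0 \<le> ?S j" for j using nn by (intro sum_nonneg) auto
  have mono: "?S n \<le> ?S j" if "n \<le> j" for n j
    using that nn by (intro sum_mono2) auto
  have "?S n \<le> 2 * B" for n
  proof (cases "n = 0")
    case True
    then show ?thesis using order_trans[OF norm_ge_zero B[of 0]] by simp
  next
    case False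
    have "real n * ?S n = (\<Sum>j\<in>{n..<n + n}. ?S n)" by simp
    also have "\<dots> \<le> (\<Sum>j\<in>{n..<n + n}. ?S j)" by (rule sum_mono) (rule mono, simp)
    also have "\<dots> \<le> (\<Sum>j<n + n. ?S j)" using S0 by (intro sum_mono2) auto
    finally have "real n * ?S n / real (n + n) \<le> (\<Sum>j<n + n. ?S j) / real (n + n)"
      by (rule divide_right_mono) simp
    also have "\<dots> \<le> B" by (rule abs_le_D1[OF B[of "n + n", unfolded real_norm_def]])
    finally show ?thesis using False by simp
  qed
  with nn show ?thesis by (rule summableI_nonneg_bounded)
qed

text \<open>Brings the lag 0 terms into the form of the theorem: the diagonal, and twice the pairs
  with l below m.\<close>

lemma sum_symmetric_square:
  fixes z :: "nat \<Rightarrow> nat \<Rightarrow> real"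
  assumes sym: "\<And>l m. z l m = z m l"
  shows "(\<Sum>l=1..n. \<Sum>m=1..n. z l m) = (\<Sum>m=1..n. z m m) + 2 * (\<Sum>m=1..n. \<Sum>l\<in>{1..<m}. z l m)"
proof (induction n)
  case (Suc n)
  have "{1..<Suc n} = {1..n}" by auto
  moreover have "(\<Sum>m=1..n. z (Suc n) m) = (\<Sum>l=1..n. z l (Suc n))" by (intro sum.cong refl sym)
  ultimately show ?case using Suc by (simp add: sum.distrib)
qed simp

text \<open>In the characteristic functions, scaling by \<open>c\<close> is a change of argument
  from \<open>t\<close> to \<open>t * c\<close>.\<close>

lemma weak_conv_m_scale:
  assumes P: "prob_space P" and Z: "\<And>n. Z n \<in> borel_measurable P" and Q: "real_distribution Q"
    and conv: "weak_conv_m (\<lambda>n. distr P borel (Z n)) Q"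
  shows "weak_conv_m (\<lambda>n. distr P borel (\<lambda>\<omega>. c * Z n \<omega>)) (distr Q borel (\<lambda>x. c * x))"
proof -
  interpret P: prob_space P by fact
  interpret Q: real_distribution Q by fact
  note [measurable] = Z
  have rd: "real_distribution (distr P borel (Z n))" "real_distribution (distr P borel (\<lambda>\<omega>. c * Z n \<omega>))" for n
    by (rule P.real_distribution_distr, simp)+
  have rq: "real_distribution (distr Q borel (\<lambda>x. c * x))"
    by (rule Q.real_distribution_distr) simp
  show ?thesis
  proof (rule levy_continuity[OF rd(2) rq])
    fix t
    have "char (distr P borel (\<lambda>\<omega>. c * Z n \<omega>)) t = char (distr P borel (Z n)) (t * c)" for n
      unfolding char_def by (simp add: integral_distr mult.assoc)
    moreover have "char (distr Q borel (\<lambda>x. c * x)) t = char Q (t * c)"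
      unfolding char_def by (simp add: integral_distr mult.assoc)
    ultimately show "(\<lambda>n. char (distr P borel (\<lambda>\<omega>. c * Z n \<omega>)) t) \<longlonglongrightarrow> char (distr Q borel (\<lambda>x. c * x)) t"
      using levy_continuity1[OF rd(1) Q conv, of "t * c"] by simp
  qed
qed

lemma real_distribution_centered_normal: "0 < \<sigma> \<Longrightarrow> real_distribution (centered_normal \<sigma>)"
  by (intro real_distribution.intro prob_space_normal_density real_distribution_axioms.intro) simp_all

lemma centered_normal_scale:
  assumes "0 < \<sigma>" "0 < c"
  shows "distr (centered_normal \<sigma>) borel (\<lambda>x. c * x) = centered_normal (c * \<sigma>)"
proof -
  interpret prob_space "centered_normal \<sigma>" by (rule prob_space_normal_density) fact
  have "distributed (centered_normal \<sigma>) lborel (\<lambda>x. x) (normal_density 0 \<sigma>)"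
    unfolding distributed_def by (auto simp: distr_id2 intro!: distr_id2)
  from normal_density_affine[OF this assms(1), of c 0] assms
  have "distributed (centered_normal \<sigma>) lborel (\<lambda>x. c * x) (normal_density 0 (c * \<sigma>))" by simp
  then have "distr (centered_normal \<sigma>) lborel (\<lambda>x. c * x) = centered_normal (c * \<sigma>)"
    by (simp add: distributed_distr_eq_density)
  moreover have "distr (centered_normal \<sigma>) lborel (\<lambda>x. c * x) = distr (centered_normal \<sigma>) borel (\<lambda>x. c * x)"
    by (rule distr_cong) simp_all
  ultimately show ?thesis by simp
qed

lemma (in stationary_chain) stationary_pair:
  fixes h :: "'a \<Rightarrow> 'a \<Rightarrow> real"
  assumes h: "(\<lambda>(x, y). h x y) \<in> borel_measurable (S \<Otimes>\<^sub>M S)"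
  shows "(\<integral>\<omega>. h (X i \<omega>) (X (i + k) \<omega>) \<partial>P) = (\<integral>\<omega>. h (X 0 \<omega>) (X k \<omega>) \<partial>P)"
proof -
  let ?S = "PiM {..k} (\<lambda>_. S)"
  have "(\<lambda>x. (x 0, x k)) \<in> ?S \<rightarrow>\<^sub>M S \<Otimes>\<^sub>M S"
    by (intro measurable_Pair measurable_component_singleton) simp_all
  from measurable_compose[OF this h] have h': "(\<lambda>x. h (x 0) (x k)) \<in> borel_measurable ?S" by simp
  have "(\<integral>x. h (x 0) (x k) \<partial>distr P ?S (past (\<lambda>n. X (n + i)) k)) = (\<integral>x. h (x 0) (x k) \<partial>distr P ?S (past X k))"
    by (simp only: stationary_past)
  then show ?thesis
    by (subst (asm) (1 2) integral_distr) (simp_all add: h' add.commute)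
qed

section \<open>Moments of the centred observable along the stationary samples\<close>

locale mp_mcmc_functional = mp_mcmc \<Omega> \<pi> N M \<kappa> A
  for \<Omega> :: "(real^'d) set" and \<pi> N M \<kappa> A +
  fixes f :: "real^'d \<Rightarrow> real" and \<mu> :: real
  assumes f_measurable: "f \<in> borel_measurable (Om \<Omega>)"
    and f_square: "integrable (target \<Omega> \<pi>) (\<lambda>x. (f x)\<^sup>2)"
    and mu: "\<mu> = (\<integral>x. f x * \<pi> x \<partial>restrict_space lborel \<Omega>)"
begin

text \<open>The centred observable is read as a function of the state that ignores the index, so
  that the results on functions of states apply.\<close>

definition g :: "(real^'d) \<times> nat \<Rightarrow> real" where
  "g s = f (fst s) - \<mu>"

sublocale Tg: prob_space "target \<Omega> \<pi>" by (rule prob_space_target)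

lemma f_target: "f \<in> borel_measurable (target \<Omega> \<pi>)"
  unfolding measurable_cong_sets[OF sets_target refl] by (rule f_measurable)

lemma f_integrable: "integrable (target \<Omega> \<pi>) f"
  by (rule Tg.square_integrable_imp_integrable[OF f_target f_square])

lemma mu_eq: "(\<integral>x. f x \<partial>target \<Omega> \<pi>) = \<mu>"
proof -
  have fm: "f \<in> borel_measurable Leb" "\<pi> \<in> borel_measurable Leb"
    unfolding measurable_cong_sets[OF sets_Leb refl] by (rule f_measurable, rule target_measurable)
  have "AE x in Leb. 0 \<le> \<pi> x" using target_nonneg by (intro AE_I2) simp
  from integral_density[OF fm this] show ?thesis
    unfolding target_def mu by (simp add: mult.commute)
qed

lemma g_measurable: "g \<in> borel_measurable states"
  unfolding g_def by (intro borel_measurable_diff borel_measurable_const measurable_compose[OF measurable_fst f_measurable])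

lemma sample_eq: "m \<in> {1..M} \<Longrightarrow> sample M j m \<omega> = fst (st m (\<omega> j))"
  unfolding chain_Z_def by (rule batch_nth)

lemma sample_measurable: "m \<le> M \<Longrightarrow> (\<lambda>\<omega>. fst (st m (\<omega> j))) \<in> stat_sim \<rightarrow>\<^sub>M Om \<Omega>"
  by (rule measurable_compose[OF RC.X_measurable measurable_compose[OF st_measurable measurable_fst]])

lemma distr_sample:
  assumes m: "m \<le> M"
  shows "distr stat_sim (Om \<Omega>) (\<lambda>\<omega>. fst (st m (\<omega> j))) = target \<Omega> \<pi>"
proof -
  have "distr stat_sim (Om \<Omega>) (\<lambda>\<omega>. fst (st m (\<omega> j))) = distr (distr stat_sim records (\<lambda>\<omega>. \<omega> j)) (Om \<Omega>) (\<lambda>w. fst (st m w))"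
    by (subst distr_distr[OF measurable_compose[OF st_measurable[OF m] measurable_fst] RC.X_measurable]) (simp add: comp_def)
  then show ?thesis by (simp only: RC.law distr_record_law_sample[OF m])
qed

lemma integral_sample:
  fixes h :: "real^'d \<Rightarrow> real"
  assumes m: "m \<le> M" and h: "h \<in> borel_measurable (Om \<Omega>)"
  shows "(\<integral>\<omega>. h (fst (st m (\<omega> j))) \<partial>stat_sim) = (\<integral>x. h x \<partial>target \<Omega> \<pi>)"
    and "integrable stat_sim (\<lambda>\<omega>. h (fst (st m (\<omega> j)))) \<longleftrightarrow> integrable (target \<Omega> \<pi>) h"
  unfolding distr_sample[OF m, of j, symmetric]
  by (rule integral_distr[OF sample_measurable[OF m] h, symmetric],
      rule integrable_distr_eq[OF sample_measurable[OF m] h, symmetric])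

lemma g_st_measurable: "m \<le> M \<Longrightarrow> (\<lambda>\<omega>. g (st m (\<omega> j))) \<in> borel_measurable stat_sim"
  by (rule measurable_compose[OF RC.X_measurable measurable_compose[OF st_measurable g_measurable]])

lemma g_square: "m \<le> M \<Longrightarrow> integrable stat_sim (\<lambda>\<omega>. (g (st m (\<omega> j)))\<^sup>2)"
proof -
  assume m: "m \<le> M"
  have "integrable (target \<Omega> \<pi>) (\<lambda>x. (f x)\<^sup>2 + \<mu>\<^sup>2 - 2 * f x * \<mu>)"
    using f_square f_integrable by simp
  then have "integrable (target \<Omega> \<pi>) (\<lambda>x. (f x - \<mu>)\<^sup>2)" by (simp only: power2_diff)
  moreover have "(\<lambda>x. (f x - \<mu>)\<^sup>2) \<in> borel_measurable (Om \<Omega>)"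
    using f_measurable by (intro borel_measurable_power borel_measurable_diff borel_measurable_const)
  ultimately show ?thesis
    unfolding g_def using integral_sample(2)[OF m, of "\<lambda>x. (f x - \<mu>)\<^sup>2" j] by simp
qed

lemma abs_mult_le_squares: "\<bar>x * y\<bar> \<le> x\<^sup>2 + y\<^sup>2" for x y :: real
proof -
  have "2 * (\<bar>x\<bar> * \<bar>y\<bar>) \<le> \<bar>x\<bar>\<^sup>2 + \<bar>y\<bar>\<^sup>2" using sum_squares_bound[of "\<bar>x\<bar>" "\<bar>y\<bar>"] by (simp add: mult.assoc)
  moreover have "0 \<le> \<bar>x\<bar> * \<bar>y\<bar>" by simp
  ultimately show ?thesis unfolding abs_mult power2_abs by linarith
qed

lemma g_product_integrable:
  assumes "l \<le> M" "m \<le> M"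
  shows "integrable stat_sim (\<lambda>\<omega>. g (st l (\<omega> i)) * g (st m (\<omega> j)))"
proof (rule Bochner_Integration.integrable_bound)
  show "integrable stat_sim (\<lambda>\<omega>. (g (st l (\<omega> i)))\<^sup>2 + (g (st m (\<omega> j)))\<^sup>2)"
    by (intro Bochner_Integration.integrable_add g_square assms)
  show "(\<lambda>\<omega>. g (st l (\<omega> i)) * g (st m (\<omega> j))) \<in> borel_measurable stat_sim"
    by (intro borel_measurable_times g_st_measurable assms)
  show "AE \<omega> in stat_sim. norm (g (st l (\<omega> i)) * g (st m (\<omega> j))) \<le> norm ((g (st l (\<omega> i)))\<^sup>2 + (g (st m (\<omega> j)))\<^sup>2)"
    by (intro AE_I2) (use abs_mult_le_squares in \<open>simp add: abs_of_nonneg\<close>)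
qed

lemma g_integrable: "m \<le> M \<Longrightarrow> integrable stat_sim (\<lambda>\<omega>. g (st m (\<omega> j)))"
  by (rule RC.square_integrable_imp_integrable[OF g_st_measurable g_square])

lemma f_sample_mean:
  assumes "m \<in> {1..M}"
  shows "(\<integral>\<omega>. f (sample M j m \<omega>) \<partial>stat_sim) = \<mu>"
  unfolding sample_eq[OF assms] using assms by (simp add: integral_sample(1)[OF _ f_measurable] mu_eq)

lemma g_mean: "m \<in> {1..M} \<Longrightarrow> (\<integral>\<omega>. g (st m (\<omega> j)) \<partial>stat_sim) = 0"
  unfolding g_def
  using integral_sample[of m f j] f_measurable f_integrable mu_eq
  by (subst Bochner_Integration.integral_diff) (simp_all add: RC.prob_space)

abbreviation zt :: "nat \<Rightarrow> nat \<Rightarrow> nat \<Rightarrow> nat \<Rightarrow> real" where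
  "zt \<equiv> zeta \<Omega> \<pi> N M \<kappa> A f"

lemma zeta_eq:
  assumes "l \<in> {1..M}" "m \<in> {1..M}"
  shows "zt i k l m = (\<integral>\<omega>. g (st l (\<omega> i)) * g (st m (\<omega> (i + k))) \<partial>stat_sim)"
  unfolding zeta_def covariance_def f_sample_mean[OF assms(1)] f_sample_mean[OF assms(2)]
  unfolding sample_eq[OF assms(1)] sample_eq[OF assms(2)] g_def ..

text \<open>Two samples at lag \<open>k\<close> are functions of the records at times
  \<open>i\<close> and \<open>i + k\<close>, whose joint law is stationary.\<close>

lemma zeta_stationary:
  assumes lm: "l \<in> {1..M}" "m \<in> {1..M}"
  shows "zt i k l m = zt 0 k l m"
proof -
  have l: "l \<le> M" "m \<le> M" using lm by auto
  have "(\<lambda>(x, y). g (st l x) * g (st m y)) \<in> borel_measurable (records \<Otimes>\<^sub>M records)"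
    unfolding case_prod_beta
    by (intro borel_measurable_times measurable_compose[OF measurable_fst measurable_compose[OF st_measurable[OF l(1)] g_measurable]]
        measurable_compose[OF measurable_snd measurable_compose[OF st_measurable[OF l(2)] g_measurable]])
  from RC.stationary_pair[OF this, of i k] show ?thesis
    by (simp only: zeta_eq[OF lm] add_0)
qed

lemma zeta_0_commute: "l \<in> {1..M} \<Longrightarrow> m \<in> {1..M} \<Longrightarrow> zt i 0 l m = zt i 0 m l"
  by (simp add: zeta_eq mult.commute)

lemma zeta_0_diag:
  assumes m: "m \<in> {1..M}"
  shows "zt i 0 m m = Tg.variance f"
proof -
  have "(\<lambda>x. (f x - \<mu>)\<^sup>2) \<in> borel_measurable (Om \<Omega>)"
    using f_measurable by (intro borel_measurable_power borel_measurable_diff borel_measurable_const)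
  from integral_sample(1)[OF _ this, of m i] m show ?thesis
    unfolding zeta_eq[OF m m] mu_eq g_def by (simp add: power2_eq_square)
qed

text \<open>Nonnegativity is known for bounded functions; \<open>g\<close> is truncated at level B,
  and a sum of squares of \<open>g\<close>, integrable by \<open>f_square\<close>, dominates the
  products.\<close>

lemma standard_choice_zeta_nonneg:
  assumes sc: "standard_choice \<Omega> \<pi> N \<kappa> A" and lm: "l \<in> {1..M}" "m \<in> {1..M}"
  shows "0 \<le> zt i (Suc k) l m"
proof -
  have l: "1 \<le> l" "l \<le> M" and m: "1 \<le> m" "m \<le> M" using lm by auto
  define a where "a B s = max (- real B) (min (real B) (g s))" for B s
  have a_bd: "\<bar>a B s\<bar> \<le> \<bar>g s\<bar>" "\<bar>a B s\<bar> \<le> real B" for B s by (auto simp: a_def)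
  have a: "bounded_on states (real B) (a B)" for B
    unfolding bounded_on_def using a_bd(2) g_measurable
    by (auto simp: a_def[abs_def] intro!: borel_measurable_max borel_measurable_min)
  have am: "(\<lambda>\<omega>. a B (st m' (\<omega> j))) \<in> borel_measurable stat_sim" if "m' \<le> M" for B m' j
    by (rule measurable_compose[OF RC.X_measurable measurable_compose[OF st_measurable[OF that] bounded_onD(1)[OF a]]])
  have a_lim: "(\<lambda>B. a B s) \<longlonglongrightarrow> g s" for s
  proof (rule tendsto_eventually)
    obtain B0 where "\<bar>g s\<bar> \<le> real B0" using real_arch_simple by blast
    then have "a B s = g s" if "B0 \<le> B" for B
      using that of_nat_mono[OF that, where 'a = real] by (auto simp: a_def)
    then show "eventually (\<lambda>B. a B s = g s) sequentially" by (auto simp: eventually_sequentially)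
  qed
  have "(\<lambda>B. \<integral>\<omega>. a B (st l (\<omega> i)) * a B (st m (\<omega> (i + Suc k))) \<partial>stat_sim)
      \<longlonglongrightarrow> (\<integral>\<omega>. g (st l (\<omega> i)) * g (st m (\<omega> (i + Suc k))) \<partial>stat_sim)"
  proof (rule integral_dominated_convergence[where w = "\<lambda>\<omega>. (g (st l (\<omega> i)))\<^sup>2 + (g (st m (\<omega> (i + Suc k))))\<^sup>2"])
    show "integrable stat_sim (\<lambda>\<omega>. (g (st l (\<omega> i)))\<^sup>2 + (g (st m (\<omega> (i + Suc k))))\<^sup>2)"
      by (intro Bochner_Integration.integrable_add g_square l m)
    show "AE \<omega> in stat_sim. (\<lambda>B. a B (st l (\<omega> i)) * a B (st m (\<omega> (i + Suc k)))) \<longlonglongrightarrow> g (st l (\<omega> i)) * g (st m (\<omega> (i + Suc k)))"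
      by (intro AE_I2 tendsto_mult a_lim)
    show "AE \<omega> in stat_sim. norm (a B (st l (\<omega> i)) * a B (st m (\<omega> (i + Suc k)))) \<le> (g (st l (\<omega> i)))\<^sup>2 + (g (st m (\<omega> (i + Suc k))))\<^sup>2" for B
    proof (rule AE_I2)
      fix \<omega>
      have "\<bar>a B (st l (\<omega> i)) * a B (st m (\<omega> (i + Suc k)))\<bar> \<le> \<bar>g (st l (\<omega> i)) * g (st m (\<omega> (i + Suc k)))\<bar>"
        unfolding abs_mult by (intro mult_mono a_bd(1)) simp_all
      then show "norm (a B (st l (\<omega> i)) * a B (st m (\<omega> (i + Suc k)))) \<le> (g (st l (\<omega> i)))\<^sup>2 + (g (st m (\<omega> (i + Suc k))))\<^sup>2"
        unfolding real_norm_def by (rule order_trans[OF _ abs_mult_le_squares])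
    qed
  qed (intro borel_measurable_times am g_st_measurable l m)+
  then show ?thesis
    unfolding zeta_eq[OF lm]
    by (rule LIMSEQ_le_const) (intro exI allI impI standard_choice_covariance_nonneg[OF sc a l m])
qed

text \<open>The autocovariance at lag \<open>k\<close> of the batch means, in terms of single
  samples; the square of \<open>M\<close> stems from the two averages.\<close>

definition batch_cov :: "nat \<Rightarrow> real" where
  "batch_cov k = (\<Sum>l=1..M. \<Sum>m=1..M. zt 0 k l m) / (real M)\<^sup>2"

definition G :: "nat \<Rightarrow> (nat \<Rightarrow> (nat \<Rightarrow> real^'d) \<times> (nat \<Rightarrow> nat)) \<Rightarrow> real" where
  "G j \<omega> = batch_mean M f (chain_Z M j \<omega>) - \<mu>"

lemma G_eq: "G j \<omega> = (\<Sum>m=1..M. g (st m (\<omega> j))) / real M"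
proof -
  have "(\<Sum>m=1..M. f (sample M j m \<omega>)) = (\<Sum>m=1..M. g (st m (\<omega> j)) + \<mu>)"
    by (intro sum.cong[OF refl]) (simp only: sample_eq g_def diff_add_cancel)
  then show ?thesis
    using M_pos unfolding G_def batch_mean_def by (simp add: sum.distrib add_divide_distrib)
qed

lemma G_product_eq: "G i \<omega> * G j \<omega> = (\<Sum>l=1..M. \<Sum>m=1..M. g (st l (\<omega> i)) * g (st m (\<omega> j))) / (real M)\<^sup>2"
  unfolding G_eq by (simp add: sum_product power2_eq_square)

lemma G_product_integrable: "integrable stat_sim (\<lambda>\<omega>. G i \<omega> * G j \<omega>)"
  unfolding G_product_eq
  by (intro integrable_divide Bochner_Integration.integrable_sum g_product_integrable) auto

lemma G_covariance: "(\<integral>\<omega>. G i \<omega> * G (i + k) \<omega> \<partial>stat_sim) = batch_cov k"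
proof -
  have "(\<integral>\<omega>. G i \<omega> * G (i + k) \<omega> \<partial>stat_sim)
      = (\<Sum>l=1..M. \<Sum>m=1..M. (\<integral>\<omega>. g (st l (\<omega> i)) * g (st m (\<omega> (i + k))) \<partial>stat_sim)) / (real M)\<^sup>2"
    unfolding G_product_eq integral_divide_zero
    by (subst Bochner_Integration.integral_sum, intro Bochner_Integration.integrable_sum g_product_integrable, simp, simp)
      (intro arg_cong2[where f = "(/)"] sum.cong[OF refl] refl Bochner_Integration.integral_sum g_product_integrable, simp_all)
  also have "\<dots> = batch_cov k"
    unfolding batch_cov_def
    by (intro arg_cong2[where f = "(/)"] sum.cong[OF refl] refl) (simp only: zeta_eq[symmetric] zeta_stationary[of _ _ i])
  finally show ?thesis .
qed

lemma G_mean: "(\<integral>\<omega>. G j \<omega> \<partial>stat_sim) = 0"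
  unfolding G_eq integral_divide_zero
  by (subst Bochner_Integration.integral_sum) (auto intro!: g_integrable sum.neutral g_mean)

lemma G_integrable: "integrable stat_sim (G j)"
  unfolding G_eq by (intro integrable_divide Bochner_Integration.integrable_sum g_integrable) auto

text \<open>The \<open>G j\<close> are centred and their covariances depend on the lag alone, so
  \<open>sum_square_stationary\<close> evaluates the double sum.\<close>

lemma variance_normalized_mean:
  assumes n: "0 < n"
  shows "RC.variance (normalized_mean (\<lambda>j \<omega>. batch_mean M f (chain_Z M j \<omega>)) \<mu> n)
    = batch_cov 0 + 2 * ((\<Sum>j<n. \<Sum>k<j. batch_cov (Suc k)) / real n)"
proof -
  let ?X = "normalized_mean (\<lambda>j \<omega>. batch_mean M f (chain_Z M j \<omega>)) \<mu> n"
  have X: "?X \<omega> = (\<Sum>i<n. G i \<omega>) / sqrt (real n)" for \<omega>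
    unfolding normalized_mean_eq G_def ..
  have mean: "(\<integral>\<omega>. ?X \<omega> \<partial>stat_sim) = 0"
    unfolding X integral_divide_zero
    by (subst Bochner_Integration.integral_sum) (simp_all add: G_integrable G_mean)
  have "RC.variance ?X = (\<integral>\<omega>. (\<Sum>i<n. \<Sum>j<n. G i \<omega> * G j \<omega>) / real n \<partial>stat_sim)"
    unfolding mean X by (simp add: power_divide power2_eq_square[of "sum _ _"] sum_product)
  also have "\<dots> = (\<Sum>i<n. \<Sum>j<n. (\<integral>\<omega>. G i \<omega> * G j \<omega> \<partial>stat_sim)) / real n"
    by (simp add: Bochner_Integration.integral_sum Bochner_Integration.integrable_sum G_product_integrable)
  also have "(\<Sum>i<n. \<Sum>j<n. (\<integral>\<omega>. G i \<omega> * G j \<omega> \<partial>stat_sim))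
      = real n * batch_cov 0 + 2 * (\<Sum>j<n. \<Sum>k<j. batch_cov (Suc k))"
    by (rule sum_square_stationary) (simp_all only: G_covariance mult.commute)
  finally show ?thesis using n by (simp add: add_divide_distrib)
qed

end

context mp_mcmc_functional begin

text \<open>The Markov property comes from \<open>Z_markov\<close> for the stationary start,
  recurrence from \<open>positive_harris\<close>, and stationarity from the records, since a batch
  is a function of one record.\<close>

lemma stationary_harris_chain:
  assumes Zm: "Z_markov \<Omega> N M \<kappa> A K" and ph: "positive_harris (Om_pow \<Omega> M) K"
  shows "harris_chain stat_sim (Om_pow \<Omega> M) K (chain_Z M) (distr stat_sim (Om_pow \<Omega> M) (chain_Z M 0))"
proof -
  have mc: "markov_chain stat_sim (Om_pow \<Omega> M) K (chain_Z M)"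
    using Zm start_law_in unfolding Z_markov_def stationary_simulation_def by blast
  have batch: "batch M \<in> records \<rightarrow>\<^sub>M Om_pow \<Omega> M"
  proof -
    have "(\<lambda>w. \<lambda>m\<in>{1..M}. fst (st m w)) \<in> records \<rightarrow>\<^sub>M Om_pow \<Omega> M"
      by (intro measurable_restrict measurable_compose[OF st_measurable measurable_fst]) simp
    moreover have "batch M = (\<lambda>w. \<lambda>m\<in>{1..M}. fst (st m w))"
      by (simp add: batch_def st_def case_prod_beta fun_eq_iff)
    ultimately show ?thesis by simp
  qed
  have law: "distr stat_sim (Om_pow \<Omega> M) (chain_Z M n) = distr record_law (Om_pow \<Omega> M) (batch M)" for n
  proof -
    have "distr stat_sim (Om_pow \<Omega> M) (chain_Z M n) = distr (distr stat_sim records (\<lambda>\<omega>. \<omega> n)) (Om_pow \<Omega> M) (batch M)"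
      by (subst distr_distr[OF batch RC.X_measurable]) (simp add: comp_def chain_Z_def[abs_def])
    then show ?thesis by (simp only: RC.law)
  qed
  show ?thesis
  proof (intro harris_chain.intro harris_chain_axioms.intro stationary_chain.intro stationary_chain_axioms.intro
      prob_chain.intro mchain.intro mc)
    show "prob_space stat_sim" by unfold_locales
    show "harris_recurrent (Om_pow \<Omega> M) K" using ph by (simp add: positive_harris_def)
    show "distr stat_sim (Om_pow \<Omega> M) (chain_Z M n) = distr stat_sim (Om_pow \<Omega> M) (chain_Z M 0)" for n
      unfolding law ..
  qed
qed

lemma batch_mean_measurable: "batch_mean M f \<in> borel_measurable (Om_pow \<Omega> M)"
  unfolding batch_mean_def[abs_def]
proof (intro borel_measurable_divide borel_measurable_const borel_measurable_sum)
  fix m assume m: "m \<in> {1..M}"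
  show "(\<lambda>z. f (z m)) \<in> borel_measurable (Om_pow \<Omega> M)"
    by (rule measurable_compose[OF _ f_measurable]) (rule measurable_component_singleton[OF m])
qed

text \<open>Passes from the normalisation by \<open>n\<close> batches, in which well-behavedness is
  stated, to the normalisation by all \<open>n * M\<close> samples.\<close>

lemma sample_mean_eq:
  "sqrt (real (n * M)) * ((\<Sum>j<n. \<Sum>m=1..M. f (sample M j m \<omega>)) / real (n * M) - \<mu>)
    = sqrt (real M) * normalized_mean (\<lambda>j \<omega>. batch_mean M f (chain_Z M j \<omega>)) \<mu> n \<omega>"
proof -
  have "(\<Sum>j<n. batch_mean M f (chain_Z M j \<omega>)) / real n = (\<Sum>j<n. \<Sum>m=1..M. f (sample M j m \<omega>)) / real (n * M)"
    unfolding batch_mean_def sum_divide_distrib[symmetric] by (simp add: mult.commute)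
  then show ?thesis
    unfolding normalized_mean_def by (simp add: real_sqrt_mult mult_ac)
qed

theorem central_limit_theorem:
  assumes \<nu>: "\<nu> \<in> space (prob_algebra states)"
    and Zm: "Z_markov \<Omega> N M \<kappa> A K" and ph: "positive_harris (Om_pow \<Omega> M) K"
    and wb: "well_behaved stat_sim (\<lambda>j \<omega>. batch_mean M f (chain_Z M j \<omega>)) \<mu>"
  shows "\<exists>\<sigma>>0. \<exists>s.
      weak_conv_m
        (\<lambda>n. distr (mp_simulation \<Omega> N M \<kappa> A \<nu>) borel
          (\<lambda>\<omega>. sqrt (real (n * M)) *
                ((\<Sum>j<n. \<Sum>m=1..M. f (sample M j m \<omega>)) / real (n * M) - \<mu>)))
        (centered_normal \<sigma>) \<and>
      \<sigma>\<^sup>2 = Tg.variance f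
         + 2 / real M * (\<Sum>m=1..M. \<Sum>l\<in>{1..<m}. zt i 0 l m)
         + 2 / real M * s \<and>
      cesaro_sums (\<lambda>k. \<Sum>l=1..M. \<Sum>m=1..M. zt i (Suc k) l m) s \<and>
      (summable (\<lambda>k. \<Sum>l=1..M. \<Sum>m=1..M. zt i (Suc k) l m) \<or> standard_choice \<Omega> \<pi> N \<kappa> A \<longrightarrow>
         (\<lambda>k. \<Sum>l=1..M. \<Sum>m=1..M. zt i (Suc k) l m) sums s)"
proof -
  let ?F = "\<lambda>j \<omega>. batch_mean M f (chain_Z M j \<omega>)"
  let ?a = "\<lambda>k. \<Sum>l=1..M. \<Sum>m=1..M. zt i (Suc k) l m"
  have M0: "0 < real M" using M_pos by simp
  obtain \<tau> where \<tau>: "0 < \<tau>"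
    and conv: "weak_conv_m (\<lambda>n. distr stat_sim borel (normalized_mean ?F \<mu> n)) (centered_normal \<tau>)"
    and var: "(\<lambda>n. RC.variance (normalized_mean ?F \<mu> n)) \<longlonglongrightarrow> \<tau>\<^sup>2"
    using wb unfolding well_behaved_def by blast
  define \<sigma> where "\<sigma> = sqrt (real M) * \<tau>"
  \<comment> \<open>The solution of
    \<open>\<tau>\<^sup>2 = batch_cov 0 + 2 * s / (real M)\<^sup>2\<close>, the limit form of
    \<open>variance_normalized_mean\<close>; the square of \<open>M\<close> undoes the division
    inside \<open>batch_cov\<close>.\<close>
  define s where "s = (real M)\<^sup>2 * ((\<tau>\<^sup>2 - batch_cov 0) / 2)"

  interpret H: harris_chain stat_sim "Om_pow \<Omega> M" K "chain_Z M" "distr stat_sim (Om_pow \<Omega> M) (chain_Z M 0)"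
    by (rule stationary_harris_chain[OF Zm ph])
  let ?P = "mp_simulation \<Omega> N M \<kappa> A \<nu>"
  interpret S: prob_chain ?P records record_kernel "\<lambda>n \<omega>. \<omega> n"
    by (rule prob_chain_simulation[OF \<nu>])
  have P: "prob_space ?P" by unfold_locales
  have mcP: "markov_chain ?P (Om_pow \<Omega> M) K (chain_Z M)"
    using Zm \<nu> unfolding Z_markov_def by blast
  interpret Z: mchain ?P "Om_pow \<Omega> M" K "chain_Z M" by (rule mchain.intro[OF mcP])
  have meas: "normalized_mean ?F \<mu> n \<in> borel_measurable ?P" for n
    unfolding normalized_mean_def[abs_def]
    by (intro borel_measurable_times borel_measurable_const borel_measurable_diff borel_measurable_divide
        borel_measurable_sum measurable_compose[OF Z.X_measurable batch_mean_measurable])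
  have convP: "weak_conv_m (\<lambda>n. distr ?P borel (normalized_mean ?F \<mu> n)) (centered_normal \<tau>)"
    by (rule H.weak_conv_any_start[OF batch_mean_measurable P mcP real_distribution_centered_normal[OF \<tau>] conv])
  have "weak_conv_m (\<lambda>n. distr ?P borel (\<lambda>\<omega>. sqrt (real M) * normalized_mean ?F \<mu> n \<omega>))
      (distr (centered_normal \<tau>) borel (\<lambda>x. sqrt (real M) * x))"
    by (rule weak_conv_m_scale[OF P meas real_distribution_centered_normal[OF \<tau>] convP])
  moreover have "distr (centered_normal \<tau>) borel (\<lambda>x. sqrt (real M) * x) = centered_normal \<sigma>"
    unfolding \<sigma>_def using M0 by (intro centered_normal_scale \<tau>) simp
  ultimately have clt: "weak_conv_m (\<lambda>n. distr ?P borel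
      (\<lambda>\<omega>. sqrt (real (n * M)) * ((\<Sum>j<n. \<Sum>m=1..M. f (sample M j m \<omega>)) / real (n * M) - \<mu>))) (centered_normal \<sigma>)"
    by (simp only: sample_mean_eq)

  have zst: "zt i k l m = zt 0 k l m" if "l \<in> {1..M}" "m \<in> {1..M}" for k l m
    by (rule zeta_stationary[OF that])
  have bc: "(\<Sum>l=1..M. \<Sum>m=1..M. zt i k l m) = (real M)\<^sup>2 * batch_cov k" for k
  proof -
    have "(\<Sum>l=1..M. \<Sum>m=1..M. zt i k l m) = (\<Sum>l=1..M. \<Sum>m=1..M. zt 0 k l m)"
      by (intro sum.cong[OF refl] zst)
    then show ?thesis using M0 by (simp add: batch_cov_def)
  qed
  have "(real M)\<^sup>2 * batch_cov 0 = real M * Tg.variance f + 2 * (\<Sum>m=1..M. \<Sum>l\<in>{1..<m}. zt i 0 l m)"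
  proof -
    \<comment> \<open>Extended by 0 outside the range of positions, because
      \<open>sum_symmetric_square\<close> asks for symmetry at all indices and
      \<open>zeta_0_commute\<close> gives it within the range.\<close>
    define z where "z l m = (if l \<in> {1..M} \<and> m \<in> {1..M} then zt i 0 l m else 0)" for l m
    have "(real M)\<^sup>2 * batch_cov 0 = (\<Sum>l=1..M. \<Sum>m=1..M. z l m)"
      unfolding bc[symmetric] by (intro sum.cong[OF refl]) (simp add: z_def)
    also have "\<dots> = (\<Sum>m=1..M. z m m) + 2 * (\<Sum>m=1..M. \<Sum>l\<in>{1..<m}. z l m)"
      by (rule sum_symmetric_square) (auto simp: z_def zeta_0_commute)
    also have "(\<Sum>m=1..M. z m m) = (\<Sum>m=1..M. Tg.variance f)"
      by (intro sum.cong[OF refl]) (simp add: z_def zeta_0_diag)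
    also have "(\<Sum>m=1..M. \<Sum>l\<in>{1..<m}. z l m) = (\<Sum>m=1..M. \<Sum>l\<in>{1..<m}. zt i 0 l m)"
      by (intro sum.cong[OF refl]) (auto simp: z_def)
    finally show ?thesis by simp
  qed
  then have "real M * batch_cov 0 = Tg.variance f + 2 / real M * (\<Sum>m=1..M. \<Sum>l\<in>{1..<m}. zt i 0 l m)"
    using M0 by (simp add: power2_eq_square field_simps)
  moreover have "\<sigma>\<^sup>2 = real M * batch_cov 0 + 2 / real M * s"
    using M0 by (simp add: \<sigma>_def s_def power_mult_distrib power2_eq_square[of "real M"] field_simps)
  ultimately have formula: "\<sigma>\<^sup>2 = Tg.variance f + 2 / real M * (\<Sum>m=1..M. \<Sum>l\<in>{1..<m}. zt i 0 l m) + 2 / real M * s"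
    by linarith

  have cesaro: "cesaro_sums ?a s"
    unfolding cesaro_sums_def bc
  proof -
    have "(\<lambda>n. (real M)\<^sup>2 * ((RC.variance (normalized_mean ?F \<mu> n) - batch_cov 0) / 2)) \<longlonglongrightarrow> s"
      unfolding s_def by (intro tendsto_mult_left tendsto_divide tendsto_diff var tendsto_const) simp
    moreover have "eventually (\<lambda>n. (real M)\<^sup>2 * ((RC.variance (normalized_mean ?F \<mu> n) - batch_cov 0) / 2)
        = (\<Sum>j<n. \<Sum>k<j. (real M)\<^sup>2 * batch_cov (Suc k)) / real n) sequentially"
      using eventually_gt_at_top[of 0]
    proof eventually_elim
      case (elim n)
      show ?case
        unfolding variance_normalized_mean[OF elim] sum_distrib_left[symmetric] by simp
    qed
    ultimately show "(\<lambda>n. (\<Sum>j<n. \<Sum>k<j. (real M)\<^sup>2 * batch_cov (Suc k)) / real n) \<longlonglongrightarrow> s"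
      by (rule Lim_transform_eventually)
  qed
  \<comment> \<open>Cesaro summability fixes the value; ordinary summability is given in the first
    case and follows from nonnegative terms in the second.\<close>
  have sums: "?a sums s" if "summable ?a \<or> standard_choice \<Omega> \<pi> N \<kappa> A"
  proof -
    have "summable ?a"
      using that
    proof
      assume sc: "standard_choice \<Omega> \<pi> N \<kappa> A"
      show ?thesis
        by (rule nonneg_cesaro_sums_summable[OF _ cesaro])
          (intro sum_nonneg standard_choice_zeta_nonneg[OF sc])
    qed
    then show ?thesis using cesaro by (rule summable_cesaro_sums)
  qed
  have "0 < \<sigma>" unfolding \<sigma>_def using M0 \<tau> by simp
  with clt formula cesaro sums show ?thesis by blast
qed

end

theorem lemma3p2:
  fixes \<Omega> :: "(real^'d) set"
    and \<pi> f :: "real^'d \<Rightarrow> real"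
    and N M i :: nat
    and \<kappa> :: "real^'d \<Rightarrow> (nat \<Rightarrow> real^'d) \<Rightarrow> real"
    and A :: "(nat \<Rightarrow> real^'d) \<Rightarrow> nat \<Rightarrow> nat \<Rightarrow> real"
    and K :: "(nat \<Rightarrow> real^'d) \<Rightarrow> (nat \<Rightarrow> real^'d) measure"
    and \<nu> :: "((real^'d) \<times> nat) measure"
    and \<mu> :: real
  assumes "mp_mcmc \<Omega> \<pi> N M \<kappa> A"
    and "\<nu> \<in> space (prob_algebra (state_space \<Omega> N))"
    and "f \<in> borel_measurable (restrict_space borel \<Omega>)"
    and "integrable (target \<Omega> \<pi>) (\<lambda>x. (f x)\<^sup>2)"
    and "\<mu> = (\<integral>x. f x * \<pi> x \<partial>restrict_space lborel \<Omega>)"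
    and "Z_markov \<Omega> N M \<kappa> A K"
    and "positive_harris (Om_pow \<Omega> M) K"
    and "well_behaved (stationary_simulation \<Omega> \<pi> N M \<kappa> A)
           (\<lambda>j \<omega>. batch_mean M f (chain_Z M j \<omega>)) \<mu>"
  shows "\<exists>\<sigma>>0. \<exists>s.
      weak_conv_m
        (\<lambda>n. distr (mp_simulation \<Omega> N M \<kappa> A \<nu>) borel
          (\<lambda>\<omega>. sqrt (real (n * M)) *
                ((\<Sum>j<n. \<Sum>m=1..M. f (sample M j m \<omega>)) / real (n * M) - \<mu>)))
        (centered_normal \<sigma>) \<and>
      \<sigma>\<^sup>2 = prob_space.variance (target \<Omega> \<pi>) f
         + 2 / real M * (\<Sum>m=1..M. \<Sum>l\<in>{1..<m}. zeta \<Omega> \<pi> N M \<kappa> A f i 0 l m)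
         + 2 / real M * s \<and>
      cesaro_sums (\<lambda>k. \<Sum>l=1..M. \<Sum>m=1..M. zeta \<Omega> \<pi> N M \<kappa> A f i (Suc k) l m) s \<and>
      (summable (\<lambda>k. \<Sum>l=1..M. \<Sum>m=1..M. zeta \<Omega> \<pi> N M \<kappa> A f i (Suc k) l m) \<or>
       standard_choice \<Omega> \<pi> N \<kappa> A \<longrightarrow>
         (\<lambda>k. \<Sum>l=1..M. \<Sum>m=1..M. zeta \<Omega> \<pi> N M \<kappa> A f i (Suc k) l m) sums s)"
proof -
  interpret mp_mcmc_functional \<Omega> \<pi> N M \<kappa> A f \<mu>
    using assms(1,3-5) by (intro mp_mcmc_functional.intro mp_mcmc_functional_axioms.intro)
  show ?thesis by (rule central_limit_theorem[OF assms(2,6-8)])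
qed

end
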